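(* Let $T>0$ be arbitrary, let $K$ be a radial potential on $\mathbb{R}^d$ with $\nabla K\in W^{1,\infty}(\mathbb{R}^d)$, and let $f_0\in\mathcal{P}_1(\mathbb{R}^d\times\mathbb{R}^d)$ have compact support. For $\epsilon>0$ let $f_\epsilon\in C([0,T);\mathcal{P}_1(\mathbb{R}^d\times\mathbb{R}^d))$ be the measure-valued solution of the kinetic equation $$\partial_t f_\epsilon+v\cdot\nabla_x f_\epsilon=\frac1\epsilon\nabla_v\cdot\big((v+\nabla_xK\ast\rho_\epsilon)f_\epsilon\big),\qquad f_\epsilon|_{t=0}=f_0,$$ where $\rho_\epsilon$ is the first marginal of $f_\epsilon$. Then there exists $\rho\in C([0,T);\mathcal{P}_1(\mathbb{R}^d))$ such that for each $t\in[0,T)$, $$\rho_\epsilon(t,\cdot)\to\rho(t,\cdot)\quad\text{in }\mathcal{P}_1(\mathbb{R}^d)\text{ with respect to } W_1,\text{ as }\epsilon\to0.$$ Moreover, $\rho$ is the unique weak solution of the initial value problem $$\rho_t-\nabla_x\cdot((\nabla_xK\ast\rho)\rho)=0,\qquad\rho|_{t=0}=\rho_0,$$ where $\rho_0$ is the first marginal of $f_0$; that is, $\rho$ satisfies $$\int_0^T\!\!\int_{\mathbb{R}^d}\partial_t\psi(t,x)\rho(t,x)\,dx\,dt-\int_0^T\!\!\int_{\mathbb{R}^d}\nabla_x\psi\cdot(\nabla_xK\ast\rho)\rho\,dx\,dt+\int_{\mathbb{R}^d}\psi(0,x)\rho_0(x)\,dx=0$$ for every $\psi\in C_c^1([0,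T);C_b^1(\mathbb{R}^d))$.
   Context: Convention: $\int\varphi(x)\mu(x)\,dx$ denotes the integral of $\varphi$ against the measure $\mu$, whether or not $\mu$ is absolutely continuous. $\mathcal{P}(\mathbb{R}^k)$ is the set of Borel probability measures and $\mathcal{P}_1(\mathbb{R}^k)$ the subset with finite first moment, endowed with the $1$-Wasserstein distance $W_1$; continuity in time with values in $\mathcal{P}_1$ is with respect to $W_1$. The first marginal $\rho$ of $f$ is defined by $\int_{\mathbb{R}^d}\tilde\psi(x)\rho(t,x)\,dx=\iint\tilde\psi(x)f(t,x,v)\,dx\,dv$ for all $\tilde\psi\in C_b(\mathbb{R}^d)$. "Radial" means that $K(x)$ depends only on $|x|$. Measure-valued solution of the kinetic equation (for fixed $\epsilon>0$): for a continuous vector field $E(t,x)$ on $[0,T]\times\mathbb{R}^d$, locally Lipschitz in $x$ and with $|E(t,x)|\le C(1+|x|)$ for some $C>0$, let $\mathcal{T}^{t,\epsilon}_E:(x_0,v_0)\mapsto(x(t),v(t))$ be the flow map of $\frac{dx}{dt}=v$, $\frac{dv}{dt}=-\frac1\epsilon v+\frac1\epsilon E(t,x)$, $(x,v)(0)=(x_0,v_0)$. For $f:[0,T]\to\mathcal{P}_1(\mathbb{R}^d\times\mathbb{R}^d)$ with first marginal $\rho$ put $E[f]=-\nabla K\ast\rho$. Then $f$ is a solution with initial condition $f_0$ if $E[f]$ is locally Lipschitz in $x$ and satisfies $|E[f](t,x)|\le C(1+|x|)$ on $[0,T]\times\mathbb{R}^d$ for some $C>0$, and $f(t)=\mathcal{T}^{t,\epsilon}_{E[f]}\#f_0$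 (push-forward) for all $t$. It is known (Cañizo–Carrillo–Rosado) that for compactly supported $f_0\in\mathcal{P}_1(\mathbb{R}^d\times\mathbb{R}^d)$ there is a unique solution $f_\epsilon\in C([0,\infty);\mathcal{P}_1(\mathbb{R}^d\times\mathbb{R}^d))$ in this sense whose support is contained, for $t\in[0,T]$, in a ball $B_{R_\epsilon(T)}$ with $R_\epsilon$ increasing; $f_\epsilon$ is this solution. Weak solutions of the macroscopic problem are sought among $\rho\in C([0,T);\mathcal{P}(\mathbb{R}^d))$, with time continuity in the narrow sense ($t\mapsto\int\varphi\,\rho(t)\,dx$ is continuous for every $\varphi\in C_b(\mathbb{R}^d)$). $C^1_b$ denotes $C^1$ functions bounded together with their first derivatives. *)

theory Defs
  imports "HOL-Probability.Probability"
begin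

definition prob_measures :: "'a::euclidean_space measure set" where
  "prob_measures = {\<mu>. prob_space \<mu> \<and> sets \<mu> = sets borel}"

definition prob_measures_1 :: "'a::euclidean_space measure set" where
  "prob_measures_1 = {\<mu> \<in> prob_measures. integrable \<mu> norm}"

definition couplings ::
  "'a::euclidean_space measure \<Rightarrow> 'a measure \<Rightarrow> ('a \<times> 'a) measure set" where
  "couplings \<mu> \<nu> =
     {\<pi> \<in> prob_measures. distr \<pi> borel fst = \<mu> \<and> distr \<pi> borel snd = \<nu>}"

definition W1 :: "'a::euclidean_space measure \<Rightarrow> 'a measure \<Rightarrow> ennreal" where
  "W1 \<mu> \<nu> = (INF \<pi> \<in> couplings \<mu> \<nu>. \<integral>\<^sup>+ p. ennreal (dist (fst p) (snd p)) \<partial>\<pi>)"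

definition C_P1 :: "real set \<Rightarrow> (real \<Rightarrow> 'a::euclidean_space measure) set" where
  "C_P1 I = {\<mu>. (\<forall>t\<in>I. \<mu> t \<in> prob_measures_1) \<and>
                (\<forall>t\<in>I. ((\<lambda>s. W1 (\<mu> s) (\<mu> t)) \<longlongrightarrow> 0) (at t within I))}"

definition C_P_narrow :: "real set \<Rightarrow> (real \<Rightarrow> 'a::euclidean_space measure) set" where
  "C_P_narrow I = {\<mu>. (\<forall>t\<in>I. \<mu> t \<in> prob_measures) \<and>
     (\<forall>\<phi> :: 'a \<Rightarrow> real. continuous_on UNIV \<phi> \<and> bounded (range \<phi>) \<longrightarrow>
        continuous_on I (\<lambda>t. \<integral>x. \<phi> x \<partial>\<mu> t))}"

definition msupport :: "'a::euclidean_space measure \<Rightarrow> 'a set" where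
  "msupport \<mu> = {x. \<forall>U. open U \<and> x \<in> U \<longrightarrow> emeasure \<mu> U > 0}"

definition first_marginal ::
  "('a::euclidean_space \<times> 'a) measure \<Rightarrow> 'a measure" where
  "first_marginal f = distr f borel fst"

definition conv_measure ::
  "('a::euclidean_space \<Rightarrow> 'a) \<Rightarrow> 'a measure \<Rightarrow> 'a \<Rightarrow> 'a" where
  "conv_measure G \<mu> x = (\<integral>y. G (x - y) \<partial>\<mu>)"

definition grad :: "('a::euclidean_space \<Rightarrow> real) \<Rightarrow> 'a \<Rightarrow> 'a" where
  "grad \<phi> x = (\<Sum>i\<in>Basis. frechet_derivative \<phi> (at x) i *\<^sub>R i)"

primrec Ck :: "nat \<Rightarrow> ('a::euclidean_space \<Rightarrow> real) \<Rightarrow> bool" where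
  "Ck 0 \<phi> \<longleftrightarrow> continuous_on UNIV \<phi>"
| "Ck (Suc k) \<phi> \<longleftrightarrow>
     (\<forall>x. \<phi> differentiable (at x)) \<and> (\<forall>i\<in>Basis. Ck k (\<lambda>x. grad \<phi> x \<bullet> i))"

definition Cc_infinity :: "('a::euclidean_space \<Rightarrow> real) set" where
  "Cc_infinity = {\<phi>. (\<forall>k. Ck k \<phi>) \<and> compact (closure {x. \<phi> x \<noteq> 0})}"

definition locally_integrable :: "('a::euclidean_space \<Rightarrow> real) \<Rightarrow> bool" where
  "locally_integrable u \<longleftrightarrow> (\<forall>S. compact S \<longrightarrow> u absolutely_integrable_on S)"

definition weak_partial ::
  "'a::euclidean_space \<Rightarrow> ('a \<Rightarrow> real) \<Rightarrow> ('a \<Rightarrow> real) \<Rightarrow> bool" where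
  "weak_partial i u g \<longleftrightarrow>
     locally_integrable u \<and> locally_integrable g \<and>
     (\<forall>\<phi>\<in>Cc_infinity.
        (\<integral>x. u x * (grad \<phi> x \<bullet> i) \<partial>lebesgue) = - (\<integral>x. g x * \<phi> x \<partial>lebesgue))"

text \<open>The field \<open>G\<close> is determined only almost everywhere. Since \<open>\<nabla>K\<close> is convolved with measures
  that may be singular, its values at single points matter: \<open>G\<close> is then to be the continuous
  representative, which exists and is unique for components in \<open>W_1_infinity\<close>.\<close>

definition weak_gradient ::
  "('a::euclidean_space \<Rightarrow> real) \<Rightarrow> ('a \<Rightarrow> 'a) \<Rightarrow> bool" where
  "weak_gradient u G \<longleftrightarrow> (\<forall>i\<in>Basis. weak_partial i u (\<lambda>x. G x \<bullet> i))"

definition L_infinity :: "('a::euclidean_space \<Rightarrow> real) set" where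
  "L_infinity = {u. u \<in> borel_measurable lebesgue \<and>
                    (\<exists>M. AE x in lebesgue. \<bar>u x\<bar> \<le> M)}"

definition W_1_infinity :: "('a::euclidean_space \<Rightarrow> real) set" where
  "W_1_infinity = {u \<in> L_infinity. \<forall>i\<in>Basis. \<exists>g\<in>L_infinity. weak_partial i u g}"

definition radial :: "('a::euclidean_space \<Rightarrow> real) \<Rightarrow> bool" where
  "radial K \<longleftrightarrow> (\<exists>k. \<forall>x. K x = k (norm x))"

text \<open>Only the value at time \<open>t\<close> is selected by \<open>THE\<close>, so solutions of the characteristic system
  matter on \<open>[0,t]\<close> only. For \<open>E\<close> continuous, locally Lipschitz in \<open>x\<close> and of linear growth, the
  value exists and is unique.\<close>

definition flow_map ::
  "real \<Rightarrow> (real \<Rightarrow> 'a::euclidean_space \<Rightarrow> 'a) \<Rightarrow> real \<Rightarrow> 'a \<times> 'a \<Rightarrow> 'a \<times> 'a" where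
  "flow_map \<epsilon> E t z0 = (THE z1. \<exists>x v.
     (x 0, v 0) = z0 \<and>
     (\<forall>s\<in>{0..t}. (x has_vector_derivative v s) (at s within {0..t}) \<and>
        (v has_vector_derivative (- (1/\<epsilon>) *\<^sub>R v s + (1/\<epsilon>) *\<^sub>R E s (x s))) (at s within {0..t})) \<and>
     z1 = (x t, v t))"

text \<open>In the remaining definitions, \<open>G\<close> stands for \<open>\<nabla>K\<close>.\<close>

definition force_field ::
  "('a::euclidean_space \<Rightarrow> 'a) \<Rightarrow> (real \<Rightarrow> ('a \<times> 'a) measure) \<Rightarrow> real \<Rightarrow> 'a \<Rightarrow> 'a" where
  "force_field G f t x = - conv_measure G (first_marginal (f t)) x"

definition kinetic_solution ::
  "real \<Rightarrow> real \<Rightarrow> ('a::euclidean_space \<Rightarrow> 'a) \<Rightarrow> ('a \<times> 'a) measure \<Rightarrow>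
     (real \<Rightarrow> ('a \<times> 'a) measure) \<Rightarrow> bool" where
  "kinetic_solution T \<epsilon> G f0 f \<longleftrightarrow>
     (\<forall>t\<in>{0..T}. f t \<in> prob_measures_1) \<and>
     local_lipschitz {0..T} UNIV (force_field G f) \<and>
     (\<exists>C>0. \<forall>t\<in>{0..T}. \<forall>x. norm (force_field G f t x) \<le> C * (1 + norm x)) \<and>
     (\<forall>t\<in>{0..T}. f t = distr f0 borel (flow_map \<epsilon> (force_field G f) t))"

definition C1b :: "('a::euclidean_space \<Rightarrow> real) set" where
  "C1b = {\<phi>. Ck 1 \<phi> \<and> bounded (range \<phi>) \<and> bounded (range (grad \<phi>))}"

definition C1b_norm :: "('a::euclidean_space \<Rightarrow> real) \<Rightarrow> real" where
  "C1b_norm \<phi> = (SUP x. \<bar>\<phi> x\<bar>) + (SUP x. norm (grad \<phi> x))"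

text \<open>\<open>C1c_C1b T \<psi> \<psi>'\<close>: the map \<open>\<psi>\<close> from \<open>[0,T)\<close> to the Banach space \<open>C1b\<close> is continuously
  differentiable with derivative \<open>\<psi>'\<close>, and its support is a compact subset of \<open>[0,T)\<close>
  (which does not force \<open>\<psi> 0 = 0\<close>).\<close>

definition C1c_C1b ::
  "real \<Rightarrow> (real \<Rightarrow> 'a::euclidean_space \<Rightarrow> real) \<Rightarrow> (real \<Rightarrow> 'a \<Rightarrow> real) \<Rightarrow> bool" where
  "C1c_C1b T \<psi> \<psi>' \<longleftrightarrow>
     (\<forall>t\<in>{0..<T}. \<psi> t \<in> C1b \<and> \<psi>' t \<in> C1b) \<and>
     (\<forall>t\<in>{0..<T}. ((\<lambda>s. C1b_norm (\<lambda>x. (\<psi> s x - \<psi> t x) / (s - t) - \<psi>' t x)) \<longlongrightarrow> 0)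
        (at t within {0..<T})) \<and>
     (\<forall>t\<in>{0..<T}. ((\<lambda>s. C1b_norm (\<lambda>x. \<psi>' s x - \<psi>' t x)) \<longlongrightarrow> 0) (at t within {0..<T})) \<and>
     (\<exists>S<T. \<forall>t\<in>{0..<T}. S < t \<longrightarrow> (\<forall>x. \<psi> t x = 0))"

definition weak_solution ::
  "real \<Rightarrow> ('a::euclidean_space \<Rightarrow> 'a) \<Rightarrow> 'a measure \<Rightarrow> (real \<Rightarrow> 'a measure) \<Rightarrow> bool" where
  "weak_solution T G \<rho>0 \<rho> \<longleftrightarrow>
     \<rho> \<in> C_P_narrow {0..<T} \<and>
     (\<forall>\<psi> \<psi>'. C1c_C1b T \<psi> \<psi>' \<longrightarrow>
        (LINT t:{0..<T}|lborel. (\<integral>x. \<psi>' t x \<partial>\<rho> t))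
        - (LINT t:{0..<T}|lborel. (\<integral>x. grad (\<psi> t) x \<bullet> conv_measure G (\<rho> t) x \<partial>\<rho> t))
        + (\<integral>x. \<psi> 0 x \<partial>\<rho>0) = 0)"

end

theory Submission imports Defs begin

text \<open>The dynamics is governed by a field \<open>\<nabla>K\<close> that is bounded and globally Lipschitz. This follows from continuity together with \<open>W\<^sup>1\<^sup>,\<^sup>\<infinity>\<close> regularity: a mollification has
  partial derivatives bounded by the weak ones, and the bound survives as the mollification radius
  tends to zero (\<open>W_1_infinity_field_bounded_lipschitz\<close>). The locale \<open>lipschitz_field\<close> fixes the
  field \<open>G\<close>, its bound \<open>M\<close> and its Lipschitz constant \<open>L\<close>.

  \<^bold>\<open>The limit.\<close> The macroscopic equation transports the initial measure along
  \<open>X' = - \<integral> G (X - X(y)) d\<rho>\<^sub>0(y)\<close>. As \<open>G\<close> is bounded, the displacement \<open>X\<^sub>t - id\<close> stays in the Banach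
  space of bounded continuous functions, where this is an ordinary differential equation with a
  Lipschitz right-hand side; so the Picard iteration (\<open>ode_existence\<close>) produces the whole flow at
  once. Its image measures \<open>\<rho>(t)\<close> solve the equation weakly by the chain rule along single
  trajectories and Fubini (\<open>\<rho>_weak_solution\<close>).

  \<^bold>\<open>Convergence.\<close> Along kinetic characteristics the combination \<open>x + \<epsilon> v\<close> has velocity
  \<open>- (\<nabla>K * \<rho>\<^sub>\<epsilon>)(x)\<close>: the stiff friction term cancels. Friction keeps \<open>\<bar>v\<bar> \<le> \<bar>v\<^sub>0\<bar> + M\<close>, hence \<open>x\<close> solves the
  first-order equation up to an error of order \<open>\<epsilon> (1 + \<bar>v\<^sub>0\<bar>)\<close>. A Gronwall argument compares \<open>x\<close>
  with \<open>X\<close> started at the same point, and transporting both by the same \<open>f\<^sub>0\<close> is a coupling, which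
  gives \<open>W\<^sub>1 = O(\<epsilon>)\<close> (\<open>kinetic_limit_rate\<close>).

  \<^bold>\<open>Uniqueness.\<close> The classical duality proof tests the equation with functions transported backwards by
  the flow of the solution. Here that flow is merely Lipschitz in space, so such functions are not
  admissible. They are replaced by compositions with explicit Euler steps \<open>x + \<delta> V(x)\<close>, where \<open>V\<close> is a
  mollified velocity. This preserves the class of functions with Lipschitz gradient, with constants
  that stay bounded over \<open>\<tau>/\<delta>\<close> steps (\<open>C11_compose_euler_step\<close>). Over one step a weak solution differs
  from the Euler push-forward by the mollification error times \<open>\<delta>\<close>, plus \<open>O(\<delta>\<^sup>2)\<close> (\<open>euler_step\<close>).
  Letting first \<open>\<delta>\<close> and then the mollification radius tend to zero leaves a Gronwall inequality for the
  dual Lipschitz distance of two solutions (\<open>euler_chain\<close>), which forces it to vanish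
  (\<open>weak_solution_unique\<close>).\<close>

section \<open>Gronwall estimates and ordinary differential equations\<close>

text \<open>Gronwall's inequality in the form used throughout. With \<open>e\<close> a distance weighted by \<open>exp (- \<lambda> t)\<close>, an
  integral inequality with rate \<open>\<lambda> / 2\<close> turns the bound \<open>\<theta>\<close> into \<open>b + \<theta> / 2\<close>; the least bound then
  satisfies \<open>\<theta> \<le> b + \<theta> / 2\<close>. A crude a priori bound \<open>c\<close> makes the supremum finite.\<close>

lemma halving_bound:
  fixes e :: "'i \<Rightarrow> real"
  assumes "\<And>i. i \<in> A \<Longrightarrow> e i \<le> c" and "0 \<le> b"
    and step: "\<And>\<theta>. 0 \<le> \<theta> \<Longrightarrow> (\<And>i. i \<in> A \<Longrightarrow> e i \<le> \<theta>) \<Longrightarrow> (\<And>i. i \<in> A \<Longrightarrow> e i \<le> b + \<theta> / 2)"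
    and "i \<in> A"
  shows "e i \<le> 2 * b"
proof -
  define \<theta> where "\<theta> = max 0 (SUP i\<in>A. e i)"
  have bdd: "bdd_above (e ` A)"
    using assms(1) by (auto simp: bdd_above_def)
  have le: "e j \<le> \<theta>" if "j \<in> A" for j
    using cSUP_upper[OF that bdd] by (simp add: \<theta>_def)
  have "(SUP i\<in>A. e i) \<le> b + \<theta> / 2"
    using \<open>i \<in> A\<close> step[OF _ le] by (intro cSUP_least) (auto simp: \<theta>_def)
  then have "\<theta> \<le> 2 * b"
    using \<open>0 \<le> b\<close> by (auto simp: \<theta>_def max_def split: if_splits)
  then show ?thesis
    using le[OF \<open>i \<in> A\<close>] by linarith
qed

text \<open>The mean value inequality with a majorant \<open>\<phi>\<close>. All integral estimates along trajectories go through
  it, so no integral of a trajectory has to be formed.\<close>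

lemma norm_diff_le_of_derivative_le:
  fixes f :: "real \<Rightarrow> 'b::real_normed_vector"
  assumes "\<And>r. r \<in> {a..b} \<Longrightarrow> (f has_vector_derivative f' r) (at r within {a..b})"
    and "\<And>r. r \<in> {a..b} \<Longrightarrow> (\<phi> has_vector_derivative \<phi>' r) (at r within {a..b})"
    and "\<And>r. r \<in> {a..b} \<Longrightarrow> norm (f' r) \<le> \<phi>' r"
    and "s \<in> {a..b}" "t \<in> {a..b}" "s \<le> t"
  shows "norm (f t - f s) \<le> \<phi> t - \<phi> s"
proof (cases "s = t")
  case False
  have 1: "(f has_vector_derivative f' r) (at r)" if "s < r" "r < t" for r
    using assms(1)[of r] assms(4,5) that at_within_interior[of r "{a..b}"] by auto
  have 2: "(\<phi> has_vector_derivative \<phi>' r) (at r)" if "s < r" "r < t" for r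
    using assms(2)[of r] assms(4,5) that at_within_interior[of r "{a..b}"] by auto
  have "continuous_on {a..b} f" "continuous_on {a..b} \<phi>"
    by (rule continuous_on_vector_derivative, rule assms, assumption)+
  then have "continuous_on {s..t} f" "continuous_on {s..t} \<phi>"
    using assms(4,5) by (auto elim!: continuous_on_subset)
  then show ?thesis
    using False assms by (intro differentiable_bound_general[where f' = f' and \<phi>' = \<phi>'] 1 2) auto
qed simp

lemma has_vector_derivative_exp_weight:
  "l \<noteq> 0 \<Longrightarrow> ((\<lambda>s. c * exp (l * s) / l) has_vector_derivative c * exp (l * t)) (at t within A)"
  for l c t :: real
  unfolding has_real_derivative_iff_has_vector_derivative[symmetric]
  by (auto intro!: derivative_eq_intros)

lemma ode_dependence:
  fixes x y :: "real \<Rightarrow> 'b::real_normed_vector"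
  assumes x: "\<And>s. s \<in> {0..T} \<Longrightarrow> (x has_vector_derivative F s (x s)) (at s within {0..T})"
    and y: "\<And>s. s \<in> {0..T} \<Longrightarrow> (y has_vector_derivative F s (y s)) (at s within {0..T})"
    and lip: "\<And>s a b. s \<in> {0..T} \<Longrightarrow> norm (F s a - F s b) \<le> \<Lambda> * norm (a - b)"
    and "\<Lambda> > 0" and t: "t \<in> {0..T}"
  shows "norm (x t - y t) \<le> 2 * norm (x 0 - y 0) * exp (2 * \<Lambda> * t)"
proof -
  define d where "d s = x s - y s" for s
  define e where "e s = norm (d s) * exp (- (2 * \<Lambda> * s))" for s
  have "continuous_on {0..T} x" "continuous_on {0..T} y"
    by (rule continuous_on_vector_derivative, rule x y, assumption)+
  then have "continuous_on {0..T} e"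
    unfolding e_def d_def by (intro continuous_intros)
  then obtain c where c: "\<And>s. s \<in> {0..T} \<Longrightarrow> e s \<le> c"
    using t continuous_attains_sup[of "{0..T}" e] by (metis compact_Icc empty_iff)
  have dd: "(d has_vector_derivative F s (x s) - F s (y s)) (at s within {0..T})" if "s \<in> {0..T}" for s
    unfolding d_def using x[OF that] y[OF that] by (rule has_vector_derivative_diff)
  have "e t \<le> 2 * norm (d 0)"
  proof (rule halving_bound[where A = "{0..T}" and e = e, OF c _ _ t])
    fix \<theta> s assume "0 \<le> \<theta>" and \<theta>: "\<And>i. i \<in> {0..T} \<Longrightarrow> e i \<le> \<theta>" and s: "s \<in> {0..T}"
    have d\<theta>: "norm (d r) \<le> \<theta> * exp (2 * \<Lambda> * r)" if "r \<in> {0..T}" for r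
      using \<theta>[OF that] by (simp add: e_def exp_minus field_simps)
    have "norm (d s - d 0) \<le> \<Lambda> * \<theta> * exp (2 * \<Lambda> * s) / (2 * \<Lambda>) - \<Lambda> * \<theta> * exp (2 * \<Lambda> * 0) / (2 * \<Lambda>)"
    proof (rule norm_diff_le_of_derivative_le[where a = 0 and b = T])
      fix r assume r: "r \<in> {0..T}"
      show "(d has_vector_derivative F r (x r) - F r (y r)) (at r within {0..T})"
        by (rule dd[OF r])
      show "((\<lambda>s. \<Lambda> * \<theta> * exp (2 * \<Lambda> * s) / (2 * \<Lambda>)) has_vector_derivative \<Lambda> * \<theta> * exp (2 * \<Lambda> * r)) (at r within {0..T})"
        using \<open>\<Lambda> > 0\<close> by (intro has_vector_derivative_exp_weight) simp
      have "norm (F r (x r) - F r (y r)) \<le> \<Lambda> * norm (d r)"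
        using lip[OF r] by (simp add: d_def)
      also have "\<dots> \<le> \<Lambda> * (\<theta> * exp (2 * \<Lambda> * r))"
        using \<open>\<Lambda> > 0\<close> d\<theta>[OF r] by (intro mult_left_mono) auto
      finally show "norm (F r (x r) - F r (y r)) \<le> \<Lambda> * \<theta> * exp (2 * \<Lambda> * r)"
        by (simp add: mult.assoc)
    qed (use s in auto)
    also have "\<dots> \<le> \<theta> / 2 * exp (2 * \<Lambda> * s)"
      using \<open>\<Lambda> > 0\<close> \<open>0 \<le> \<theta>\<close> by (simp add: field_simps)
    finally have "norm (d s) \<le> norm (d 0) + \<theta> / 2 * exp (2 * \<Lambda> * s)"
      using norm_triangle_sub[of "d s" "d 0"] by linarith
    also have "\<dots> \<le> (norm (d 0) + \<theta> / 2) * exp (2 * \<Lambda> * s)"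
      using \<open>\<Lambda> > 0\<close> s by (simp add: distrib_right mult_ge1_I mult_le_cancel_left1)
    finally show "e s \<le> norm (d 0) + \<theta> / 2"
      by (simp add: e_def exp_minus field_simps)
  qed auto
  then show ?thesis
    by (simp add: e_def d_def exp_minus field_simps)
qed

text \<open>Picard iteration in the norm weighted by \<open>exp (- 2 \<Lambda> t)\<close>, for which the integral operator
  contracts with factor \<open>1/2\<close> on all of \<open>[0,T]\<close>, however long this interval is. The
  state space is an arbitrary Banach space: it is \<open>\<real>\<^sup>d \<times> \<real>\<^sup>d\<close> for the kinetic characteristics and a
  space of displacement fields for the mean-field flow.\<close>

theorem ode_existence:
  fixes F :: "real \<Rightarrow> 'b::banach \<Rightarrow> 'b"
  assumes cont: "continuous_on ({0..T} \<times> UNIV) (\<lambda>(t, x). F t x)"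
    and lip: "\<And>s a b. s \<in> {0..T} \<Longrightarrow> norm (F s a - F s b) \<le> \<Lambda> * norm (a - b)"
    and "\<Lambda> > 0" "T \<ge> 0"
  obtains x where "x 0 = x0"
    "\<And>s. s \<in> {0..T} \<Longrightarrow> (x has_vector_derivative F s (x s)) (at s within {0..T})"
proof -
  \<comment> \<open>Time is clamped to \<open>[0,T]\<close>, so that continuous functions of it are bounded on the whole line.\<close>
  define c where "c t = max 0 (min T t)" for t
  have c_in: "c t \<in> {0..T}" for t
    using \<open>T \<ge> 0\<close> by (auto simp: c_def)
  have c_cont: "continuous_on UNIV c"
    unfolding c_def by (intro continuous_intros)
  define g where "g Y s = F s (exp (2 * \<Lambda> * s) *\<^sub>R apply_bcontfun Y s)" for Y :: "real \<Rightarrow>\<^sub>C 'b" and s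
  have g_cont: "continuous_on {0..T} (g Y)" for Y
    unfolding g_def
    by (rule continuous_on_compose2[OF cont, where f = "\<lambda>s. (s, exp (2 * \<Lambda> * s) *\<^sub>R apply_bcontfun Y s)", simplified])
       (auto intro!: continuous_intros)
  \<comment> \<open>The fixed point is sought for \<open>Y t = exp (- 2 \<Lambda> t) x t\<close>.\<close>
  define H where "H Y t = exp (- (2 * \<Lambda> * t)) *\<^sub>R (x0 + integral {0..t} (g Y))" for Y t
  have H_cont: "continuous_on {0..T} (H Y)" for Y
    unfolding H_def by (intro continuous_intros indefinite_integral_continuous_1 integrable_continuous_interval g_cont)
  have HC: "(\<lambda>t. H Y (c t)) \<in> bcontfun" for Y
  proof -
    have "compact (H Y ` {0..T})"
      by (intro compact_continuous_image H_cont compact_Icc)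
    then obtain b where b: "\<And>t. t \<in> {0..T} \<Longrightarrow> norm (H Y t) \<le> b"
      using compact_imp_bounded bounded_iff by (metis imageI)
    show ?thesis
      using b c_in c_cont
      by (intro bcontfun_normI[where b = b] continuous_on_compose2[OF H_cont]) auto
  qed
  define \<Phi> where "\<Phi> Y = Bcontfun (\<lambda>t. H Y (c t))" for Y
  have \<Phi>: "apply_bcontfun (\<Phi> Y) t = H Y (c t)" for Y t
    unfolding \<Phi>_def by (simp add: Bcontfun_inverse[OF HC])
  have "dist (\<Phi> Y) (\<Phi> Z) \<le> 1/2 * dist Y Z" for Y Z
  proof -
    have HYZ: "norm (H Y t - H Z t) \<le> 1/2 * norm (Y - Z)" if t: "t \<in> {0..T}" for t
    proof -
      let ?N = "norm (Y - Z)"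
      define D where "D s = integral {0..s} (g Y) - integral {0..s} (g Z)" for s
      have "norm (D t - D 0) \<le> \<Lambda> * ?N * exp (2 * \<Lambda> * t) / (2 * \<Lambda>) - \<Lambda> * ?N * exp (2 * \<Lambda> * 0) / (2 * \<Lambda>)"
      proof (rule norm_diff_le_of_derivative_le[where a = 0 and b = T])
        fix r assume r: "r \<in> {0..T}"
        show "(D has_vector_derivative g Y r - g Z r) (at r within {0..T})"
          unfolding D_def
          by (intro has_vector_derivative_diff integral_has_vector_derivative g_cont r)
        show "((\<lambda>s. \<Lambda> * ?N * exp (2 * \<Lambda> * s) / (2 * \<Lambda>)) has_vector_derivative \<Lambda> * ?N * exp (2 * \<Lambda> * r)) (at r within {0..T})"
          using \<open>\<Lambda> > 0\<close> by (intro has_vector_derivative_exp_weight) simp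
        have "norm (g Y r - g Z r) \<le> \<Lambda> * norm (exp (2 * \<Lambda> * r) *\<^sub>R apply_bcontfun Y r - exp (2 * \<Lambda> * r) *\<^sub>R apply_bcontfun Z r)"
          unfolding g_def by (rule lip[OF r])
        also have "\<dots> = \<Lambda> * (exp (2 * \<Lambda> * r) * norm (apply_bcontfun (Y - Z) r))"
          by (simp flip: scaleR_diff_right)
        also have "\<dots> \<le> \<Lambda> * (exp (2 * \<Lambda> * r) * ?N)"
          using \<open>\<Lambda> > 0\<close> by (intro mult_left_mono norm_bounded) auto
        finally show "norm (g Y r - g Z r) \<le> \<Lambda> * ?N * exp (2 * \<Lambda> * r)"
          by (simp add: mult_ac)
      qed (use t in auto)
      also have "\<dots> \<le> 1/2 * ?N * exp (2 * \<Lambda> * t)"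
        using \<open>\<Lambda> > 0\<close> by (simp add: field_simps)
      finally have *: "norm (D t) \<le> 1/2 * ?N * exp (2 * \<Lambda> * t)"
        by (simp add: D_def)
      have "H Y t - H Z t = exp (- (2 * \<Lambda> * t)) *\<^sub>R D t"
        by (simp add: H_def D_def flip: scaleR_diff_right)
      then show ?thesis
        using * by (simp add: exp_minus field_simps)
    qed
    show ?thesis
      unfolding dist_norm
    proof (rule norm_bound)
      show "norm (apply_bcontfun (\<Phi> Y - \<Phi> Z) t) \<le> 1/2 * norm (Y - Z)" for t
        using HYZ[OF c_in[of t]] by (simp add: \<Phi>)
    qed
  qed
  then obtain Y where Y: "\<Phi> Y = Y"
    using banach_fix_type[of "1/2" \<Phi>] by auto
  define x where "x t = x0 + integral {0..t} (g Y)" for t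
  have "apply_bcontfun Y t = exp (- (2 * \<Lambda> * t)) *\<^sub>R x t" if "t \<in> {0..T}" for t
  proof -
    have "c t = t" using that by (auto simp: c_def)
    then show ?thesis using \<Phi>[of Y t] by (simp add: Y H_def x_def)
  qed
  then have gx: "g Y t = F t (x t)" if "t \<in> {0..T}" for t
    using that by (simp add: g_def exp_minus)
  show thesis
  proof (rule that[of x])
    show "x 0 = x0" by (simp add: x_def)
    show "(x has_vector_derivative F s (x s)) (at s within {0..T})" if "s \<in> {0..T}" for s
      using integral_has_vector_derivative[OF g_cont that, of Y] gx[OF that]
      by (auto simp: x_def[abs_def] intro!: derivative_eq_intros)
  qed
qed

section \<open>Smooth bump functions\<close>

lemma grad_inner:
  assumes "(f has_derivative f') (at x)"
  shows "grad f x \<bullet> v = f' v"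
proof -
  interpret bounded_linear f' using assms by (rule has_derivative_bounded_linear)
  have "frechet_derivative f (at x) = f'"
    using frechet_derivative_at[OF assms] by simp
  then have "grad f x \<bullet> v = (\<Sum>i\<in>Basis. f' i * (i \<bullet> v))"
    by (simp add: grad_def inner_sum_left)
  also have "\<dots> = f' (\<Sum>i\<in>Basis. (v \<bullet> i) *\<^sub>R i)"
    unfolding sum scaleR by (simp add: inner_commute[of v] mult.commute)
  finally show ?thesis
    by (simp add: euclidean_representation)
qed

lemma Ck_SucI:
  assumes "\<And>x. (f has_derivative f' x) (at x)"
    and "\<And>i. i \<in> Basis \<Longrightarrow> Ck n (\<lambda>x. f' x i)"
  shows "Ck (Suc n) f"
  using assms by (auto simp: differentiable_def grad_inner[OF assms(1)])

lemma Ck_SucD: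
  assumes "Ck (Suc n) f"
  obtains f' where "\<And>x. (f has_derivative f' x) (at x)" "\<And>i. i \<in> Basis \<Longrightarrow> Ck n (\<lambda>x. f' x i)"
proof -
  have d: "(f has_derivative frechet_derivative f (at x)) (at x)" for x
    using assms by (auto simp: frechet_derivative_works)
  show thesis
    using assms grad_inner[OF d] by (intro that[OF d]) auto
qed

lemma Ck_Suc_imp_Ck: "Ck (Suc n) f \<Longrightarrow> Ck n f"
proof (induction n arbitrary: f)
  case 0
  then show ?case
    by (auto simp: continuous_on_eq_continuous_at differentiable_imp_continuous_within)
next
  case (Suc n)
  obtain f' where f': "\<And>x. (f has_derivative f' x) (at x)" "\<And>i. i \<in> Basis \<Longrightarrow> Ck (Suc n) (\<lambda>x. f' x i)"
    using Suc.prems by (rule Ck_SucD) blast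
  show ?case
    by (rule Ck_SucI[OF f'(1)]) (rule Suc.IH[OF f'(2)])
qed

lemma Ck_const [simp]: "Ck n (\<lambda>x. c)"
proof (induction n arbitrary: c)
  case (Suc n)
  show ?case by (rule Ck_SucI[where f' = "\<lambda>x h. 0"]) (auto intro: Suc)
qed simp

lemma Ck_add: "Ck n f \<Longrightarrow> Ck n g \<Longrightarrow> Ck n (\<lambda>x. f x + g x)"
proof (induction n arbitrary: f g)
  case 0
  then show ?case by (auto intro: continuous_on_add)
next
  case (Suc n)
  obtain f' where f': "\<And>x. (f has_derivative f' x) (at x)" "\<And>i. i \<in> Basis \<Longrightarrow> Ck n (\<lambda>x. f' x i)"
    using Suc.prems(1) by (rule Ck_SucD) blast
  obtain g' where g': "\<And>x. (g has_derivative g' x) (at x)" "\<And>i. i \<in> Basis \<Longrightarrow> Ck n (\<lambda>x. g' x i)"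
    using Suc.prems(2) by (rule Ck_SucD) blast
  show ?case
    by (rule Ck_SucI[OF has_derivative_add[OF f'(1) g'(1)]]) (intro Suc.IH f'(2) g'(2))
qed

lemma Ck_mult: "Ck n f \<Longrightarrow> Ck n g \<Longrightarrow> Ck n (\<lambda>x. f x * g x)"
proof (induction n arbitrary: f g)
  case 0
  then show ?case by (auto intro: continuous_on_mult)
next
  case (Suc n)
  obtain f' where f': "\<And>x. (f has_derivative f' x) (at x)" "\<And>i. i \<in> Basis \<Longrightarrow> Ck n (\<lambda>x. f' x i)"
    using Suc.prems(1) by (rule Ck_SucD) blast
  obtain g' where g': "\<And>x. (g has_derivative g' x) (at x)" "\<And>i. i \<in> Basis \<Longrightarrow> Ck n (\<lambda>x. g' x i)"
    using Suc.prems(2) by (rule Ck_SucD) blast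
  show ?case
    by (rule Ck_SucI[OF has_derivative_mult[OF f'(1) g'(1)]])
       (intro Ck_add Suc.IH f'(2) g'(2) Suc.prems[THEN Ck_Suc_imp_Ck])
qed

lemma Ck_inner_diff: "Ck n (\<lambda>x. (x - a) \<bullet> v)"
proof (cases n)
  case 0
  then show ?thesis by (auto intro!: continuous_intros)
next
  case (Suc m)
  show ?thesis unfolding Suc
    by (rule Ck_SucI[where f' = "\<lambda>x h. h \<bullet> v"]) (auto intro!: derivative_eq_intros)
qed

text \<open>With the extra power of \<open>s\<close> in the denominator this family of functions, flat at \<open>0\<close>, is closed under
  differentiation up to linear combinations, which makes smoothness an induction.\<close>

definition flat_exp :: "nat \<Rightarrow> real \<Rightarrow> real" where
  "flat_exp k s = (if s > 0 then exp (- 1 / s) / s ^ k else 0)"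

lemma flat_exp_nonneg: "flat_exp k s \<ge> 0"
  by (simp add: flat_exp_def)

lemma flat_exp_tendsto_0: "(flat_exp k \<longlongrightarrow> 0) (at 0)"
proof -
  have "((\<lambda>s. exp (- 1 / s) / s ^ k) \<longlongrightarrow> 0) (at_right (0::real))"
    unfolding filterlim_at_right_to_top
    using tendsto_power_div_exp_0[of k] by (simp add: field_simps exp_minus)
  then have "(flat_exp k \<longlongrightarrow> 0) (at_right 0)"
    by (rule Lim_transform_eventually) (auto simp: flat_exp_def eventually_at_right_less eventually_at intro!: exI[of _ 1])
  moreover have "(flat_exp k \<longlongrightarrow> 0) (at_left 0)"
    by (rule tendsto_eventually) (auto simp: flat_exp_def eventually_at intro!: exI[of _ 1])
  ultimately show ?thesis
    by (simp add: filterlim_split_at)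
qed

text \<open>At \<open>0\<close> the difference quotient of \<open>flat_exp k\<close> is \<open>flat_exp (Suc k)\<close>, which tends to zero.\<close>

lemma flat_exp_has_derivative:
  "(flat_exp k has_real_derivative flat_exp (k + 2) s - real k * flat_exp (Suc k) s) (at s)"
proof -
  consider "s > 0" | "s < 0" | "s = 0" by linarith
  then show ?thesis
  proof cases
    case 1
    have "((\<lambda>s. exp (- 1 / s) / s ^ k) has_real_derivative
        (exp (- 1 / s) * (1 / s\<^sup>2) * s ^ k - exp (- 1 / s) * (real k * s ^ (k - 1))) / (s ^ k * s ^ k)) (at s)"
      using 1 by (auto intro!: derivative_eq_intros simp: power2_eq_square)
    moreover have "(exp (- 1 / s) * (1 / s\<^sup>2) * s ^ k - exp (- 1 / s) * (real k * s ^ (k - 1))) / (s ^ k * s ^ k)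
        = flat_exp (k + 2) s - real k * flat_exp (Suc k) s"
      using 1 by (cases k) (simp_all add: flat_exp_def field_simps power2_eq_square)
    ultimately have "((\<lambda>s. exp (- 1 / s) / s ^ k) has_real_derivative flat_exp (k + 2) s - real k * flat_exp (Suc k) s) (at s)"
      by simp
    then show ?thesis
      by (rule has_field_derivative_transform_within_open[where S = "{0<..}"]) (use 1 in \<open>auto simp: flat_exp_def\<close>)
  next
    case 2
    have "((\<lambda>s. 0) has_real_derivative flat_exp (k + 2) s - real k * flat_exp (Suc k) s) (at s)"
      using 2 by (auto simp: flat_exp_def)
    then show ?thesis
      by (rule has_field_derivative_transform_within_open[where S = "{..<0}"]) (use 2 in \<open>auto simp: flat_exp_def\<close>)
  next
    case 3
    have "((\<lambda>h. (flat_exp k h - flat_exp k 0) / (h - 0)) \<longlongrightarrow> 0) (at 0)"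
      by (rule Lim_transform_eventually[OF flat_exp_tendsto_0[of "Suc k"]])
         (auto simp: flat_exp_def eventually_at intro!: exI[of _ 1])
    then show ?thesis
      by (simp add: 3 has_field_derivative_iff flat_exp_def)
  qed
qed

lemma continuous_on_flat_exp [continuous_intros]: "continuous_on A f \<Longrightarrow> continuous_on A (\<lambda>x. flat_exp k (f x))"
  by (rule continuous_on_compose2[where t = UNIV])
     (auto intro!: continuous_at_imp_continuous_on DERIV_isCont[OF flat_exp_has_derivative])

lemma flat_exp_radial_has_derivative:
  "((\<lambda>x. flat_exp k (c - (x - a) \<bullet> (x - a))) has_derivative
     (\<lambda>h. (flat_exp (k + 2) (c - (x - a) \<bullet> (x - a)) - real k * flat_exp (Suc k) (c - (x - a) \<bullet> (x - a))) *
          (- 2 * ((x - a) \<bullet> h)))) (at x)"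
  by (rule has_derivative_eq_rhs[OF DERIV_compose_FDERIV[OF flat_exp_has_derivative, where g = "\<lambda>x. c - (x - a) \<bullet> (x - a)" and s = UNIV]])
     (auto intro!: derivative_eq_intros ext simp: inner_commute algebra_simps)

text \<open>The parameter \<open>c\<close> will be the squared radius of the support. Differentiation stays within products
  of such functions with affine ones, so the induction runs over all \<open>k\<close> at once.\<close>

lemma Ck_flat_exp_radial: "Ck n (\<lambda>x. flat_exp k (c - (x - a) \<bullet> (x - a)))"
proof (induction n arbitrary: k)
  case 0
  show ?case by (auto intro!: continuous_intros)
next
  case (Suc n)
  have "Ck n (\<lambda>x. (flat_exp (k + 2) (c - (x - a) \<bullet> (x - a)) + (- real k) * flat_exp (Suc k) (c - (x - a) \<bullet> (x - a))) *
          (- 2 * ((x - a) \<bullet> i)))" for i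
    by (intro Ck_add Ck_mult Ck_const Ck_inner_diff Suc)
  then show ?case
    by (intro Ck_SucI[OF flat_exp_radial_has_derivative]) simp
qed

lemma flat_exp_radial_eq_0:
  assumes "r \<ge> 0" "dist a x \<ge> r"
  shows "flat_exp k (r\<^sup>2 - (x - a) \<bullet> (x - a)) = 0"
  using power_mono[OF assms(2,1), of 2]
  by (simp add: flat_exp_def dist_norm norm_minus_commute[of a] power2_norm_eq_inner[symmetric])

lemma flat_exp_radial_in_Cc_infinity:
  assumes "r \<ge> 0"
  shows "(\<lambda>x. flat_exp k (r\<^sup>2 - (x - a) \<bullet> (x - a))) \<in> Cc_infinity"
proof -
  have "{x. flat_exp k (r\<^sup>2 - (x - a) \<bullet> (x - a)) \<noteq> 0} \<subseteq> cball a r"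
    using flat_exp_radial_eq_0[OF assms, of a _ k] by (force simp: not_le)
  then have "compact (closure {x. flat_exp k (r\<^sup>2 - (x - a) \<bullet> (x - a)) \<noteq> 0})"
    using compact_closure bounded_subset bounded_cball by blast
  then show ?thesis
    by (simp add: Cc_infinity_def Ck_flat_exp_radial)
qed

section \<open>Mollification\<close>

lemma integrable_compact_support:
  fixes f :: "'a::euclidean_space \<Rightarrow> 'b::euclidean_space"
  assumes "continuous_on UNIV f" and "\<And>y. y \<notin> cball a r \<Longrightarrow> f y = 0"
  shows "integrable lborel f"
proof -
  have "integrable lborel (\<lambda>x. indicator (cball a r) x *\<^sub>R f x)"
    using assms(1) by (intro borel_integrable_compact) (auto elim: continuous_on_subset)
  moreover have "(\<lambda>x. indicator (cball a r) x *\<^sub>R f x) = f"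
    using assms(2) by (auto simp: indicator_def)
  ultimately show ?thesis by simp
qed

definition bump_mass :: "'a::euclidean_space itself \<Rightarrow> real \<Rightarrow> real" where
  "bump_mass _ r = (\<integral>z. flat_exp 0 (r\<^sup>2 - z \<bullet> z) \<partial>(lborel :: 'a measure))"

definition mollifier :: "real \<Rightarrow> 'a::euclidean_space \<Rightarrow> real" where
  "mollifier r z = flat_exp 0 (r\<^sup>2 - z \<bullet> z) / bump_mass TYPE('a) r"

definition mollify :: "real \<Rightarrow> ('a::euclidean_space \<Rightarrow> 'b::euclidean_space) \<Rightarrow> 'a \<Rightarrow> 'b" where
  "mollify r u x = (\<integral>y. mollifier r (y - x) *\<^sub>R u y \<partial>lborel)"

lemma flat_exp_norm_eq_0: "r \<ge> 0 \<Longrightarrow> z \<notin> cball 0 r \<Longrightarrow> flat_exp k (r\<^sup>2 - z \<bullet> z) = 0"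
  using flat_exp_radial_eq_0[of r 0 z k] by simp

lemma bump_mass_pos:
  assumes "r > 0"
  shows "bump_mass TYPE('a::euclidean_space) r > 0"
proof -
  let ?f = "\<lambda>z::'a. flat_exp 0 (r\<^sup>2 - z \<bullet> z)"
  have int: "integrable lborel ?f"
    using assms by (intro integrable_compact_support[of _ 0 r]) (auto intro!: continuous_intros flat_exp_norm_eq_0 simp del: mem_cball)
  have pos: "?f z > 0" if "z \<in> ball 0 r" for z
    using that assms by (auto simp: flat_exp_def power2_norm_eq_inner[symmetric] power_strict_mono)
  have "\<not> (AE z in lborel. ?f z = 0)"
  proof
    assume "AE z in lborel. ?f z = 0"
    then have "AE z in lebesgue. z \<in> {z. ?f z = 0}"
      by (auto dest: AE_completion)
    moreover have "closed {z::'a. ?f z = 0}"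
      by (intro closed_Collect_eq continuous_intros)
    ultimately have "(0::'a) \<in> {z. ?f z = 0}"
      by (intro mem_closed_if_AE_lebesgue) auto
    then show False using pos[of 0] assms by simp
  qed
  then have "integral\<^sup>L lborel ?f \<noteq> 0"
    using integral_nonneg_eq_0_iff_AE[OF int] flat_exp_nonneg by auto
  moreover have "integral\<^sup>L lborel ?f \<ge> 0"
    by (intro Bochner_Integration.integral_nonneg) (simp add: flat_exp_nonneg)
  ultimately show ?thesis
    unfolding bump_mass_def by linarith
qed

lemma mollifier_nonneg: "r > 0 \<Longrightarrow> mollifier r z \<ge> 0" for z :: "'a::euclidean_space"
  unfolding mollifier_def using bump_mass_pos[of r, where 'a='a] by (simp add: flat_exp_nonneg less_imp_le)

lemma mollifier_eq_0: "r > 0 \<Longrightarrow> z \<notin> cball 0 r \<Longrightarrow> mollifier r z = 0"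
  by (simp add: mollifier_def flat_exp_norm_eq_0)

lemma continuous_on_mollifier [continuous_intros]:
  "r > 0 \<Longrightarrow> continuous_on A f \<Longrightarrow> continuous_on A (\<lambda>x. mollifier r (f x))"
  unfolding mollifier_def using bump_mass_pos[of r, where 'a='b]
  by (auto intro!: continuous_intros)

lemma integral_mollifier: "r > 0 \<Longrightarrow> (\<integral>z. mollifier r z \<partial>(lborel :: 'a::euclidean_space measure)) = 1"
  unfolding mollifier_def using bump_mass_pos[of r, where 'a='a]
  by (simp add: bump_mass_def)

lemma integral_lborel_shift:
  fixes f :: "'a::euclidean_space \<Rightarrow> 'b::euclidean_space"
  assumes "f \<in> borel_measurable borel"
  shows "(\<integral>y. f y \<partial>lborel) = (\<integral>z. f (x + z) \<partial>lborel)"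
proof -
  have "(\<integral>y. f y \<partial>lborel) = (\<integral>y. f y \<partial>(distr lborel borel ((+) x)))"
    by (simp add: lborel_distr_plus)
  also have "\<dots> = (\<integral>z. f (x + z) \<partial>lborel)"
    using assms by (intro integral_distr) auto
  finally show ?thesis .
qed

text \<open>In this form regularity of \<open>u\<close> passes to the mollification; in the defining form \<open>u\<close> is not
  differentiated and only the kernel carries the variable.\<close>

lemma mollify_shift:
  assumes "r > 0" "continuous_on UNIV u"
  shows "mollify r u x = (\<integral>z. mollifier r z *\<^sub>R u (x + z) \<partial>lborel)"
  unfolding mollify_def using assms
  by (subst integral_lborel_shift[where x = x])
     (auto intro!: borel_measurable_continuous_onI continuous_intros)

lemma integrable_mollifier:
  "r > 0 \<Longrightarrow> continuous_on UNIV u \<Longrightarrow> integrable lborel (\<lambda>z. mollifier r z *\<^sub>R u (x + z))"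
  for u :: "'a::euclidean_space \<Rightarrow> 'b::euclidean_space"
  by (intro integrable_compact_support[of _ 0 r])
     (auto intro!: continuous_intros continuous_on_compose2[of UNIV u] simp: mollifier_eq_0 simp del: mem_cball)

lemma norm_integral_mollifier_le:
  fixes w :: "'a::euclidean_space \<Rightarrow> 'b::euclidean_space"
  assumes "r > 0" "continuous_on UNIV w" "\<And>z. z \<in> cball 0 r \<Longrightarrow> norm (w z) \<le> c"
  shows "norm (\<integral>z. mollifier r z *\<^sub>R w z \<partial>lborel) \<le> c"
proof -
  have "norm (\<integral>z. mollifier r z *\<^sub>R w z \<partial>lborel) \<le> (\<integral>z. mollifier r (z::'a) * c \<partial>lborel)"
  proof (rule Bochner_Integration.integral_norm_bound_integral)
    show "integrable lborel (\<lambda>z. mollifier r z *\<^sub>R w z)"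
      using integrable_mollifier[of r w 0] assms by simp
    show "integrable lborel (\<lambda>z::'a. mollifier r z * c)"
      using integrable_mollifier[of r "\<lambda>_::'a. c" 0] assms by simp
    show "norm (mollifier r z *\<^sub>R w z) \<le> mollifier r z * c" for z
      using assms mollifier_nonneg[of r z] mollifier_eq_0[of r z]
      by (cases "z \<in> cball 0 r") (auto intro: mult_left_mono)
  qed
  then show ?thesis using assms by (simp add: integral_mollifier)
qed

lemma norm_mollify_le:
  assumes "r > 0" "continuous_on UNIV u" "\<And>z. norm (u z) \<le> M"
  shows "norm (mollify r u x) \<le> M"
  unfolding mollify_shift[OF assms(1,2)]
  using assms by (intro norm_integral_mollifier_le) (auto intro!: continuous_on_compose2[of UNIV u] continuous_intros)

lemma mollify_close:
  fixes u :: "'a::euclidean_space \<Rightarrow> 'b::euclidean_space"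
  assumes "r > 0" "continuous_on UNIV u" "\<And>z. norm z \<le> r \<Longrightarrow> norm (u (x + z) - u x) \<le> d"
  shows "norm (mollify r u x - u x) \<le> d"
proof -
  have "integrable lborel (mollifier r :: 'a \<Rightarrow> real)"
    using integrable_mollifier[of r "\<lambda>_. 1::real" "0::'a"] assms(1) by simp
  then have "(\<integral>z. mollifier r (z::'a) *\<^sub>R u x \<partial>lborel) = u x"
    using assms(1) integral_mollifier[of r, where 'a='a] by simp
  then have "mollify r u x - u x = (\<integral>z. mollifier r z *\<^sub>R u (x + z) \<partial>lborel) - (\<integral>z. mollifier r (z::'a) *\<^sub>R u x \<partial>lborel)"
    using assms(1,2) by (simp add: mollify_shift)
  also have "\<dots> = (\<integral>z. mollifier r z *\<^sub>R (u (x + z) - u x) \<partial>lborel)"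
    using integrable_mollifier[of r u x] integrable_mollifier[of r "\<lambda>_. u x" x] assms
    by (simp add: scaleR_diff_right)
  also have "norm \<dots> \<le> d"
    using assms by (intro norm_integral_mollifier_le) (auto intro!: continuous_on_compose2[of UNIV u] continuous_intros)
  finally show ?thesis .
qed

lemma mollify_lipschitz:
  assumes "r > 0" "continuous_on UNIV u" "\<And>x y. norm (u x - u y) \<le> L * norm (x - y)"
  shows "norm (mollify r u x - mollify r u y) \<le> L * norm (x - y)"
proof -
  have "mollify r u x - mollify r u y = (\<integral>z. mollifier r z *\<^sub>R (u (x + z) - u (y + z)) \<partial>lborel)"
    using integrable_mollifier[of r u x] integrable_mollifier[of r u y] assms
    by (simp add: scaleR_diff_right mollify_shift)
  also have "norm \<dots> \<le> L * norm (x - y)"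
    using assms(1,2) assms(3)[of "x + z" "y + z" for z]
    by (intro norm_integral_mollifier_le) (auto intro!: continuous_on_compose2[of UNIV u] continuous_intros)
  finally show ?thesis .
qed

text \<open>Minus the gradient of the mollifier, that is, its gradient in the centre \<open>x\<close> of \<open>mollifier r (y - x)\<close>.\<close>

definition mollifier_grad :: "real \<Rightarrow> 'a::euclidean_space \<Rightarrow> 'a" where
  "mollifier_grad r z = (2 * flat_exp 2 (r\<^sup>2 - z \<bullet> z) / bump_mass TYPE('a) r) *\<^sub>R z"

lemma mollifier_has_derivative:
  "((\<lambda>x. mollifier r (y - x)) has_derivative (\<lambda>v. mollifier_grad r (y - x) \<bullet> v)) (at x within A)"
proof -
  have eq: "(\<lambda>x. mollifier r (y - x)) = (\<lambda>x. flat_exp 0 (r\<^sup>2 - (x - y) \<bullet> (x - y)) / bump_mass TYPE('a) r)"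
    by (simp add: mollifier_def algebra_simps inner_commute)
  have "((\<lambda>x. mollifier r (y - x)) has_derivative (\<lambda>v. mollifier_grad r (y - x) \<bullet> v)) (at x)"
    unfolding eq
    by (rule has_derivative_eq_rhs[OF bounded_linear.has_derivative[OF bounded_linear_divide flat_exp_radial_has_derivative]])
       (auto simp: mollifier_grad_def fun_eq_iff algebra_simps inner_commute numeral_2_eq_2 add_divide_distrib diff_divide_distrib)
  then show ?thesis by (rule has_derivative_at_withinI)
qed

lemma continuous_on_mollifier_grad [continuous_intros]:
  "r > 0 \<Longrightarrow> continuous_on A f \<Longrightarrow> continuous_on A (\<lambda>x. mollifier_grad r (f x))"
  unfolding mollifier_grad_def using bump_mass_pos[of r, where 'a='b]
  by (auto intro!: continuous_intros)

lemma mollifier_grad_eq_0: "r > 0 \<Longrightarrow> z \<notin> cball 0 r \<Longrightarrow> mollifier_grad r z = 0"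
  by (simp add: mollifier_grad_def flat_exp_norm_eq_0)

text \<open>Differentiation under the integral sign. Near \<open>x\<close> all integrands live in one fixed box, so the
  Leibniz rule for integrals over boxes applies.\<close>

lemma mollify_has_derivative:
  fixes u :: "'a::euclidean_space \<Rightarrow> 'b::euclidean_space"
  assumes "r > 0" and u: "continuous_on UNIV u"
  obtains D where "(mollify r u has_derivative blinfun_apply D) (at x)"
    "\<And>v. blinfun_apply D v = (\<integral>y. (mollifier_grad r (y - x) \<bullet> v) *\<^sub>R u y \<partial>lborel)"
proof -
  obtain a b :: 'a where ab: "cball x (r + 1) \<subseteq> cbox a b"
    using bounded_subset_cbox_symmetric[OF bounded_cball] by metis
  note uc [continuous_intros] = continuous_on_compose2[OF u _ subset_UNIV]
  have on_box: "integral\<^sup>L lborel g = integral (cbox a b) g" 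
    if g: "continuous_on UNIV g" "\<And>y. y \<notin> cball x (r + 1) \<Longrightarrow> g y = 0" for g :: "'a \<Rightarrow> 'b"
  proof -
    have eq: "(\<lambda>y. if y \<in> cbox a b then g y else 0) = g"
      using g(2) ab by (intro ext) (metis subsetD)
    have "(g has_integral integral\<^sup>L lborel g) UNIV"
      by (intro has_integral_integral_lborel integrable_compact_support[of _ x "r + 1"] g)
    then have "(g has_integral integral\<^sup>L lborel g) (cbox a b)"
      using has_integral_restrict_UNIV[of "cbox a b" g] by (simp add: eq)
    then show ?thesis by (simp add: integral_unique)
  qed
  define fx where "fx x' y = blinfun_scaleR_left (u y) o\<^sub>L blinfun_inner_right (mollifier_grad r (y - x'))" for x' y
  define D where "D = integral (cbox a b) (fx x)"
  have fx_cont: "continuous_on A (\<lambda>(x', y). fx x' y)" for A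
    unfolding fx_def split_beta using \<open>r > 0\<close>
    by (intro continuous_intros bounded_linear.continuous_on[OF bounded_linear_blinfun_scaleR_left]
        bounded_linear.continuous_on[OF bounded_linear_blinfun_inner_right]) auto
  have "((\<lambda>x'. integral (cbox a b) (\<lambda>y. mollifier r (y - x') *\<^sub>R u y)) has_derivative D) (at x within ball x 1)"
    unfolding D_def
  proof (rule leibniz_rule)
    show "((\<lambda>x'. mollifier r (y - x') *\<^sub>R u y) has_derivative fx x' y) (at x' within ball x 1)" for x' y
      unfolding fx_def
      by (rule has_derivative_eq_rhs[OF has_derivative_scaleR_left[OF mollifier_has_derivative]]) auto
    show "(\<lambda>y. mollifier r (y - x') *\<^sub>R u y) integrable_on cbox a b" for x'
      using \<open>r > 0\<close> by (intro integrable_continuous continuous_intros) auto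
  qed (auto simp: fx_cont)
  then have "((\<lambda>x'. integral (cbox a b) (\<lambda>y. mollifier r (y - x') *\<^sub>R u y)) has_derivative D) (at x)"
    by (simp add: at_within_open[of x "ball x 1"])
  moreover have "integral (cbox a b) (\<lambda>y. mollifier r (y - x') *\<^sub>R u y) = mollify r u x'" if "x' \<in> ball x 1" for x'
  proof -
    have "y - x' \<notin> cball 0 r" if "y \<notin> cball x (r + 1)" for y
      using that \<open>x' \<in> ball x 1\<close> dist_triangle[of x y x'] by (auto simp: dist_norm norm_minus_commute)
    then show ?thesis
      unfolding mollify_def using \<open>r > 0\<close>
      by (subst on_box) (auto intro!: continuous_intros simp: mollifier_eq_0 simp del: mem_cball)
  qed
  ultimately have 1: "(mollify r u has_derivative D) (at x)"
    using has_derivative_transform_within_open[of "\<lambda>x'. integral (cbox a b) (\<lambda>y. mollifier r (y - x') *\<^sub>R u y)"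
        D x UNIV "ball x 1" "mollify r u"] by simp
  have 2: "D v = (\<integral>y. (mollifier_grad r (y - x) \<bullet> v) *\<^sub>R u y \<partial>lborel)" for v
  proof -
    have "fx x integrable_on cbox a b"
      by (intro integrable_continuous continuous_on_compose2[OF fx_cont[of UNIV], where f = "Pair x", simplified] continuous_intros)
    then have "D v = integral (cbox a b) (\<lambda>y. fx x y v)"
      unfolding D_def by (rule blinfun_apply_integral)
    also have "\<dots> = (\<integral>y. (mollifier_grad r (y - x) \<bullet> v) *\<^sub>R u y \<partial>lborel)"
    proof -
      have "y - x \<notin> cball 0 r" if "y \<notin> cball x (r + 1)" for y
        using that by (auto simp: dist_norm norm_minus_commute)
      then show ?thesis
        unfolding fx_def using \<open>r > 0\<close>
        by (subst on_box) (auto intro!: continuous_intros simp: mollifier_grad_eq_0 simp del: mem_cball)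
    qed
    finally show ?thesis .
  qed
  show thesis using 1 2 by (rule that)
qed

lemma norm_derivative_le_of_lipschitz:
  fixes f :: "'a::real_normed_vector \<Rightarrow> 'b::real_normed_vector"
  assumes "(f has_derivative blinfun_apply D) (at x)" and lip: "\<And>x y. norm (f x - f y) \<le> L * norm (x - y)"
    and "L \<ge> 0"
  shows "norm D \<le> L"
proof (rule field_le_epsilon)
  fix e :: real assume "e > 0"
  then obtain d where "d > 0" and d: "\<And>y. norm (y - x) < d \<Longrightarrow> norm (f y - f x - D (y - x)) \<le> e * norm (y - x)"
    using assms(1) unfolding has_derivative_at_alt by blast
  show "norm D \<le> L + e"
  proof (rule norm_blinfun_bound)
    fix v
    show "norm (D v) \<le> (L + e) * norm v"
    proof (cases "v = 0")
      case False
      \<comment> \<open>any positive \<open>t\<close> with \<open>norm (t v) < d\<close> will do\<close>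
    define t where "t = d / (2 * norm v)"
      have t: "t > 0" "norm (t *\<^sub>R v) < d"
        using \<open>d > 0\<close> False by (auto simp: t_def)
      have "norm (D (t *\<^sub>R v)) \<le> norm (f (x + t *\<^sub>R v) - f x) + norm (f (x + t *\<^sub>R v) - f x - D (t *\<^sub>R v))"
        using norm_triangle_ineq4[of "f (x + t *\<^sub>R v) - f x" "f (x + t *\<^sub>R v) - f x - D (t *\<^sub>R v)"] by simp
      also have "\<dots> \<le> L * norm (t *\<^sub>R v) + e * norm (t *\<^sub>R v)"
        using d[of "x + t *\<^sub>R v"] lip[of "x + t *\<^sub>R v" x] t(2) by (intro add_mono) auto
      finally have "t * norm (D v) \<le> t * ((L + e) * norm v)"
        using t(1) by (simp add: blinfun.scaleR_right algebra_simps)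
      then show ?thesis
        using t(1) by simp
    qed (simp add: blinfun.zero_right)
  qed (use \<open>L \<ge> 0\<close> \<open>e > 0\<close> in simp)
qed


text \<open>Regularisation at scale \<open>r\<close> without loss in the bound and in the Lipschitz constant. The derivative is
  itself Lipschitz because the kernel's gradient can be integrated against increments of \<open>u\<close>. It matters
  that \<open>B\<close> depends on \<open>r\<close> alone: it is applied to the velocity of every single Euler step.\<close>

lemma smooth_approximation:
  fixes r :: real
  assumes "r > 0"
  obtains B where "B \<ge> 0"
    "\<And>(u :: 'a::euclidean_space \<Rightarrow> 'b::euclidean_space) M L.
      L \<ge> 0 \<Longrightarrow> (\<And>x. norm (u x) \<le> M) \<Longrightarrow> (\<And>x y. norm (u x - u y) \<le> L * norm (x - y)) \<Longrightarrow>
      \<exists>v v'. (\<forall>x. (v has_derivative blinfun_apply (v' x)) (at x)) \<and> (\<forall>x. norm (v x) \<le> M) \<and>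
        (\<forall>x. norm (v x - u x) \<le> L * r) \<and> (\<forall>x. norm (v' x) \<le> L) \<and>
        (\<forall>x y. norm (v' x - v' y) \<le> B * L * norm (x - y))"
proof
  define B where "B = (\<integral>z. norm (mollifier_grad r (z :: 'a)) \<partial>lborel)"
  show "B \<ge> 0"
    unfolding B_def by (rule Bochner_Integration.integral_nonneg) simp
  fix u :: "'a \<Rightarrow> 'b" and M L
  assume "L \<ge> 0" and bd: "\<And>x. norm (u x) \<le> M" and lip: "\<And>x y. norm (u x - u y) \<le> L * norm (x - y)"
  have u: "continuous_on UNIV u"
    by (rule lipschitz_on_continuous_on[of L]) (use \<open>L \<ge> 0\<close> lip in \<open>auto simp: lipschitz_on_def dist_norm\<close>)
  note uc [continuous_intros] = continuous_on_compose2[OF u _ subset_UNIV]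
  have "\<exists>D. (mollify r u has_derivative blinfun_apply D) (at x) \<and>
    (\<forall>v. blinfun_apply D v = (\<integral>y. (mollifier_grad r (y - x) \<bullet> v) *\<^sub>R u y \<partial>lborel))" for x
    using mollify_has_derivative[OF assms u, of x] by metis
  then obtain v' where v': "\<And>x. (mollify r u has_derivative blinfun_apply (v' x)) (at x)"
    and v'_eq: "\<And>x v. blinfun_apply (v' x) v = (\<integral>y. (mollifier_grad r (y - x) \<bullet> v) *\<^sub>R u y \<partial>lborel)"
    by metis
  have int: "integrable lborel (\<lambda>z. (mollifier_grad r z \<bullet> v) *\<^sub>R w z)" if "continuous_on UNIV w" for v and w :: "'a \<Rightarrow> 'b"
    using assms that
    by (intro integrable_compact_support[of _ 0 r]) (auto intro!: continuous_intros simp: mollifier_grad_eq_0 simp del: mem_cball)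
  have int_norm: "integrable lborel (\<lambda>z::'a. norm (mollifier_grad r z))"
    using assms
    by (intro integrable_compact_support[of _ 0 r]) (auto intro!: continuous_intros simp: mollifier_grad_eq_0 simp del: mem_cball)
  have "norm (v' x - v' y) \<le> B * L * norm (x - y)" for x y
  proof (rule norm_blinfun_bound)
    fix v
    have shift: "blinfun_apply (v' x) v = (\<integral>z. (mollifier_grad r z \<bullet> v) *\<^sub>R u (x + z) \<partial>lborel)" for x
      unfolding v'_eq using assms
      by (subst integral_lborel_shift[where x = x]) (auto intro!: borel_measurable_continuous_onI continuous_intros)
    have "blinfun_apply (v' x - v' y) v = (\<integral>z. (mollifier_grad r z \<bullet> v) *\<^sub>R (u (x + z) - u (y + z)) \<partial>lborel)"
      using int[of "\<lambda>z. u (x + z)" v] int[of "\<lambda>z. u (y + z)" v]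
      by (simp add: blinfun.diff_left shift scaleR_diff_right continuous_intros)
    also have "norm \<dots> \<le> (\<integral>z. norm (mollifier_grad r (z :: 'a)) * (norm v * (L * norm (x - y))) \<partial>lborel)"
    proof (rule Bochner_Integration.integral_norm_bound_integral)
      show "integrable lborel (\<lambda>z. (mollifier_grad r z \<bullet> v) *\<^sub>R (u (x + z) - u (y + z)))"
        by (intro int continuous_intros)
      show "integrable lborel (\<lambda>z::'a. norm (mollifier_grad r z) * (norm v * (L * norm (x - y))))"
        using int_norm by simp
      fix z :: 'a
      have "norm ((mollifier_grad r z \<bullet> v) *\<^sub>R (u (x + z) - u (y + z)))
          \<le> (norm (mollifier_grad r z) * norm v) * (L * norm (x - y))"
        unfolding norm_scaleR using lip[of "x + z" "y + z"] Cauchy_Schwarz_ineq2[of "mollifier_grad r z" v]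
        by (intro mult_mono) auto
      then show "norm ((mollifier_grad r z \<bullet> v) *\<^sub>R (u (x + z) - u (y + z)))
          \<le> norm (mollifier_grad r z) * (norm v * (L * norm (x - y)))"
        by (simp add: mult.assoc)
    qed
    also have "\<dots> = B * L * norm (x - y) * norm v"
      using int_norm by (simp add: B_def)
    finally show "norm (blinfun_apply (v' x - v' y) v) \<le> B * L * norm (x - y) * norm v" .
  qed (use \<open>B \<ge> 0\<close> \<open>L \<ge> 0\<close> in simp)
  moreover have "norm (v' x) \<le> L" for x
    by (rule norm_derivative_le_of_lipschitz[OF v' mollify_lipschitz[OF assms u lip] \<open>L \<ge> 0\<close>])
  moreover have "norm (mollify r u x - u x) \<le> L * r" for x
  proof (rule mollify_close[OF assms u])
    fix z :: 'a assume "norm z \<le> r"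
    then have "L * norm (x + z - x) \<le> L * r"
      using \<open>L \<ge> 0\<close> by (intro mult_left_mono) auto
    then show "norm (u (x + z) - u x) \<le> L * r"
      using lip[of "x + z" x] by linarith
  qed
  ultimately show "\<exists>v v'. (\<forall>x. (v has_derivative blinfun_apply (v' x)) (at x)) \<and> (\<forall>x. norm (v x) \<le> M) \<and>
        (\<forall>x. norm (v x - u x) \<le> L * r) \<and> (\<forall>x. norm (v' x) \<le> L) \<and>
        (\<forall>x y. norm (v' x - v' y) \<le> B * L * norm (x - y))"
    using v' norm_mollify_le[OF assms u bd] by (intro exI[of _ "mollify r u"] exI[of _ v']) auto
qed

section \<open>Continuous fields in \<open>W\<^sup>1\<^sup>,\<^sup>\<infinity>\<close>\<close>

lemma L_infinity_continuous_bounded: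
  assumes "u \<in> L_infinity" "continuous_on UNIV u"
  obtains M where "\<And>x. \<bar>u x\<bar> \<le> M"
proof -
  obtain M where "AE x in lebesgue. x \<in> {x. \<bar>u x\<bar> \<le> M}"
    using assms(1) by (auto simp: L_infinity_def)
  moreover have "closed {x. \<bar>u x\<bar> \<le> M}"
    by (intro closed_Collect_le continuous_intros assms)
  ultimately show thesis
    using mem_closed_if_AE_lebesgue that[of M] by blast
qed

text \<open>The partial derivative of a mollification is the weak derivative tested with the bump function centred
  at \<open>x\<close>.\<close>

lemma mollify_partial_le:
  fixes u :: "'a::euclidean_space \<Rightarrow> real"
  assumes "r > 0" and u: "continuous_on UNIV u"
    and wp: "weak_partial i u g" and g: "g \<in> borel_measurable lebesgue" and N: "AE x in lebesgue. \<bar>g x\<bar> \<le> N"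
    and D: "\<And>v. blinfun_apply D v = (\<integral>y. (mollifier_grad r (y - x) \<bullet> v) *\<^sub>R u y \<partial>lborel)"
  shows "\<bar>blinfun_apply D i\<bar> \<le> N"
proof -
  define m where "m = bump_mass TYPE('a) r"
  have "m > 0" unfolding m_def by (rule bump_mass_pos[OF \<open>r > 0\<close>])
  define \<phi> where "\<phi> y = flat_exp 0 (r\<^sup>2 - (y - x) \<bullet> (y - x))" for y
  have \<phi>_moll: "\<phi> y = m * mollifier r (y - x)" for y
    using \<open>m > 0\<close> by (simp add: \<phi>_def mollifier_def m_def)
  have grad: "grad \<phi> y \<bullet> i = - m * (mollifier_grad r (y - x) \<bullet> i)" for y
    unfolding \<phi>_def[abs_def] using \<open>m > 0\<close>
    by (subst grad_inner[OF flat_exp_radial_has_derivative]) (simp add: mollifier_grad_def m_def numeral_2_eq_2)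
  have "\<phi> \<in> Cc_infinity"
    unfolding \<phi>_def[abs_def] using \<open>r > 0\<close> by (intro flat_exp_radial_in_Cc_infinity) simp
  then have "(\<integral>y. u y * (grad \<phi> y \<bullet> i) \<partial>lebesgue) = - (\<integral>y. g y * \<phi> y \<partial>lebesgue)"
    using wp unfolding weak_partial_def by blast
  then have *: "(\<integral>y. u y * (- m * (mollifier_grad r (y - x) \<bullet> i)) \<partial>lebesgue) = - (\<integral>y. g y * \<phi> y \<partial>lebesgue)"
    unfolding grad .
  have "(\<integral>y. u y * (- m * (mollifier_grad r (y - x) \<bullet> i)) \<partial>lebesgue)
      = (\<integral>y. u y * (- m * (mollifier_grad r (y - x) \<bullet> i)) \<partial>lborel)"
    using u \<open>r > 0\<close>
    by (intro integral_completion) (auto intro!: borel_measurable_continuous_onI continuous_intros)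
  also have "\<dots> = (\<integral>y. - m * ((mollifier_grad r (y - x) \<bullet> i) *\<^sub>R u y) \<partial>lborel)"
    by (intro Bochner_Integration.integral_cong) auto
  also have "\<dots> = - m * blinfun_apply D i"
    unfolding D by (rule integral_mult_right_zero)
  finally have mD: "m * blinfun_apply D i = (\<integral>y. g y * \<phi> y \<partial>lebesgue)"
    using * by simp
  have \<phi>_cont: "continuous_on UNIV \<phi>"
    unfolding \<phi>_def by (intro continuous_intros)
  have \<phi>_meas: "\<phi> \<in> borel_measurable lborel"
    using \<phi>_cont by (simp add: borel_measurable_continuous_onI)
  have \<phi>_nonneg: "\<phi> y \<ge> 0" for y
    by (simp add: \<phi>_def flat_exp_nonneg)
  have \<phi>_int: "integrable lebesgue \<phi>"
    using \<open>r > 0\<close> flat_exp_radial_eq_0[of r x _ 0]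
    by (intro integrable_completion[THEN iffD2] \<phi>_meas integrable_compact_support[OF \<phi>_cont, of x r])
       (auto simp: \<phi>_def)
  have bd: "AE y in lebesgue. norm (g y * \<phi> y) \<le> N * \<phi> y"
    using N by eventually_elim (auto simp: abs_mult \<phi>_nonneg intro!: mult_right_mono)
  have int: "integrable lebesgue (\<lambda>y. g y * \<phi> y)"
  proof (rule Bochner_Integration.integrable_bound)
    show "integrable lebesgue (\<lambda>y. N * \<phi> y)"
      using \<phi>_int by simp
    show "(\<lambda>y. g y * \<phi> y) \<in> borel_measurable lebesgue"
      using g \<phi>_int by (intro borel_measurable_times) auto
    show "AE y in lebesgue. norm (g y * \<phi> y) \<le> norm (N * \<phi> y)"
      using bd by eventually_elim (simp add: abs_le_iff)
  qed
  have "\<bar>m * blinfun_apply D i\<bar> \<le> (\<integral>y. norm (g y * \<phi> y) \<partial>lebesgue)"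
    unfolding mD using integral_norm_bound[of lebesgue "\<lambda>y. g y * \<phi> y"] by simp
  also have "\<dots> \<le> (\<integral>y. N * \<phi> y \<partial>lebesgue)"
    using int \<phi>_int bd by (intro integral_mono_AE) auto
  also have "\<dots> = N * (\<integral>y. \<phi> y \<partial>lborel)"
    using \<phi>_meas by (simp add: integral_completion)
  also have "(\<integral>y. \<phi> y \<partial>lborel) = m"
    using integral_lborel_shift[of \<phi> x] \<phi>_cont
    by (simp add: borel_measurable_continuous_onI \<phi>_def m_def bump_mass_def)
  finally have "m * \<bar>blinfun_apply D i\<bar> \<le> m * N"
    using \<open>m > 0\<close> by (simp add: abs_mult mult.commute)
  then show ?thesis
    using \<open>m > 0\<close> by simp
qed

text \<open>Mollifications are Lipschitz with a constant independent of the radius, and they converge pointwise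
  because \<open>u\<close> is continuous.\<close>

lemma W_1_infinity_continuous_lipschitz:
  fixes u :: "'a::euclidean_space \<Rightarrow> real"
  assumes u: "continuous_on UNIV u" and W: "u \<in> W_1_infinity"
  obtains L where "\<And>x y. \<bar>u x - u y\<bar> \<le> L * norm (x - y)"
proof -
  have "\<exists>g N. weak_partial i u g \<and> g \<in> borel_measurable lebesgue \<and> (AE x in lebesgue. \<bar>g x\<bar> \<le> N)"
    if "i \<in> Basis" for i
    using W that by (fastforce simp: W_1_infinity_def L_infinity_def)
  then obtain g N where gN: "\<And>i. i \<in> Basis \<Longrightarrow> weak_partial i u (g i)"
      "\<And>i. i \<in> Basis \<Longrightarrow> g i \<in> borel_measurable lebesgue"
      "\<And>i. i \<in> Basis \<Longrightarrow> AE x in lebesgue. \<bar>g i x\<bar> \<le> N i"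
    by metis
  define L where "L = (\<Sum>i\<in>Basis. N i)"
  have moll: "\<bar>mollify r u x - mollify r u y\<bar> \<le> L * norm (x - y)" if "r > 0" for r x y
  proof -
    have "\<exists>D. (mollify r u has_derivative blinfun_apply D) (at x) \<and> norm D \<le> L" for x
    proof -
      obtain D where D: "(mollify r u has_derivative blinfun_apply D) (at x)"
        "\<And>v. blinfun_apply D v = (\<integral>y. (mollifier_grad r (y - x) \<bullet> v) *\<^sub>R u y \<partial>lborel)"
        using mollify_has_derivative[OF \<open>r > 0\<close> u] by metis
      have Di: "\<bar>blinfun_apply D i\<bar> \<le> N i" if "i \<in> Basis" for i
        by (rule mollify_partial_le[OF \<open>r > 0\<close> u gN(1)[OF that] gN(2)[OF that] gN(3)[OF that] D(2)])
      then have "L \<ge> 0"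
        unfolding L_def by (intro sum_nonneg) (meson abs_ge_zero order_trans)
      have "norm D \<le> L"
      proof (rule norm_blinfun_bound[OF \<open>L \<ge> 0\<close>])
        fix v :: 'a
        have "blinfun_apply D v = blinfun_apply D (\<Sum>i\<in>Basis. (v \<bullet> i) *\<^sub>R i)"
          by (simp add: euclidean_representation)
        also have "\<dots> = (\<Sum>i\<in>Basis. (v \<bullet> i) * blinfun_apply D i)"
          by (simp add: blinfun.sum_right blinfun.scaleR_right)
        also have "\<bar>\<dots>\<bar> \<le> (\<Sum>i\<in>Basis. norm v * N i)"
          using Di by (intro sum_abs[THEN order_trans] sum_mono) (auto simp: abs_mult Basis_le_norm intro!: mult_mono)
        finally show "norm (blinfun_apply D v) \<le> L * norm v"
          unfolding L_def sum_distrib_right by (simp add: mult.commute)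
      qed
      then show ?thesis using D(1) by blast
    qed
    then obtain D where D: "\<And>x. (mollify r u has_derivative blinfun_apply (D x)) (at x)" "\<And>x. norm (D x) \<le> L"
      by metis
    have "norm (mollify r u x - mollify r u y) \<le> L * norm (x - y)"
      by (rule differentiable_bound[where S = UNIV and f' = "\<lambda>x. blinfun_apply (D x)"])
         (auto simp: D norm_blinfun.rep_eq[symmetric])
    then show ?thesis by simp
  qed
  have "\<bar>u x - u y\<bar> \<le> L * norm (x - y)" for x y
  proof (rule field_le_epsilon)
    fix e :: real assume "e > 0"
    have "\<exists>d>0. \<forall>z. norm z < d \<longrightarrow> \<bar>u (x + z) - u x\<bar> \<le> e / 2" for x
    proof -
      have "isCont u x" using u by (simp add: continuous_on_eq_continuous_at)
      then obtain d where "d > 0" and d: "\<And>x'. dist x' x < d \<Longrightarrow> dist (u x') (u x) < e / 2"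
        unfolding continuous_at_eps_delta using \<open>e > 0\<close> by (metis half_gt_zero)
      show ?thesis
        using \<open>d > 0\<close> d[of "x + z" for z] by (intro exI[of _ d]) (auto simp: dist_norm less_imp_le)
    qed
    then obtain d where d: "\<And>x. d x > 0" "\<And>x z. norm z < d x \<Longrightarrow> \<bar>u (x + z) - u x\<bar> \<le> e / 2"
      by metis
    define r where "r = min (d x) (d y) / 2"
    have r: "r > 0" "r < d x" "r < d y"
      using d(1)[of x] d(1)[of y] by (auto simp: r_def min_def)
    have "\<bar>mollify r u x - u x\<bar> \<le> e / 2" "\<bar>mollify r u y - u y\<bar> \<le> e / 2"
      using mollify_close[OF r(1) u, of x "e / 2"] mollify_close[OF r(1) u, of y "e / 2"] d(2) r by auto
    then show "\<bar>u x - u y\<bar> \<le> L * norm (x - y) + e"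
      using moll[OF r(1), of x y] by linarith
  qed
  then show thesis by (rule that)
qed

text \<open>The constants are enlarged to be at least \<open>1\<close>, so that they may be divided by and used as exponential
  rates.\<close>

lemma W_1_infinity_field_bounded_lipschitz:
  fixes G :: "'a::euclidean_space \<Rightarrow> 'a"
  assumes G: "continuous_on UNIV G" and W: "\<forall>i\<in>Basis. (\<lambda>x. G x \<bullet> i) \<in> W_1_infinity"
  obtains M L where "M \<ge> 1" "L \<ge> 1" "\<And>x. norm (G x) \<le> M" "\<And>x y. norm (G x - G y) \<le> L * norm (x - y)"
proof -
  have c: "continuous_on UNIV (\<lambda>x. G x \<bullet> i)" for i
    by (intro continuous_intros G)
  have "\<exists>M. \<forall>x. \<bar>G x \<bullet> i\<bar> \<le> M" if "i \<in> Basis" for i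
    using W that by (auto simp: W_1_infinity_def intro: L_infinity_continuous_bounded[OF _ c, of i])
  then obtain M where M: "\<And>i x. i \<in> Basis \<Longrightarrow> \<bar>G x \<bullet> i\<bar> \<le> M i"
    by metis
  have "\<exists>L. \<forall>x y. \<bar>G x \<bullet> i - G y \<bullet> i\<bar> \<le> L * norm (x - y)" if "i \<in> Basis" for i
    using W that by (auto intro: W_1_infinity_continuous_lipschitz[OF c, of i])
  then obtain L where L: "\<And>i x y. i \<in> Basis \<Longrightarrow> \<bar>G x \<bullet> i - G y \<bullet> i\<bar> \<le> L i * norm (x - y)"
    by metis
  show thesis
  proof (rule that[of "max 1 (\<Sum>i\<in>Basis. M i)" "max 1 (\<Sum>i\<in>Basis. L i)"])
    have "norm (G x) \<le> (\<Sum>i\<in>Basis. M i)" for x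
      by (rule order_trans[OF norm_le_l1]) (intro sum_mono M)
    then show "norm (G x) \<le> max 1 (\<Sum>i\<in>Basis. M i)" for x
      by (simp add: max.coboundedI2)
    have "norm (G x - G y) \<le> (\<Sum>i\<in>Basis. L i) * norm (x - y)" for x y
      unfolding sum_distrib_right
      by (rule order_trans[OF norm_le_l1]) (intro sum_mono, simp add: inner_diff_left L)
    also have "\<dots> x y \<le> max 1 (\<Sum>i\<in>Basis. L i) * norm (x - y)" for x y
      by (intro mult_right_mono) auto
    finally show "norm (G x - G y) \<le> max 1 (\<Sum>i\<in>Basis. L i) * norm (x - y)" for x y .
  qed auto
qed

section \<open>Test functions\<close>

lemma norm_grad_le:
  assumes "(\<phi> has_derivative blinfun_apply D) (at x)"
  shows "norm (grad \<phi> x) \<le> norm D"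
proof (cases "grad \<phi> x = 0")
  case False
  have "norm (grad \<phi> x) * norm (grad \<phi> x) = blinfun_apply D (grad \<phi> x)"
    using grad_inner[OF assms, of "grad \<phi> x"] by (simp add: power2_norm_eq_inner[symmetric] power2_eq_square)
  also have "\<dots> \<le> norm D * norm (grad \<phi> x)"
    using norm_blinfun[of D "grad \<phi> x"] by simp
  finally show ?thesis using False by simp
qed simp

lemma C1bI:
  fixes \<phi> :: "'a::euclidean_space \<Rightarrow> real"
  assumes D: "\<And>x. (\<phi> has_derivative blinfun_apply (D x)) (at x)" and "continuous_on UNIV D"
    and "\<And>x. norm (\<phi> x) \<le> B" and A: "\<And>x. norm (D x) \<le> A"
  shows "\<phi> \<in> C1b"
proof -
  have "Ck 1 \<phi>"
    unfolding One_nat_def using assms(2)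
    by (intro Ck_SucI[OF D]) (auto intro!: continuous_intros)
  moreover have "bounded (range \<phi>)"
    using assms(3) by (intro boundedI) auto
  moreover have "bounded (range (grad \<phi>))"
    using norm_grad_le[OF D] A by (intro boundedI[where B = A]) (auto intro: order_trans)
  ultimately show ?thesis by (simp add: C1b_def)
qed

lemma C1b_has_derivative:
  assumes "\<phi> \<in> C1b"
  shows "(\<phi> has_derivative (\<lambda>v. grad \<phi> x \<bullet> v)) (at x within A)"
proof -
  have d: "(\<phi> has_derivative frechet_derivative \<phi> (at x)) (at x)"
    using assms by (auto simp: C1b_def frechet_derivative_works)
  have "(\<lambda>v. grad \<phi> x \<bullet> v) = frechet_derivative \<phi> (at x)"
    using grad_inner[OF d] by auto
  then show ?thesis
    using d has_derivative_at_withinI by metis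
qed

lemma C1b_continuous:
  assumes "\<phi> \<in> C1b"
  shows "continuous_on A \<phi>" "continuous_on A (grad \<phi>)"
proof -
  have "continuous_on UNIV \<phi>"
    using assms Ck_Suc_imp_Ck[of 0 \<phi>] by (simp add: C1b_def)
  moreover have "continuous_on UNIV (grad \<phi>)"
    using assms by (intro continuous_on_componentwise[THEN iffD2]) (auto simp: C1b_def)
  ultimately show "continuous_on A \<phi>" "continuous_on A (grad \<phi>)"
    by (auto elim: continuous_on_subset)
qed

lemma C1b_norm_upper:
  assumes "\<phi> \<in> C1b"
  shows "\<bar>\<phi> x\<bar> + norm (grad \<phi> y) \<le> C1b_norm \<phi>"
proof -
  have "bdd_above (range (\<lambda>x. \<bar>\<phi> x\<bar>))" "bdd_above (range (\<lambda>x. norm (grad \<phi> x)))"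
    using assms by (auto simp: C1b_def bounded_iff bdd_above_def)
  then show ?thesis
    unfolding C1b_norm_def by (intro add_mono cSUP_upper) auto
qed

lemma C1b_norm_bounds:
  assumes "\<phi> \<in> C1b"
  shows "\<bar>\<phi> x\<bar> \<le> C1b_norm \<phi>" "norm (grad \<phi> x) \<le> C1b_norm \<phi>" "0 \<le> C1b_norm \<phi>"
  using C1b_norm_upper[OF assms, of x x] abs_ge_zero[of "\<phi> x"] norm_ge_zero[of "grad \<phi> x"] by linarith+

lemma C1b_norm_le:
  assumes "\<And>x. \<bar>\<phi> x\<bar> \<le> a" "\<And>x. norm (grad \<phi> x) \<le> b"
  shows "C1b_norm \<phi> \<le> a + b"
  unfolding C1b_norm_def using assms by (intro add_mono cSUP_least) auto

lemma C1b_linear_combination: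
  assumes "\<phi> \<in> C1b" "\<eta> \<in> C1b"
  shows "(\<lambda>x. c * \<phi> x + d * \<eta> x) \<in> C1b"
    "grad (\<lambda>x. c * \<phi> x + d * \<eta> x) x = c *\<^sub>R grad \<phi> x + d *\<^sub>R grad \<eta> x"
proof -
  have der: "((\<lambda>x. c * \<phi> x + d * \<eta> x) has_derivative (\<lambda>v. (c *\<^sub>R grad \<phi> x + d *\<^sub>R grad \<eta> x) \<bullet> v)) (at x)" for x
    by (auto intro!: derivative_eq_intros C1b_has_derivative assms simp: inner_add_left)
  show grad: "grad (\<lambda>x. c * \<phi> x + d * \<eta> x) x = c *\<^sub>R grad \<phi> x + d *\<^sub>R grad \<eta> x" for x
    by (rule euclidean_eqI) (simp add: grad_inner[OF der])
  have "norm (c * \<phi> x + d * \<eta> x) \<le> \<bar>c\<bar> * C1b_norm \<phi> + \<bar>d\<bar> * C1b_norm \<eta>" for x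
    by (rule norm_triangle_le) (auto simp: abs_mult intro!: add_mono mult_left_mono C1b_norm_bounds assms)
  moreover have "norm (grad (\<lambda>x. c * \<phi> x + d * \<eta> x) x) \<le> \<bar>c\<bar> * C1b_norm \<phi> + \<bar>d\<bar> * C1b_norm \<eta>" for x
    unfolding grad by (rule norm_triangle_le) (auto intro!: add_mono mult_left_mono C1b_norm_bounds assms)
  moreover have "Ck 1 (\<lambda>x. c * \<phi> x + d * \<eta> x)"
    using assms by (intro Ck_add Ck_mult Ck_const) (auto simp: C1b_def simp del: Ck.simps)
  ultimately show "(\<lambda>x. c * \<phi> x + d * \<eta> x) \<in> C1b"
    unfolding C1b_def by (auto intro!: boundedI simp del: Ck.simps)
qed

lemma C1b_diff:
  assumes "\<phi> \<in> C1b" "\<eta> \<in> C1b"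
  shows "(\<lambda>x. \<phi> x - \<eta> x) \<in> C1b" "grad (\<lambda>x. \<phi> x - \<eta> x) x = grad \<phi> x - grad \<eta> x"
  using C1b_linear_combination[OF assms, of 1 "-1"] by simp_all

lemma C1b_scale:
  assumes "\<phi> \<in> C1b"
  shows "(\<lambda>x. c * \<phi> x) \<in> C1b" "grad (\<lambda>x. c * \<phi> x) x = c *\<^sub>R grad \<phi> x"
  using C1b_linear_combination[OF assms assms, of c 0] by simp_all

lemma C1b_norm_scale_le:
  assumes "\<phi> \<in> C1b"
  shows "C1b_norm (\<lambda>x. c * \<phi> x) \<le> \<bar>c\<bar> * (C1b_norm \<phi> + C1b_norm \<phi>)"
  unfolding distrib_left
  by (rule C1b_norm_le)
     (auto simp: C1b_scale[OF assms] abs_mult intro!: mult_left_mono C1b_norm_bounds assms)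

lemma C1b_norm_triangle:
  assumes "\<phi> \<in> C1b" "\<eta> \<in> C1b"
  shows "\<bar>C1b_norm \<phi> - C1b_norm \<eta>\<bar> \<le> 2 * C1b_norm (\<lambda>x. \<phi> x - \<eta> x)"
proof -
  let ?n = "C1b_norm (\<lambda>x. \<phi> x - \<eta> x)"
  have bdd: "bdd_above (range (\<lambda>x. \<bar>\<phi> x\<bar>))" "bdd_above (range (\<lambda>x. norm (grad \<phi> x)))" if "\<phi> \<in> C1b" for \<phi> :: "'a \<Rightarrow> real"
    using that by (auto simp: C1b_def bounded_iff bdd_above_def)
  have d: "\<bar>\<phi> x - \<eta> x\<bar> \<le> ?n" "norm (grad \<phi> x - grad \<eta> x) \<le> ?n" for x
    using C1b_norm_bounds(1,2)[OF C1b_diff(1)[OF assms], of x] by (simp_all add: C1b_diff[OF assms])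
  have "C1b_norm \<phi> \<le> ((SUP x. \<bar>\<eta> x\<bar>) + ?n) + ((SUP x. norm (grad \<eta> x)) + ?n)"
  proof (rule C1b_norm_le)
    show "\<bar>\<phi> x\<bar> \<le> (SUP x. \<bar>\<eta> x\<bar>) + ?n" for x
      using cSUP_upper[OF UNIV_I bdd(1)[OF assms(2)], of x] d(1)[of x] by linarith
    show "norm (grad \<phi> x) \<le> (SUP x. norm (grad \<eta> x)) + ?n" for x
      using cSUP_upper[OF UNIV_I bdd(2)[OF assms(2)], of x] d(2)[of x] norm_triangle_sub[of "grad \<phi> x" "grad \<eta> x"] by linarith
  qed
  moreover have "C1b_norm \<eta> \<le> ((SUP x. \<bar>\<phi> x\<bar>) + ?n) + ((SUP x. norm (grad \<phi> x)) + ?n)"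
  proof (rule C1b_norm_le)
    show "\<bar>\<eta> x\<bar> \<le> (SUP x. \<bar>\<phi> x\<bar>) + ?n" for x
      using cSUP_upper[OF UNIV_I bdd(1)[OF assms(1)], of x] d(1)[of x] by linarith
    show "norm (grad \<eta> x) \<le> (SUP x. norm (grad \<phi> x)) + ?n" for x
      using cSUP_upper[OF UNIV_I bdd(2)[OF assms(1)], of x] d(2)[of x]
        norm_triangle_sub[of "grad \<eta> x" "grad \<phi> x"] by (simp add: norm_minus_commute)
  qed
  ultimately show ?thesis
    by (simp add: C1b_norm_def)
qed

lemma continuous_on_uniform_family:
  fixes f :: "real \<Rightarrow> 'a::t2_space \<Rightarrow> 'b::real_normed_vector"
  assumes cont: "\<And>t. t \<in> I \<Longrightarrow> continuous_on UNIV (f t)"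
    and le: "\<And>t s x. t \<in> I \<Longrightarrow> s \<in> I \<Longrightarrow> norm (f s x - f t x) \<le> n t s"
    and n: "\<And>t. t \<in> I \<Longrightarrow> (n t \<longlongrightarrow> 0) (at t within I)"
  shows "continuous_on (I \<times> UNIV) (\<lambda>(t, x). f t x)"
  unfolding continuous_on_def
proof
  fix p assume "p \<in> I \<times> (UNIV :: 'a set)"
  then obtain t x where p: "p = (t, x)" and t: "t \<in> I" by auto
  let ?F = "at (t, x) within I \<times> UNIV"
  \<comment> \<open>The limit at \<open>t\<close> says nothing about \<open>n t t\<close>, but the pairs \<open>(t, y)\<close> also have to be covered.\<close>
  define m where "m s = (if s = t then 0 else n t s)" for s
  have "(m \<longlongrightarrow> 0) (at t within I)"
    by (rule Lim_transform_eventually[OF n[OF t]]) (simp add: m_def eventually_at_filter)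
  then have "continuous (at t within I) m"
    by (simp add: continuous_within m_def)
  then have 1: "((\<lambda>q. m (fst q)) \<longlongrightarrow> m t) ?F"
    by (rule continuous_within_tendsto_compose)
       (auto intro!: tendsto_eq_intros always_eventually simp: eventually_at_filter)
  have "isCont (f t) x"
    using cont[OF t] by (simp add: continuous_on_eq_continuous_at)
  then have "((\<lambda>q. f t (snd q)) \<longlongrightarrow> f t x) ?F"
    by (rule isCont_tendsto_compose) (auto intro!: tendsto_eq_intros)
  then have "((\<lambda>q. m (fst q) + norm (f t (snd q) - f t x)) \<longlongrightarrow> m t + norm (f t x - f t x)) ?F"
    by (intro tendsto_intros 1)
  then have 2: "((\<lambda>q. m (fst q) + norm (f t (snd q) - f t x)) \<longlongrightarrow> 0) ?F"
    by (simp add: m_def)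
  have "((\<lambda>q. f (fst q) (snd q) - f t x) \<longlongrightarrow> 0) ?F"
  proof (rule Lim_null_comparison[OF _ 2])
    have "norm (f s y - f t x) \<le> m s + norm (f t y - f t x)" if "s \<in> I" for s y
      using le[OF t that, of y] norm_triangle_ineq[of "f s y - f t y" "f t y - f t x"] by (simp add: m_def)
    then show "\<forall>\<^sub>F q in ?F. norm (f (fst q) (snd q) - f t x) \<le> m (fst q) + norm (f t (snd q) - f t x)"
      by (auto simp: eventually_at_filter intro!: always_eventually)
  qed
  then show "((\<lambda>(t, x). f t x) \<longlongrightarrow> (case p of (t, x) \<Rightarrow> f t x)) (at p within I \<times> UNIV)"
    unfolding p case_prod_unfold fst_conv snd_conv by (rule LIM_zero_cancel)
qed

lemma grad_zero: "grad (\<lambda>x::'a::euclidean_space. 0) x = 0"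
  by (rule euclidean_eqI) (simp add: grad_inner[OF has_derivative_const])

text \<open>Convergence in the norm of \<open>C1b\<close> is uniform convergence of functions and gradients; the norm along a
  continuous curve is continuous, hence bounded on compact sets.\<close>

lemma C1b_curve:
  fixes \<theta> :: "real \<Rightarrow> 'a::euclidean_space \<Rightarrow> real"
  assumes C: "\<And>t. t \<in> I \<Longrightarrow> \<theta> t \<in> C1b"
    and lim: "\<And>t. t \<in> I \<Longrightarrow> ((\<lambda>s. C1b_norm (\<lambda>x. \<theta> s x - \<theta> t x)) \<longlongrightarrow> 0) (at t within I)"
  shows "continuous_on (I \<times> UNIV) (\<lambda>(t, x). \<theta> t x)"
    "continuous_on (I \<times> UNIV) (\<lambda>(t, x). grad (\<theta> t) x)"
    "compact J \<Longrightarrow> J \<subseteq> I \<Longrightarrow> \<exists>B. \<forall>t\<in>J. \<forall>x. \<bar>\<theta> t x\<bar> \<le> B \<and> norm (grad (\<theta> t) x) \<le> B"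
proof -
  have le: "norm (\<theta> s x - \<theta> t x) \<le> C1b_norm (\<lambda>x. \<theta> s x - \<theta> t x)"
      "norm (grad (\<theta> s) x - grad (\<theta> t) x) \<le> C1b_norm (\<lambda>x. \<theta> s x - \<theta> t x)"
      if "s \<in> I" "t \<in> I" for s t x
    using C1b_norm_bounds(1,2)[OF C1b_diff(1)[OF C C], of s t x] that by (simp_all add: C1b_diff C)
  show "continuous_on (I \<times> UNIV) (\<lambda>(t, x). \<theta> t x)"
    using C lim le(1)
    by (intro continuous_on_uniform_family[where n = "\<lambda>t s. C1b_norm (\<lambda>x. \<theta> s x - \<theta> t x)"])
       (auto simp: C1b_continuous)
  show "continuous_on (I \<times> UNIV) (\<lambda>(t, x). grad (\<theta> t) x)"
    using C lim le(2)
    by (intro continuous_on_uniform_family[where n = "\<lambda>t s. C1b_norm (\<lambda>x. \<theta> s x - \<theta> t x)"])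
       (auto simp: C1b_continuous)
  assume "compact J" "J \<subseteq> I"
  have "continuous_on I (\<lambda>t. C1b_norm (\<theta> t))"
    unfolding continuous_on_def
  proof
    fix t assume t: "t \<in> I"
    have "((\<lambda>s. 2 * C1b_norm (\<lambda>x. \<theta> s x - \<theta> t x)) \<longlongrightarrow> 0) (at t within I)"
      using tendsto_mult_right_zero[OF lim[OF t]] .
    then have "((\<lambda>s. C1b_norm (\<theta> s) - C1b_norm (\<theta> t)) \<longlongrightarrow> 0) (at t within I)"
    proof (rule Lim_null_comparison[rotated])
      have "norm (C1b_norm (\<theta> s) - C1b_norm (\<theta> t)) \<le> 2 * C1b_norm (\<lambda>x. \<theta> s x - \<theta> t x)" if "s \<in> I" for s
        using C1b_norm_triangle[OF C[OF that] C[OF t]] by simp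
      then show "\<forall>\<^sub>F s in at t within I. norm (C1b_norm (\<theta> s) - C1b_norm (\<theta> t)) \<le> 2 * C1b_norm (\<lambda>x. \<theta> s x - \<theta> t x)"
        unfolding eventually_at_filter by (intro always_eventually) blast
    qed
    then show "((\<lambda>t. C1b_norm (\<theta> t)) \<longlongrightarrow> C1b_norm (\<theta> t)) (at t within I)"
      by (rule LIM_zero_cancel)
  qed
  then have "compact ((\<lambda>t. C1b_norm (\<theta> t)) ` J)"
    using \<open>compact J\<close> \<open>J \<subseteq> I\<close> by (intro compact_continuous_image) (auto elim: continuous_on_subset)
  then obtain B where B: "\<forall>t\<in>J. C1b_norm (\<theta> t) \<le> B"
    using bounded_imp_bdd_above[OF compact_imp_bounded, of "(\<lambda>t. C1b_norm (\<theta> t)) ` J"] by (auto simp: bdd_above_def)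
  then show "\<exists>B. \<forall>t\<in>J. \<forall>x. \<bar>\<theta> t x\<bar> \<le> B \<and> norm (grad (\<theta> t) x) \<le> B"
  proof (intro exI[of _ B] ballI allI conjI)
    fix t x assume "t \<in> J"
    then have "\<theta> t \<in> C1b" "C1b_norm (\<theta> t) \<le> B"
      using C \<open>J \<subseteq> I\<close> B by auto
    then show "\<bar>\<theta> t x\<bar> \<le> B" "norm (grad (\<theta> t) x) \<le> B"
      using C1b_norm_bounds(1,2)[of "\<theta> t" x] by linarith+
  qed
qed

text \<open>Differentiability in the Banach space \<open>C1b\<close> implies continuity there: the increment is \<open>s - t\<close> times a
  difference quotient of bounded norm.\<close>

lemma C1c_C1b_continuity:
  assumes "C1c_C1b T \<psi> \<psi>'" "t \<in> {0..<T}"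
  shows "((\<lambda>s. C1b_norm (\<lambda>x. \<psi> s x - \<psi> t x)) \<longlongrightarrow> 0) (at t within {0..<T})"
proof -
  let ?q = "\<lambda>s. C1b_norm (\<lambda>x. (\<psi> s x - \<psi> t x) / (s - t) - \<psi>' t x)"
  have C: "\<And>s. s \<in> {0..<T} \<Longrightarrow> \<psi> s \<in> C1b" "\<psi>' t \<in> C1b" and q: "(?q \<longlongrightarrow> 0) (at t within {0..<T})"
    using assms by (auto simp: C1c_C1b_def)
  have "((\<lambda>s. \<bar>s - t\<bar> * 2 * (?q s + C1b_norm (\<psi>' t))) \<longlongrightarrow> \<bar>t - t\<bar> * 2 * (0 + C1b_norm (\<psi>' t))) (at t within {0..<T})"
    by (intro tendsto_intros q)
  then have lim: "((\<lambda>s. \<bar>s - t\<bar> * 2 * (?q s + C1b_norm (\<psi>' t))) \<longlongrightarrow> 0) (at t within {0..<T})"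
    by simp
  have "norm (C1b_norm (\<lambda>x. \<psi> s x - \<psi> t x)) \<le> \<bar>s - t\<bar> * 2 * (?q s + C1b_norm (\<psi>' t))"
    if s: "s \<in> {0..<T}" "s \<noteq> t" for s
  proof -
    let ?D = "\<lambda>x. \<psi> s x - \<psi> t x"
    let ?Q = "\<lambda>x. ?D x / (s - t) - \<psi>' t x"
    have D: "?D \<in> C1b" using C s assms(2) by (intro C1b_diff)
    have Q: "?Q \<in> C1b"
      using C1b_diff(1)[OF C1b_scale(1)[OF D] C(2), of "1 / (s - t)"] by simp
    have Deq: "?D = (\<lambda>x. (s - t) * ?Q x + (s - t) * \<psi>' t x)"
      using s(2) by (auto simp: field_simps)
    have "C1b_norm ?D \<le> \<bar>s - t\<bar> * (?q s + C1b_norm (\<psi>' t)) + \<bar>s - t\<bar> * (?q s + C1b_norm (\<psi>' t))"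
    proof (rule C1b_norm_le)
      fix x
      have "?D x = (s - t) * (?Q x + \<psi>' t x)"
        using s(2) by simp
      from arg_cong[OF this, of abs] have "\<bar>?D x\<bar> = \<bar>s - t\<bar> * \<bar>?Q x + \<psi>' t x\<bar>"
        unfolding abs_mult .
      also have "\<dots> \<le> \<bar>s - t\<bar> * (?q s + C1b_norm (\<psi>' t))"
        using C1b_norm_bounds(1)[OF Q, of x] C1b_norm_bounds(1)[OF C(2), of x]
        by (intro mult_left_mono) linarith+
      finally show "\<bar>?D x\<bar> \<le> \<bar>s - t\<bar> * (?q s + C1b_norm (\<psi>' t))" .
      have "norm (grad ?D x) = norm ((s - t) *\<^sub>R (grad ?Q x + grad (\<psi>' t) x))"
        by (subst Deq) (simp only: C1b_linear_combination(2)[OF Q C(2)] scaleR_add_right)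
      also have "\<dots> \<le> \<bar>s - t\<bar> * (?q s + C1b_norm (\<psi>' t))"
        unfolding norm_scaleR real_norm_def using C1b_norm_bounds(2)[OF Q, of x] C1b_norm_bounds(2)[OF C(2), of x]
        by (intro mult_left_mono norm_triangle_le) auto
      finally show "norm (grad ?D x) \<le> \<bar>s - t\<bar> * (?q s + C1b_norm (\<psi>' t))" .
    qed
    then show ?thesis
      using C1b_norm_bounds(3)[OF D] by simp
  qed
  then show ?thesis
    by (intro Lim_null_comparison[OF _ lim]) (auto simp: eventually_at_filter intro!: always_eventually)
qed

lemma C1c_C1b_separated:
  assumes \<phi>: "\<phi> \<in> C1b"
    and \<eta>: "\<And>t. t \<in> {0..<T} \<Longrightarrow> (\<eta> has_real_derivative \<eta>' t) (at t within {0..<T})"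
    and \<eta>': "continuous_on {0..<T} \<eta>'"
    and supp: "S < T" "\<And>t. t \<in> {0..<T} \<Longrightarrow> S < t \<Longrightarrow> \<eta> t = 0"
  shows "C1c_C1b T (\<lambda>t x. \<eta> t * \<phi> x) (\<lambda>t x. \<eta>' t * \<phi> x)"
proof -
  have null: "((\<lambda>s. C1b_norm (\<lambda>x. c s * \<phi> x)) \<longlongrightarrow> 0) F" if "(c \<longlongrightarrow> 0) F" for c F
  proof (rule Lim_null_comparison)
    show "\<forall>\<^sub>F s in F. norm (C1b_norm (\<lambda>x. c s * \<phi> x)) \<le> \<bar>c s\<bar> * (C1b_norm \<phi> + C1b_norm \<phi>)"
      using C1b_norm_scale_le[OF \<phi>] C1b_norm_bounds(3)[OF C1b_scale(1)[OF \<phi>]] by (intro always_eventually) simp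
    show "((\<lambda>s. \<bar>c s\<bar> * (C1b_norm \<phi> + C1b_norm \<phi>)) \<longlongrightarrow> 0) F"
      using tendsto_mult_left_zero[OF tendsto_rabs_zero[OF that]] .
  qed
  show ?thesis
    unfolding C1c_C1b_def
  proof (intro conjI ballI exI[of _ S] impI allI)
    fix t assume t: "t \<in> {0..<T}"
    show "(\<lambda>x. \<eta> t * \<phi> x) \<in> C1b" "(\<lambda>x. \<eta>' t * \<phi> x) \<in> C1b"
      by (rule C1b_scale[OF \<phi>])+
    have "((\<lambda>s. (\<eta> s - \<eta> t) / (s - t) - \<eta>' t) \<longlongrightarrow> 0) (at t within {0..<T})"
      using \<eta>[OF t] unfolding has_field_derivative_iff by (rule LIM_zero)
    then show "((\<lambda>s. C1b_norm (\<lambda>x. (\<eta> s * \<phi> x - \<eta> t * \<phi> x) / (s - t) - \<eta>' t * \<phi> x)) \<longlongrightarrow> 0) (at t within {0..<T})"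
      by (rule null[THEN Lim_transform_eventually])
         (auto intro!: always_eventually arg_cong[where f = C1b_norm] simp: algebra_simps diff_divide_distrib)
    have "((\<lambda>s. \<eta>' s - \<eta>' t) \<longlongrightarrow> 0) (at t within {0..<T})"
      using \<eta>' t by (intro LIM_zero) (simp add: continuous_on_def)
    then show "((\<lambda>s. C1b_norm (\<lambda>x. \<eta>' s * \<phi> x - \<eta>' t * \<phi> x)) \<longlongrightarrow> 0) (at t within {0..<T})"
      by (rule null[THEN Lim_transform_eventually])
         (auto intro!: always_eventually arg_cong[where f = C1b_norm] simp: algebra_simps)
  qed (use supp in auto)
qed

section \<open>Probability measures and the Wasserstein distance\<close>

lemma prob_measuresD:
  assumes "\<mu> \<in> prob_measures"
  shows "prob_space \<mu>" "sets \<mu> = sets borel" "space \<mu> = UNIV" "measurable \<mu> N = measurable borel N"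
  using assms sets_eq_imp_space_eq[of \<mu> borel] by (auto simp: prob_measures_def intro!: measurable_cong_sets)

lemma prob_integrable_bounded:
  fixes g :: "'a::euclidean_space \<Rightarrow> 'b::euclidean_space"
  assumes "\<mu> \<in> prob_measures" "g \<in> borel_measurable borel" "\<And>x. norm (g x) \<le> B"
  shows "integrable \<mu> g"
proof -
  interpret prob_space \<mu> using assms(1) by (rule prob_measuresD)
  show ?thesis
    using assms by (intro integrable_const_bound[where B = B]) (auto simp: prob_measuresD)
qed

lemma norm_prob_integral_le:
  fixes g :: "'a \<Rightarrow> 'b::euclidean_space"
  assumes "prob_space \<mu>" "\<And>x. norm (g x) \<le> B"
  shows "norm (\<integral>x. g x \<partial>\<mu>) \<le> B"
proof (cases "integrable \<mu> g")
  case True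
  interpret prob_space \<mu> by fact
  have "norm (\<integral>x. g x \<partial>\<mu>) \<le> (\<integral>x. norm (g x) \<partial>\<mu>)"
    by (rule integral_norm_bound)
  also have "\<dots> \<le> (\<integral>x. B \<partial>\<mu>)"
    using True assms(2) by (intro integral_mono) auto
  finally have "norm (\<integral>x. g x \<partial>\<mu>) \<le> (\<integral>x. B \<partial>\<mu>)" .
  then show ?thesis by (simp add: prob_space)
next
  case False
  have "0 \<le> B" using assms(2)[of undefined] norm_ge_zero order_trans by blast
  with False show ?thesis by (simp add: not_integrable_integral_eq)
qed

lemma borel_measurable_lipschitz:
  fixes g :: "'a::real_normed_vector \<Rightarrow> 'b::real_normed_vector"
  assumes "\<And>x y. norm (g x - g y) \<le> L * norm (x - y)"
  shows "continuous_on A g" "g \<in> borel_measurable borel"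
proof -
  have "norm (g x - g y) \<le> max 0 L * norm (x - y)" for x y
    by (rule order_trans[OF assms mult_right_mono]) auto
  then have *: "continuous_on B g" for B
    by (intro lipschitz_on_continuous_on[of "max 0 L"]) (auto simp: lipschitz_on_def dist_norm)
  then show "continuous_on A g" "g \<in> borel_measurable borel"
    by (auto intro: borel_measurable_continuous_onI)
qed

text \<open>Indicators of closed sets are limits of Lipschitz functions of the distance to the set. Functions with
  Lipschitz constant \<open>1\<close> suffice because the equality of integrals is homogeneous.\<close>

lemma prob_measures_eqI:
  fixes \<mu> \<nu> :: "'a::euclidean_space measure"
  assumes \<mu>: "\<mu> \<in> prob_measures" and \<nu>: "\<nu> \<in> prob_measures"
    and eq: "\<And>\<phi> :: 'a \<Rightarrow> real. bounded (range \<phi>) \<Longrightarrow> (\<And>x y. \<bar>\<phi> x - \<phi> y\<bar> \<le> norm (x - y)) \<Longrightarrow>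
      (\<integral>x. \<phi> x \<partial>\<mu>) = (\<integral>x. \<phi> x \<partial>\<nu>)"
  shows "\<mu> = \<nu>"
proof -
  have closed: "emeasure \<mu> C = emeasure \<nu> C" if "closed C" for C
  proof (cases "C = {}")
    case False
    define \<phi> where "\<phi> n x = max 0 (1 - real (Suc n) * infdist x C)" for n x
    have \<phi>_le: "norm (\<phi> n x) \<le> 1" for n x
      using infdist_nonneg[of x C] by (auto simp: \<phi>_def)
    have \<phi>_lip: "\<bar>\<phi> n x - \<phi> n y\<bar> \<le> real (Suc n) * norm (x - y)" for n x y
    proof -
      have "\<bar>\<phi> n x - \<phi> n y\<bar> \<le> \<bar>real (Suc n) * infdist x C - real (Suc n) * infdist y C\<bar>"
        unfolding \<phi>_def by linarith
      also have "\<dots> = real (Suc n) * \<bar>infdist x C - infdist y C\<bar>"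
        by (simp add: abs_mult flip: right_diff_distrib)
      also have "\<dots> \<le> real (Suc n) * norm (x - y)"
        using infdist_triangle_abs[of x C y] by (intro mult_left_mono) (auto simp: dist_norm)
      finally show ?thesis .
    qed
    have \<phi>_meas: "\<phi> n \<in> borel_measurable borel" for n
      using borel_measurable_lipschitz(2)[of "\<phi> n" "real (Suc n)"] \<phi>_lip by simp
    have \<phi>_eq: "(\<integral>x. \<phi> n x \<partial>\<mu>) = (\<integral>x. \<phi> n x \<partial>\<nu>)" for n
    proof -
      have "(\<integral>x. \<phi> n x / real (Suc n) \<partial>\<mu>) = (\<integral>x. \<phi> n x / real (Suc n) \<partial>\<nu>)"
      proof (rule eq)
        show "bounded (range (\<lambda>x. \<phi> n x / real (Suc n)))"
          using \<phi>_le[of n] by (intro boundedI[where B = 1]) (auto simp: divide_simps intro!: order_trans[OF \<phi>_le[of n, simplified]])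
        show "\<bar>\<phi> n x / real (Suc n) - \<phi> n y / real (Suc n)\<bar> \<le> norm (x - y)" for x y
          using \<phi>_lip[of n x y] by (simp add: divide_simps mult.commute flip: diff_divide_distrib)
      qed
      then show ?thesis by simp
    qed
    have lim: "(\<lambda>n. \<phi> n x) \<longlonglongrightarrow> indicator C x" for x
    proof (cases "x \<in> C")
      case False
      then have pos: "infdist x C > 0"
        using \<open>C \<noteq> {}\<close> \<open>closed C\<close> infdist_pos_not_in_closed by blast
      then obtain N where "1 < real N * infdist x C"
        using reals_Archimedean3 by blast
      then have "\<phi> n x = 0" if "n \<ge> N" for n
      proof -
        have "real N * infdist x C \<le> real (Suc n) * infdist x C"
          using that pos by (intro mult_right_mono) auto
        then show ?thesis using \<open>1 < _\<close> by (simp add: \<phi>_def)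
      qed
      then show ?thesis
        using False by (intro tendsto_eventually eventually_sequentiallyI[of N]) simp
    qed (simp add: \<phi>_def)
    have conv: "(\<lambda>n. \<integral>x. \<phi> n x \<partial>\<kappa>) \<longlonglongrightarrow> measure \<kappa> C" if "\<kappa> \<in> prob_measures" for \<kappa>
    proof -
      interpret prob_space \<kappa> using that by (rule prob_measuresD)
      have "(\<lambda>n. \<integral>x. \<phi> n x \<partial>\<kappa>) \<longlonglongrightarrow> (\<integral>x. indicator C x \<partial>\<kappa>)"
        using lim \<phi>_le \<open>closed C\<close> \<phi>_meas
        by (intro integral_dominated_convergence[where w = "\<lambda>_. 1"]) (auto simp: prob_measuresD[OF that])
      then show ?thesis using \<open>closed C\<close> by (simp add: prob_measuresD[OF that])
    qed
    have "measure \<mu> C = measure \<nu> C"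
      using conv[OF \<mu>] conv[OF \<nu>] \<phi>_eq LIMSEQ_unique by auto
    moreover have "finite_measure \<mu>" "finite_measure \<nu>"
      using \<mu> \<nu> prob_space.finite_measure prob_measuresD(1) by blast+
    ultimately show ?thesis
      by (simp add: finite_measure.emeasure_eq_measure)
  qed simp
  interpret prob_space \<mu> using \<mu> by (rule prob_measuresD)
  show ?thesis
  proof (rule measure_eqI_generator_eq[where E = "Collect closed" and \<Omega> = UNIV and A = "\<lambda>_. UNIV"])
    show "Int_stable (Collect (closed :: 'a set \<Rightarrow> bool))"
      by (auto simp: Int_stable_def)
    show "sets \<mu> = sigma_sets UNIV (Collect closed)" "sets \<nu> = sigma_sets UNIV (Collect closed)"
      using \<mu> \<nu> by (simp_all add: prob_measuresD borel_eq_closed)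
    show "emeasure \<mu> UNIV \<noteq> \<infinity>" by simp
    show "emeasure \<mu> X = emeasure \<nu> X" if "X \<in> Collect closed" for X
      using that closed by simp
  qed auto
qed

lemma distr_in_prob_measures:
  "prob_space \<mu> \<Longrightarrow> X \<in> borel_measurable \<mu> \<Longrightarrow> distr \<mu> borel X \<in> prob_measures"
  by (simp add: prob_measures_def prob_space.prob_space_distr)

text \<open>The joint law of \<open>X\<close> and \<open>Y\<close> is a coupling of their laws.\<close>

lemma W1_distr_le:
  fixes X Y :: "'z \<Rightarrow> 'a::euclidean_space"
  assumes "prob_space \<mu>" and [measurable]: "X \<in> borel_measurable \<mu>" "Y \<in> borel_measurable \<mu>"
    and w: "integrable \<mu> w" and le: "\<And>z. dist (X z) (Y z) \<le> w z"
  shows "W1 (distr \<mu> borel X) (distr \<mu> borel Y) \<le> ennreal (\<integral>z. w z \<partial>\<mu>)"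
proof -
  have [measurable]: "(\<lambda>z. (X z, Y z)) \<in> borel_measurable \<mu>"
    unfolding borel_prod[symmetric] by measurable
  have [measurable]: "fst \<in> borel_measurable (borel :: ('a \<times> 'a) measure)" "snd \<in> borel_measurable (borel :: ('a \<times> 'a) measure)"
    unfolding borel_prod[symmetric] by measurable
  let ?\<pi> = "distr \<mu> borel (\<lambda>z. (X z, Y z))"
  have "?\<pi> \<in> couplings (distr \<mu> borel X) (distr \<mu> borel Y)"
    using assms(1) by (auto simp: couplings_def distr_in_prob_measures distr_distr comp_def)
  then have "W1 (distr \<mu> borel X) (distr \<mu> borel Y) \<le> (\<integral>\<^sup>+ p. ennreal (dist (fst p) (snd p)) \<partial>?\<pi>)"
    unfolding W1_def by (rule INF_lower)
  also have "\<dots> = (\<integral>\<^sup>+ z. ennreal (dist (X z) (Y z)) \<partial>\<mu>)"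
    by (subst nn_integral_distr) (auto intro!: measurable_compose[OF _ measurable_ennreal] borel_measurable_dist)
  also have "\<dots> \<le> (\<integral>\<^sup>+ z. ennreal (w z) \<partial>\<mu>)"
    by (intro nn_integral_mono ennreal_leI le)
  also have "\<dots> = ennreal (\<integral>z. w z \<partial>\<mu>)"
    using w le by (intro nn_integral_eq_integral) (auto intro: order_trans[OF zero_le_dist])
  finally show ?thesis .
qed

text \<open>The easy half of Kantorovich duality.\<close>

lemma integral_diff_le_W1:
  fixes g :: "'a::euclidean_space \<Rightarrow> 'b::euclidean_space"
  assumes bd: "\<And>x. norm (g x) \<le> B" and lip: "\<And>x y. norm (g x - g y) \<le> L * norm (x - y)"
    and "L \<ge> 0" and W: "W1 \<mu> \<nu> < ennreal c"
  shows "norm ((\<integral>x. g x \<partial>\<mu>) - (\<integral>x. g x \<partial>\<nu>)) \<le> L * c"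
proof -
  obtain \<pi> where \<pi>: "\<pi> \<in> couplings \<mu> \<nu>" and less: "(\<integral>\<^sup>+ p. ennreal (dist (fst p) (snd p)) \<partial>\<pi>) < ennreal c"
    using W unfolding W1_def INF_less_iff by blast
  have \<pi>p: "\<pi> \<in> prob_measures" and \<mu>: "\<mu> = distr \<pi> borel fst" and \<nu>: "\<nu> = distr \<pi> borel snd"
    using \<pi> by (auto simp: couplings_def)
  note gm [measurable] = borel_measurable_lipschitz(2)[OF lip]
  have [measurable]: "fst \<in> borel_measurable (borel :: ('a \<times> 'a) measure)" "snd \<in> borel_measurable (borel :: ('a \<times> 'a) measure)"
    unfolding borel_prod[symmetric] by measurable
  have int: "integrable \<pi> (\<lambda>p. dist (fst p) (snd p))"
  proof (rule integrableI_nonneg)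
    show "(\<integral>\<^sup>+ p. ennreal (dist (fst p) (snd p)) \<partial>\<pi>) < \<infinity>"
      using less by (rule order.strict_trans) simp
  qed (auto simp: prob_measuresD[OF \<pi>p])
  have ig: "integrable \<pi> (\<lambda>p. g (fst p))" "integrable \<pi> (\<lambda>p. g (snd p))"
    by (auto intro!: prob_integrable_bounded[OF \<pi>p _ bd])
  have "(\<integral>x. g x \<partial>\<mu>) - (\<integral>x. g x \<partial>\<nu>) = (\<integral>p. g (fst p) \<partial>\<pi>) - (\<integral>p. g (snd p) \<partial>\<pi>)"
    unfolding \<mu> \<nu> by (subst (1 2) integral_distr) (auto simp: prob_measuresD[OF \<pi>p])
  also have "\<dots> = (\<integral>p. g (fst p) - g (snd p) \<partial>\<pi>)"
    using ig by simp
  also have "norm \<dots> \<le> (\<integral>p. L * dist (fst p) (snd p) \<partial>\<pi>)"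
    using ig int lip by (intro Bochner_Integration.integral_norm_bound_integral) (auto simp: dist_norm)
  also have "\<dots> = L * (\<integral>p. dist (fst p) (snd p) \<partial>\<pi>)"
    by simp
  also have "\<dots> \<le> L * c"
  proof (intro mult_left_mono \<open>L \<ge> 0\<close>)
    have "ennreal (\<integral>p. dist (fst p) (snd p) \<partial>\<pi>) < ennreal c"
      using less int by (simp add: nn_integral_eq_integral)
    then show "(\<integral>p. dist (fst p) (snd p) \<partial>\<pi>) \<le> c"
      by (metis ennreal_less_iff ennreal_neg less_eq_real_def linorder_not_less not_less_zero)
  qed
  finally show ?thesis .
qed

section \<open>The mean-field flow\<close>

lemma norm_integral_diff_le:
  fixes f g :: "'z \<Rightarrow> 'b::euclidean_space"
  assumes "integrable \<mu> f" "integrable \<mu> g" "integrable \<mu> w" "\<And>z. norm (f z - g z) \<le> w z"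
  shows "norm ((\<integral>z. f z \<partial>\<mu>) - (\<integral>z. g z \<partial>\<mu>)) \<le> (\<integral>z. w z \<partial>\<mu>)"
proof -
  have "norm (\<integral>z. f z - g z \<partial>\<mu>) \<le> (\<integral>z. norm (f z - g z) \<partial>\<mu>)"
    by (rule integral_norm_bound)
  also have "\<dots> \<le> (\<integral>z. w z \<partial>\<mu>)"
    using assms by (intro integral_mono) auto
  finally show ?thesis using assms by simp
qed

instance bcontfun :: (metric_space, banach) banach ..

text \<open>The field \<open>G\<close> stands for \<open>\<nabla>K\<close>.\<close>

locale lipschitz_field =
  fixes G :: "'a::euclidean_space \<Rightarrow> 'a" and M L :: real
  assumes G_bound: "norm (G x) \<le> M" and G_lip: "norm (G x - G y) \<le> L * norm (x - y)"
    and M_ge_1: "M \<ge> 1" and L_ge_1: "L \<ge> 1"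
begin

lemma G_continuous [continuous_intros]: "continuous_on A f \<Longrightarrow> continuous_on A (\<lambda>x. G (f x))"
  by (rule continuous_on_compose2[OF borel_measurable_lipschitz(1)[OF G_lip, of UNIV]]) auto

lemma G_measurable [measurable]: "G \<in> borel_measurable borel"
  by (rule borel_measurable_lipschitz(2)[OF G_lip])

lemma G_integrable:
  assumes "prob_space \<mu>" "X \<in> borel_measurable \<mu>"
  shows "integrable \<mu> (\<lambda>z. G (c - X z))"
proof -
  interpret prob_space \<mu> by fact
  have "(\<lambda>z. G (c - X z)) \<in> borel_measurable \<mu>"
    using assms(2) by measurable
  then show ?thesis
    by (intro integrable_const_bound[where B = M]) (auto simp: G_bound)
qed

lemma conv_distr:
  assumes "X \<in> borel_measurable \<mu>"
  shows "conv_measure G (distr \<mu> borel X) x = (\<integral>z. G (x - X z) \<partial>\<mu>)"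
  unfolding conv_measure_def by (rule integral_distr[OF assms]) simp

lemma conv_bound: "prob_space \<mu> \<Longrightarrow> norm (conv_measure G \<mu> x) \<le> M"
  unfolding conv_measure_def by (rule norm_prob_integral_le) (auto intro: G_bound)

lemma G_integral_diff_le:
  assumes "prob_space \<mu>" "X \<in> borel_measurable \<mu>" "Y \<in> borel_measurable \<mu>" "integrable \<mu> w"
    and "\<And>z. norm ((x - X z) - (y - Y z)) \<le> w z"
  shows "norm ((\<integral>z. G (x - X z) \<partial>\<mu>) - (\<integral>z. G (y - Y z) \<partial>\<mu>)) \<le> L * (\<integral>z. w z \<partial>\<mu>)"
proof -
  have "norm ((\<integral>z. G (x - X z) \<partial>\<mu>) - (\<integral>z. G (y - Y z) \<partial>\<mu>)) \<le> (\<integral>z. L * w z \<partial>\<mu>)"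
  proof (rule norm_integral_diff_le)
    show "norm (G (x - X z) - G (y - Y z)) \<le> L * w z" for z
      using L_ge_1 assms(5) by (intro order_trans[OF G_lip] mult_left_mono) auto
  qed (use assms in \<open>auto intro!: G_integrable\<close>)
  then show ?thesis by simp
qed

lemma conv_lipschitz:
  assumes "\<mu> \<in> prob_measures"
  shows "norm (conv_measure G \<mu> x - conv_measure G \<mu> y) \<le> L * norm (x - y)"
proof -
  interpret prob_space \<mu> using assms by (rule prob_measuresD)
  have id: "(\<lambda>z. z) \<in> borel_measurable \<mu>"
    using assms by (simp add: prob_measuresD)
  show ?thesis
    using G_integral_diff_le[OF prob_space_axioms id id, of "\<lambda>_. norm (x - y)" x y]
    by (simp add: conv_measure_def prob_space)
qed

text \<open>The unknown is the displacement \<open>U = X - id\<close>, since \<open>X\<close> itself is unbounded. The velocity of \<open>U\<close> is bounded by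
  \<open>M\<close> and Lipschitz in the supremum norm with constant \<open>2 L\<close>: moving both interacting particles by at
  most \<open>d\<close> changes their difference by at most \<open>2 d\<close>.\<close>

lemma aggregation_flow_exists:
  assumes \<rho>0: "\<rho>0 \<in> prob_measures" and "T \<ge> 0"
  obtains X where "\<And>x. X 0 x = x" "\<And>t. continuous_on UNIV (X t)"
    "\<And>t x. t \<in> {0..T} \<Longrightarrow> ((\<lambda>s. X s x) has_vector_derivative
        - conv_measure G (distr \<rho>0 borel (X t)) (X t x)) (at t within {0..T})"
proof -
  interpret prob_space \<rho>0 using \<rho>0 by (rule prob_measuresD)
  define V where "V U x = - (\<integral>y. G (x + apply_bcontfun U x - (y + apply_bcontfun U y)) \<partial>\<rho>0)" for U :: "'a \<Rightarrow>\<^sub>C 'a" and x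
  have meas: "(\<lambda>y. y + apply_bcontfun U y) \<in> borel_measurable \<rho>0" for U :: "'a \<Rightarrow>\<^sub>C 'a"
    unfolding prob_measuresD(4)[OF \<rho>0] by (intro borel_measurable_continuous_onI continuous_intros) auto
  have V_bound: "norm (V U x) \<le> M" for U x
    unfolding V_def norm_minus_cancel by (rule norm_prob_integral_le[OF prob_space_axioms]) (rule G_bound)
  have V_lip: "norm (V U x - V U y) \<le> L * norm (x + apply_bcontfun U x - (y + apply_bcontfun U y))" for U x y
    using G_integral_diff_le[OF prob_space_axioms meas meas, of "\<lambda>_. norm (x + apply_bcontfun U x - (y + apply_bcontfun U y))"
        "x + apply_bcontfun U x" U "y + apply_bcontfun U y" U]
    unfolding V_def by (simp add: prob_space norm_minus_commute)
  have V_cont: "continuous_on UNIV (V U)" for U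
    unfolding continuous_on_def
  proof
    fix x
    have c: "(apply_bcontfun U \<longlongrightarrow> apply_bcontfun U x) (at x)"
      using continuous_on_apply_bcontfun[of UNIV U] unfolding continuous_on_def by blast
    have "((\<lambda>y. L * norm (y + apply_bcontfun U y - (x + apply_bcontfun U x)))
        \<longlongrightarrow> L * norm (x + apply_bcontfun U x - (x + apply_bcontfun U x))) (at x)"
      by (intro tendsto_intros c)
    then have "((\<lambda>y. L * norm (y + apply_bcontfun U y - (x + apply_bcontfun U x))) \<longlongrightarrow> 0) (at x)"
      by simp
    then have "((\<lambda>y. V U y - V U x) \<longlongrightarrow> 0) (at x)"
      by (rule Lim_null_comparison[rotated]) (simp add: V_lip)
    then show "(V U \<longlongrightarrow> V U x) (at x)"
      by (rule LIM_zero_cancel)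
  qed
  have VB: "V U \<in> bcontfun" for U
    using V_cont V_bound by (rule bcontfun_normI)
  define F where "F U = Bcontfun (V U)" for U
  have F: "apply_bcontfun (F U) = V U" for U
    unfolding F_def by (rule Bcontfun_inverse[OF VB])
  have F_lip: "norm (F U - F W) \<le> (2 * L) * norm (U - W)" for U W
  proof (rule norm_bound)
    fix x
    have le: "norm (apply_bcontfun U y - apply_bcontfun W y) \<le> norm (U - W)" for y
      using norm_bounded[of "U - W" y] by simp
    have "norm (x + apply_bcontfun U x - (y + apply_bcontfun U y) - (x + apply_bcontfun W x - (y + apply_bcontfun W y)))
        \<le> 2 * norm (U - W)" for y
    proof -
      have eq: "x + apply_bcontfun U x - (y + apply_bcontfun U y) - (x + apply_bcontfun W x - (y + apply_bcontfun W y))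
         = (apply_bcontfun U x - apply_bcontfun W x) - (apply_bcontfun U y - apply_bcontfun W y)"
        by simp
      show ?thesis
        unfolding eq using norm_triangle_ineq4[of "apply_bcontfun U x - apply_bcontfun W x" "apply_bcontfun U y - apply_bcontfun W y"] le[of x] le[of y]
        by linarith
    qed
    then have "norm (V U x - V W x) \<le> L * (2 * norm (U - W))"
      using G_integral_diff_le[OF prob_space_axioms meas meas, of "\<lambda>_. 2 * norm (U - W)"
        "x + apply_bcontfun U x" U "x + apply_bcontfun W x" W]
      unfolding V_def by (simp add: prob_space norm_minus_commute)
    then show "norm (apply_bcontfun (F U - F W) x) \<le> 2 * L * norm (U - W)"
      by (simp add: F)
  qed
  have "continuous_on ({0..T} \<times> UNIV) (\<lambda>(t, U). F U)"
    unfolding split_beta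
    by (rule continuous_on_compose2[OF borel_measurable_lipschitz(1)[OF F_lip, of UNIV]]) (auto intro: continuous_intros)
  then obtain U where U0: "U 0 = 0" and U: "\<And>t. t \<in> {0..T} \<Longrightarrow> (U has_vector_derivative F (U t)) (at t within {0..T})"
    using ode_existence[of T "\<lambda>t U. F U" "2 * L" 0] F_lip L_ge_1 \<open>T \<ge> 0\<close> by auto
  define X where "X t x = x + apply_bcontfun (U t) x" for t x
  show thesis
  proof (rule that[of X])
    show "X 0 x = x" for x by (simp add: X_def U0)
    show "continuous_on UNIV (X t)" for t
      unfolding X_def by (intro continuous_intros) auto
    fix t x assume t: "t \<in> {0..T}"
    have bl: "bounded_linear (\<lambda>W :: 'a \<Rightarrow>\<^sub>C 'a. apply_bcontfun W x)"
      by (rule bounded_linear_intro[where K = 1]) (auto simp: norm_bounded)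
    have "((\<lambda>s. apply_bcontfun (U s) x) has_vector_derivative V (U t) x) (at t within {0..T})"
      using bounded_linear.has_vector_derivative[OF bl U[OF t]] by (simp add: F)
    then have "((\<lambda>s. X s x) has_vector_derivative V (U t) x) (at t within {0..T})"
      unfolding X_def by (auto intro!: derivative_eq_intros)
    moreover have "X t \<in> borel_measurable \<rho>0"
      using meas[of "U t"] by (simp add: X_def[abs_def])
    ultimately show "((\<lambda>s. X s x) has_vector_derivative - conv_measure G (distr \<rho>0 borel (X t)) (X t x)) (at t within {0..T})"
      by (simp add: conv_distr V_def X_def)
  qed
qed

end

section \<open>The flow yields a weak solution\<close>

lemma C1c_C1b_quotient:
  assumes "C1c_C1b T \<psi> \<psi>'" "t \<in> {0..<T}"
  obtains q where "(q \<longlongrightarrow> 0) (at t within {0..<T})"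
    "\<And>s x. s \<in> {0..<T} \<Longrightarrow> \<bar>(\<psi> s x - \<psi> t x) / (s - t) - \<psi>' t x\<bar> \<le> q s"
proof (rule that)
  let ?Q = "\<lambda>s x. (\<psi> s x - \<psi> t x) / (s - t) - \<psi>' t x"
  show "((\<lambda>s. C1b_norm (?Q s)) \<longlongrightarrow> 0) (at t within {0..<T})"
    using assms by (auto simp: C1c_C1b_def)
  fix s x assume "s \<in> {0..<T}"
  then have "?Q s \<in> C1b"
    using assms C1b_diff(1)[OF C1b_scale(1)[OF C1b_diff(1)], of "\<psi> s" "\<psi> t" "\<psi>' t" "1 / (s - t)"]
    by (auto simp: C1c_C1b_def)
  then show "\<bar>?Q s x\<bar> \<le> C1b_norm (?Q s)"
    by (rule C1b_norm_bounds)
qed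

text \<open>A chain rule along a curve. The time difference quotient converges uniformly in space, so it may be
  evaluated at the moving point \<open>X s\<close>.\<close>

lemma C1c_C1b_chain:
  assumes \<psi>: "C1c_C1b T \<psi> \<psi>'" and t: "t \<in> {0..<T}"
    and X: "(X has_vector_derivative v) (at t within {0..<T})"
  shows "((\<lambda>s. \<psi> s (X s)) has_vector_derivative \<psi>' t (X t) + grad (\<psi> t) (X t) \<bullet> v) (at t within {0..<T})"
proof -
  let ?F = "at t within {0..<T}"
  obtain q where q: "(q \<longlongrightarrow> 0) ?F"
    and le: "\<And>s x. s \<in> {0..<T} \<Longrightarrow> \<bar>(\<psi> s x - \<psi> t x) / (s - t) - \<psi>' t x\<bar> \<le> q s"
    using C1c_C1b_quotient[OF \<psi> t] by metis
  have C: "\<psi> t \<in> C1b" "\<psi>' t \<in> C1b"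
    using \<psi> t by (auto simp: C1c_C1b_def)
  have "((\<lambda>s. (\<psi> s (X s) - \<psi> t (X s)) / (s - t) - \<psi>' t (X s)) \<longlongrightarrow> 0) ?F"
    using le by (intro Lim_null_comparison[OF _ q]) (auto simp: eventually_at_filter intro!: always_eventually)
  moreover have "((\<lambda>s. \<psi>' t (X s)) \<longlongrightarrow> \<psi>' t (X t)) ?F"
  proof (rule isCont_tendsto_compose[where g = "\<psi>' t"])
    show "isCont (\<psi>' t) (X t)"
      using C1b_continuous(1)[OF C(2), of UNIV] by (simp add: continuous_on_eq_continuous_at)
    show "(X \<longlongrightarrow> X t) ?F"
      using has_vector_derivative_continuous[OF X] by (simp add: continuous_within)
  qed
  moreover have "((\<lambda>s. (\<psi> t (X s) - \<psi> t (X t)) / (s - t)) \<longlongrightarrow> grad (\<psi> t) (X t) \<bullet> v) ?F"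
  proof -
    have "((\<lambda>s. \<psi> t (X s)) has_vector_derivative grad (\<psi> t) (X t) \<bullet> v) ?F"
      using has_derivative_compose[OF X[unfolded has_vector_derivative_def] C1b_has_derivative[OF C(1)]]
      by (simp add: has_vector_derivative_def)
    then show ?thesis
      by (simp add: has_real_derivative_iff_has_vector_derivative[symmetric] has_field_derivative_iff)
  qed
  ultimately have "((\<lambda>s. ((\<psi> s (X s) - \<psi> t (X s)) / (s - t) - \<psi>' t (X s)) + \<psi>' t (X s)
      + (\<psi> t (X s) - \<psi> t (X t)) / (s - t)) \<longlongrightarrow> 0 + \<psi>' t (X t) + grad (\<psi> t) (X t) \<bullet> v) ?F"
    by (intro tendsto_add)
  moreover have "((\<psi> s (X s) - \<psi> t (X s)) / (s - t) - \<psi>' t (X s)) + \<psi>' t (X s)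
      + (\<psi> t (X s) - \<psi> t (X t)) / (s - t) = (\<psi> s (X s) - \<psi> t (X t)) / (s - t)" for s
    by (simp add: add_divide_distrib[symmetric])
  ultimately show ?thesis
    by (simp add: has_real_derivative_iff_has_vector_derivative[symmetric] has_field_derivative_iff)
qed

text \<open>The time derivative vanishes beyond the support as well, so that all time integrals run over a compact
  interval.\<close>

lemma C1c_C1b_vanishes:
  assumes \<psi>: "C1c_C1b T \<psi> \<psi>'"
  obtains S where "0 \<le> S" "S < T \<or> T \<le> 0"
    "\<And>t x. t \<in> {0..<T} \<Longrightarrow> S < t \<Longrightarrow> \<psi> t x = 0 \<and> \<psi>' t x = 0 \<and> grad (\<psi> t) x = 0"
proof -
  obtain S0 where S0: "S0 < T" "\<And>t x. t \<in> {0..<T} \<Longrightarrow> S0 < t \<Longrightarrow> \<psi> t x = 0"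
    using \<psi> by (auto simp: C1c_C1b_def)
  show thesis
  proof (rule that[of "max 0 S0"])
    fix t x assume t: "t \<in> {0..<T}" and "max 0 S0 < t"
    then have St: "S0 < t" "0 < t" "t < T" by auto
    have "\<psi> t = (\<lambda>x. 0)" using S0(2)[OF t St(1)] by auto
    then have g: "grad (\<psi> t) x = 0"
      by (simp only: grad_zero)
    obtain q where q: "(q \<longlongrightarrow> 0) (at t within {0..<T})"
      and le: "\<And>s x. s \<in> {0..<T} \<Longrightarrow> \<bar>(\<psi> s x - \<psi> t x) / (s - t) - \<psi>' t x\<bar> \<le> q s"
      using C1c_C1b_quotient[OF \<psi> t] by metis
    have at: "at t within {0..<T} = at t"
      using St by (intro at_within_interior) simp
    have "\<forall>\<^sub>F s in at t. s \<in> {max 0 S0<..<T}"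
      using St by (intro eventually_at_in_open') auto
    then have ev: "\<forall>\<^sub>F s in at t. \<bar>\<psi>' t x\<bar> \<le> q s"
    proof eventually_elim
      case (elim s)
      then have "s \<in> {0..<T}" "S0 < s" by auto
      then show ?case using le[of s x] S0(2)[of s x] S0(2)[OF t St(1)] by simp
    qed
    have "\<bar>\<psi>' t x\<bar> \<le> 0"
      by (rule tendsto_lowerbound[OF q[unfolded at] ev]) simp
    then show "\<psi> t x = 0 \<and> \<psi>' t x = 0 \<and> grad (\<psi> t) x = 0"
      using S0(2)[OF t St(1)] g by auto
  qed (use S0 in auto)
qed

text \<open>A flow as constructed above; the measures \<open>\<rho> t\<close> that it transports appear in its own velocity.\<close>

locale aggregation_flow = lipschitz_field G M L for G :: "'a::euclidean_space \<Rightarrow> 'a" and M L +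
  fixes T :: real and \<rho>0 :: "'a measure" and X :: "real \<Rightarrow> 'a \<Rightarrow> 'a"
  assumes T_pos: "T > 0" and \<rho>0: "\<rho>0 \<in> prob_measures"
    and X_0: "X 0 x = x" and X_cont: "continuous_on UNIV (X t)"
    and X_deriv: "t \<in> {0..T} \<Longrightarrow> ((\<lambda>s. X s x) has_vector_derivative
        - conv_measure G (distr \<rho>0 borel (X t)) (X t x)) (at t within {0..T})"
begin

sublocale prob_space \<rho>0 using \<rho>0 by (rule prob_measuresD)

definition \<rho> :: "real \<Rightarrow> 'a measure" where "\<rho> t = distr \<rho>0 borel (X t)"

lemma X_measurable [measurable]: "X t \<in> borel_measurable \<rho>0"
  unfolding prob_measuresD(4)[OF \<rho>0] by (rule borel_measurable_continuous_onI[OF X_cont])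

lemma \<rho>_prob: "\<rho> t \<in> prob_measures"
  unfolding \<rho>_def by (rule distr_in_prob_measures[OF prob_space_axioms X_measurable])

lemma X_speed:
  assumes "s \<in> {0..T}" "t \<in> {0..T}"
  shows "norm (X s x - X t x) \<le> M * \<bar>s - t\<bar>"
proof -
  have "norm (X b x - X a x) \<le> M * b - M * a" if "a \<in> {0..T}" "b \<in> {0..T}" "a \<le> b" for a b
    using that
  proof (intro norm_diff_le_of_derivative_le[where a = 0 and b = T and f' = "\<lambda>t. - conv_measure G (\<rho> t) (X t x)" and \<phi>' = "\<lambda>_. M"])
    show "((\<lambda>s. X s x) has_vector_derivative - conv_measure G (\<rho> r) (X r x)) (at r within {0..T})" if "r \<in> {0..T}" for r
      using X_deriv[OF that] by (simp add: \<rho>_def)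
    show "((*) M has_vector_derivative M) (at r within {0..T})" for r
      by (auto intro!: derivative_eq_intros simp: has_real_derivative_iff_has_vector_derivative[symmetric])
    show "norm (- conv_measure G (\<rho> r) (X r x)) \<le> M" for r
      using conv_bound[OF prob_measuresD(1)[OF \<rho>_prob]] by simp
  qed
  from this[of s t] this[of t s] show ?thesis
    using assms by (cases "s \<le> t") (auto simp: norm_minus_commute algebra_simps)
qed

lemma X_joint: "continuous_on ({0..T} \<times> UNIV) (\<lambda>(t, x). X t x)"
  by (rule continuous_on_uniform_family[where n = "\<lambda>t s. M * \<bar>s - t\<bar>"])
     (auto intro!: X_cont X_speed tendsto_eq_intros)

definition vel :: "real \<Rightarrow> 'a \<Rightarrow> 'a" where "vel t x = conv_measure G (\<rho> t) (X t x)"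

lemma vel_joint: "continuous_on ({0..T} \<times> UNIV) (\<lambda>(t, x). vel t x)"
proof (rule continuous_on_uniform_family[where n = "\<lambda>t s. L * (2 * M * \<bar>s - t\<bar>)"])
  show "continuous_on UNIV (vel t)" for t
    unfolding vel_def
    by (rule continuous_on_compose2[OF borel_measurable_lipschitz(1)[OF conv_lipschitz[OF \<rho>_prob], of UNIV] X_cont]) auto
  fix s t x assume st: "t \<in> {0..T}" "s \<in> {0..T}"
  have "norm (vel s x - vel t x) \<le> L * (\<integral>z. 2 * M * \<bar>s - t\<bar> \<partial>\<rho>0)"
    unfolding vel_def \<rho>_def conv_distr[OF X_measurable]
  proof (rule G_integral_diff_le[OF prob_space_axioms X_measurable X_measurable])
    fix z
    show "norm ((X s x - X s z) - (X t x - X t z)) \<le> 2 * M * \<bar>s - t\<bar>"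
      using X_speed[OF st(2,1), of x] X_speed[OF st(2,1), of z]
        norm_triangle_ineq4[of "X s x - X t x" "X s z - X t z"] by (simp add: algebra_simps)
  qed simp
  then show "norm (vel s x - vel t x) \<le> L * (2 * M * \<bar>s - t\<bar>)"
    by (simp add: prob_space)
qed (auto intro!: tendsto_eq_intros)

lemma \<rho>_C_P1:
  assumes "integrable \<rho>0 norm"
  shows "\<rho> \<in> C_P1 {0..<T}"
  unfolding C_P1_def
proof (intro CollectI conjI ballI)
  fix t assume t: "t \<in> {0..<T}"
  have "integrable \<rho>0 (\<lambda>x. norm (X t x))"
  proof (rule Bochner_Integration.integrable_bound)
    show "integrable \<rho>0 (\<lambda>x. norm x + M * t)"
      using assms by simp
    show "AE x in \<rho>0. norm (norm (X t x)) \<le> norm (norm x + M * t)"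
    proof (rule AE_I2)
      fix x
      show "norm (norm (X t x)) \<le> norm (norm x + M * t)"
        using X_speed[of t 0 x] t norm_triangle_sub[of "X t x" x] M_ge_1 by (simp add: X_0)
    qed
  qed measurable
  then show "\<rho> t \<in> prob_measures_1"
    using \<rho>_prob[of t] by (simp add: prob_measures_1_def \<rho>_def integrable_distr_eq)
  have lim: "((\<lambda>s. ennreal (M * \<bar>s - t\<bar>)) \<longlongrightarrow> ennreal 0) (at t within {0..<T})"
    by (intro tendsto_ennrealI) (auto intro!: tendsto_eq_intros)
  have le: "W1 (\<rho> s) (\<rho> t) \<le> ennreal (M * \<bar>s - t\<bar>)" if "s \<in> {0..<T}" for s
    using W1_distr_le[OF prob_space_axioms X_measurable X_measurable, of "\<lambda>_. M * \<bar>s - t\<bar>" s t] X_speed[of s t] t that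
    by (simp add: \<rho>_def dist_norm prob_space)
  show "((\<lambda>s. W1 (\<rho> s) (\<rho> t)) \<longlongrightarrow> 0) (at t within {0..<T})"
  proof (rule tendsto_sandwich[OF _ _ tendsto_const])
    show "\<forall>\<^sub>F s in at t within {0..<T}. W1 (\<rho> s) (\<rho> t) \<le> ennreal (M * \<bar>s - t\<bar>)"
      using le by (auto simp: eventually_at_filter intro!: always_eventually)
  qed (use lim in auto)
qed

lemma \<rho>_narrow: "\<rho> \<in> C_P_narrow {0..<T}"
  unfolding C_P_narrow_def
proof (intro CollectI conjI ballI allI impI)
  show "\<rho> t \<in> prob_measures" for t by (rule \<rho>_prob)
  fix \<phi> :: "'a \<Rightarrow> real" assume \<phi>: "continuous_on UNIV \<phi> \<and> bounded (range \<phi>)"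
  then obtain B where B: "\<And>x. norm (\<phi> x) \<le> B"
    by (auto simp: bounded_iff)
  have [measurable]: "\<phi> \<in> borel_measurable borel"
    using \<phi> by (intro borel_measurable_continuous_onI) simp
  have eq: "(\<integral>x. \<phi> x \<partial>\<rho> t) = (\<integral>x. \<phi> (X t x) \<partial>\<rho>0)" for t
    unfolding \<rho>_def by (rule integral_distr) auto
  show "continuous_on {0..<T} (\<lambda>t. \<integral>x. \<phi> x \<partial>\<rho> t)"
    unfolding eq continuous_on_sequentially
  proof (intro allI ballI impI, elim conjE)
    fix u t assume t: "t \<in> {0..<T}" and u: "\<forall>n. u n \<in> {0..<T}" "u \<longlonglongrightarrow> t"
    show "((\<lambda>t. \<integral>x. \<phi> (X t x) \<partial>\<rho>0) \<circ> u) \<longlonglongrightarrow> (\<integral>x. \<phi> (X t x) \<partial>\<rho>0)"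
      unfolding comp_def
    proof (rule integral_dominated_convergence[where w = "\<lambda>_. B"])
      show "AE x in \<rho>0. (\<lambda>n. \<phi> (X (u n) x)) \<longlonglongrightarrow> \<phi> (X t x)"
      proof (rule AE_I2)
        fix x
        have "((\<lambda>n. X (u n) x - X t x)) \<longlonglongrightarrow> 0"
        proof (rule Lim_null_comparison)
          show "\<forall>\<^sub>F n in sequentially. norm (X (u n) x - X t x) \<le> M * \<bar>u n - t\<bar>"
            using u(1) t X_speed by (intro always_eventually allI) (meson atLeastAtMost_iff atLeastLessThan_iff less_imp_le)
          show "(\<lambda>n. M * \<bar>u n - t\<bar>) \<longlonglongrightarrow> 0"
            using u(2) by (auto intro!: tendsto_eq_intros)
        qed
        then have "(\<lambda>n. X (u n) x) \<longlonglongrightarrow> X t x"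
          by (rule LIM_zero_cancel)
        then show "(\<lambda>n. \<phi> (X (u n) x)) \<longlonglongrightarrow> \<phi> (X t x)"
          using \<phi> by (intro isCont_tendsto_compose[where g = \<phi>]) (auto simp: continuous_on_eq_continuous_at)
      qed
    qed (use B in auto)
  qed
qed

text \<open>Integrability for Fubini: the integrand is bounded and vanishes outside \<open>[0,S]\<close>, a set of finite measure.\<close>

lemma time_space_integrable:
  assumes k: "continuous_on ({0..<T} \<times> UNIV) (\<lambda>(t, x). k t x)"
    and S: "0 \<le> S" "S < T" "\<And>t x. t \<in> {0..<T} \<Longrightarrow> S < t \<Longrightarrow> k t x = 0"
    and B: "\<And>t x. t \<in> {0..S} \<Longrightarrow> \<bar>k t x\<bar> \<le> B"
  shows "integrable (lborel \<Otimes>\<^sub>M \<rho>0) (\<lambda>(t, x). indicator {0..<T} t *\<^sub>R (k t x :: real))"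
proof -
  interpret P: pair_sigma_finite lborel \<rho>0 ..
  have sets: "sets (lborel \<Otimes>\<^sub>M \<rho>0) = sets (borel :: (real \<times> 'a) measure)"
    unfolding borel_prod[symmetric] by (intro sets_pair_measure_cong) (auto simp: prob_measuresD[OF \<rho>0])
  have "(\<lambda>p. indicator ({0..<T} \<times> UNIV) p *\<^sub>R (case p of (t, x) \<Rightarrow> k t x)) \<in> borel_measurable borel"
    by (intro borel_measurable_continuous_on_indicator k) (unfold borel_prod[symmetric], measurable)
  also have "(\<lambda>p. indicator ({0..<T} \<times> UNIV) p *\<^sub>R (case p of (t, x) \<Rightarrow> k t x)) = (\<lambda>(t, x). indicator {0..<T} t *\<^sub>R k t x)"
    by (auto simp: fun_eq_iff indicator_def)
  finally have meas: "(\<lambda>(t, x). indicator {0..<T} t *\<^sub>R k t x) \<in> borel_measurable (lborel \<Otimes>\<^sub>M \<rho>0)"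
    using measurable_cong_sets[OF sets refl] by blast
  show ?thesis
  proof (rule integrableI_bounded_set[where A = "{0..S} \<times> space \<rho>0" and B = B])
    show "emeasure (lborel \<Otimes>\<^sub>M \<rho>0) ({0..S} \<times> space \<rho>0) < \<infinity>"
      using S by (simp add: emeasure_pair_measure_Times emeasure_space_1)
    show "AE p \<in> {0..S} \<times> space \<rho>0 in lborel \<Otimes>\<^sub>M \<rho>0. norm (case p of (t, x) \<Rightarrow> indicator {0..<T} t *\<^sub>R k t x) \<le> B"
      using B S(2) by (intro AE_I2) auto
    show "AE p in lborel \<Otimes>\<^sub>M \<rho>0. p \<notin> {0..S} \<times> space \<rho>0 \<longrightarrow> (case p of (t, x) \<Rightarrow> indicator {0..<T} t *\<^sub>R k t x) = 0"
    proof (rule AE_I2)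
      fix p :: "real \<times> 'a" assume p: "p \<in> space (lborel \<Otimes>\<^sub>M \<rho>0)"
      then show "p \<notin> {0..S} \<times> space \<rho>0 \<longrightarrow> (case p of (t, x) \<Rightarrow> indicator {0..<T} t *\<^sub>R k t x) = 0"
        using S(3)[of "fst p" "snd p"] by (force simp: space_pair_measure indicator_def)
    qed
  qed (use meas in auto)
qed

text \<open>Integrated over \<open>[0,T)\<close>, the time derivative of \<open>\<psi>\<close> along the trajectory from \<open>x\<close> leaves \<open>- \<psi> 0 x\<close>;
  integrating over \<open>\<rho>0\<close> and exchanging the integrals gives the weak formulation.\<close>

theorem \<rho>_weak_solution: "weak_solution T G \<rho>0 \<rho>"
  unfolding weak_solution_def
proof (intro conjI allI impI \<rho>_narrow)
  fix \<psi> \<psi>' :: "real \<Rightarrow> 'a \<Rightarrow> real" assume \<psi>: "C1c_C1b T \<psi> \<psi>'"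
  interpret P: pair_sigma_finite lborel \<rho>0 ..
  have C: "\<psi> t \<in> C1b" "\<psi>' t \<in> C1b" if "t \<in> {0..<T}" for t
    using \<psi> that by (auto simp: C1c_C1b_def)
  have lim': "((\<lambda>s. C1b_norm (\<lambda>x. \<psi>' s x - \<psi>' t x)) \<longlongrightarrow> 0) (at t within {0..<T})" if "t \<in> {0..<T}" for t
    using \<psi> that by (auto simp: C1c_C1b_def)
  obtain S where S: "0 \<le> S" "S < T"
    and van: "\<And>t x. t \<in> {0..<T} \<Longrightarrow> S < t \<Longrightarrow> \<psi> t x = 0 \<and> \<psi>' t x = 0 \<and> grad (\<psi> t) x = 0"
    using C1c_C1b_vanishes[OF \<psi>] T_pos by (metis not_le)
  define k1 where "k1 t x = \<psi>' t (X t x)" for t x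
  define k2 where "k2 t x = grad (\<psi> t) (X t x) \<bullet> vel t x" for t x
  have sub: "{0..<T} \<times> UNIV \<subseteq> {0..T} \<times> (UNIV :: 'a set)" by auto
  have Xj: "continuous_on ({0..<T} \<times> UNIV) (\<lambda>p. (fst p, X (fst p) (snd p)))"
    using continuous_on_subset[OF X_joint sub] by (auto simp: split_beta intro!: continuous_intros)
  have Xim: "(\<lambda>p. (fst p, X (fst p) (snd p))) ` ({0..<T} \<times> UNIV) \<subseteq> {0..<T} \<times> UNIV"
    by auto
  have k1c: "continuous_on ({0..<T} \<times> UNIV) (\<lambda>(t, x). k1 t x)"
    unfolding k1_def split_beta
    using continuous_on_compose2[OF C1b_curve(1)[OF C(2) lim'] Xj Xim] by (simp add: split_beta)
  have k2c: "continuous_on ({0..<T} \<times> UNIV) (\<lambda>(t, x). k2 t x)"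
    unfolding k2_def split_beta
    using continuous_on_compose2[OF C1b_curve(2)[OF C(1) C1c_C1b_continuity[OF \<psi>]] Xj Xim] continuous_on_subset[OF vel_joint sub]
    by (intro continuous_on_inner) (auto simp: split_beta)
  have cS: "compact {0..S}" "{0..S} \<subseteq> {0..<T}" using S by auto
  obtain B1 where B1: "\<And>t x. t \<in> {0..S} \<Longrightarrow> \<bar>k1 t x\<bar> \<le> B1"
    using C1b_curve(3)[OF C(2) lim' cS] unfolding k1_def by metis
  obtain B2 where B2: "\<And>t x. t \<in> {0..S} \<Longrightarrow> norm (grad (\<psi> t) x) \<le> B2"
    using C1b_curve(3)[OF C(1) C1c_C1b_continuity[OF \<psi>] cS] by metis
  have B2': "\<bar>k2 t x\<bar> \<le> B2 * M" if "t \<in> {0..S}" for t x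
    unfolding k2_def vel_def
    by (rule order_trans[OF Cauchy_Schwarz_ineq2])
       (use B2[OF that] order_trans[OF norm_ge_zero B2[OF that]] in \<open>auto intro!: mult_mono conv_bound prob_measuresD[OF \<rho>_prob]\<close>)
  have int1: "integrable (lborel \<Otimes>\<^sub>M \<rho>0) (\<lambda>(t, x). indicator {0..<T} t *\<^sub>R k1 t x)"
    using van by (intro time_space_integrable[OF k1c S _ B1]) (auto simp: k1_def)
  have int2: "integrable (lborel \<Otimes>\<^sub>M \<rho>0) (\<lambda>(t, x). indicator {0..<T} t *\<^sub>R k2 t x)"
    using van by (intro time_space_integrable[OF k2c S _ B2']) (auto simp: k2_def)
  have I1: "(LINT t:{0..<T}|lborel. (\<integral>x. \<psi>' t x \<partial>\<rho> t)) = (\<integral>t. \<integral>x. indicator {0..<T} t *\<^sub>R k1 t x \<partial>\<rho>0 \<partial>lborel)"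
    unfolding set_lebesgue_integral_def
  proof (rule Bochner_Integration.integral_cong[OF refl])
    fix t
    show "indicator {0..<T} t *\<^sub>R (\<integral>x. \<psi>' t x \<partial>\<rho> t) = (\<integral>x. indicator {0..<T} t *\<^sub>R k1 t x \<partial>\<rho>0)"
    proof (cases "t \<in> {0..<T}")
      case True
      then show ?thesis
        unfolding \<rho>_def k1_def
        by (subst integral_distr) (auto intro!: borel_measurable_continuous_onI C1b_continuous C)
    qed simp
  qed
  have I2: "(LINT t:{0..<T}|lborel. (\<integral>x. grad (\<psi> t) x \<bullet> conv_measure G (\<rho> t) x \<partial>\<rho> t))
      = (\<integral>t. \<integral>x. indicator {0..<T} t *\<^sub>R k2 t x \<partial>\<rho>0 \<partial>lborel)"
    unfolding set_lebesgue_integral_def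
  proof (rule Bochner_Integration.integral_cong[OF refl])
    fix t
    show "indicator {0..<T} t *\<^sub>R (\<integral>x. grad (\<psi> t) x \<bullet> conv_measure G (\<rho> t) x \<partial>\<rho> t) = (\<integral>x. indicator {0..<T} t *\<^sub>R k2 t x \<partial>\<rho>0)"
    proof (cases "t \<in> {0..<T}")
      case True
      have "(\<lambda>x. grad (\<psi> t) x \<bullet> conv_measure G (\<rho> t) x) \<in> borel_measurable borel"
        by (intro borel_measurable_continuous_onI continuous_on_inner C1b_continuous C True
            borel_measurable_lipschitz(1)[OF conv_lipschitz[OF \<rho>_prob]])
      then have "(\<integral>x. grad (\<psi> t) x \<bullet> conv_measure G (\<rho> t) x \<partial>\<rho> t) = (\<integral>x. k2 t x \<partial>\<rho>0)"
        unfolding k2_def vel_def by (rule integral_distr[OF X_measurable, folded \<rho>_def])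
      then show ?thesis using True by simp
    qed simp
  qed
  have inner: "(\<integral>t. indicator {0..<T} t *\<^sub>R k1 t x - indicator {0..<T} t *\<^sub>R k2 t x \<partial>lborel) = - \<psi> 0 x" for x
  proof -
    \<comment> \<open>Beyond \<open>S\<close> everything vanishes; the margin up to \<open>R\<close> makes the upper boundary term zero.\<close>
    define R where "R = (S + T) / 2"
    have R: "S < R" "R < T" "0 < R" using S by (auto simp: R_def)
    let ?k = "\<lambda>t. k1 t x - k2 t x"
    have sl: "continuous_on {0..R} (\<lambda>t. (t, x))" by (intro continuous_intros)
    have im: "(\<lambda>t. (t, x)) ` {0..R} \<subseteq> {0..<T} \<times> UNIV" using R by auto
    have kc: "continuous_on {0..R} ?k"
      using continuous_on_compose2[OF k1c sl im] continuous_on_compose2[OF k2c sl im]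
      by (intro continuous_on_diff) auto
    have "(?k has_integral \<psi> R (X R x) - \<psi> 0 (X 0 x)) {0..R}"
    proof (rule fundamental_theorem_of_calculus)
      show "0 \<le> R" using R by simp
      fix t assume t: "t \<in> {0..R}"
      have "((\<lambda>s. X s x) has_vector_derivative - vel t x) (at t within {0..<T})"
        using X_deriv[of t x] t R unfolding vel_def \<rho>_def
        by (auto elim!: has_vector_derivative_within_subset)
      then have "((\<lambda>s. \<psi> s (X s x)) has_vector_derivative \<psi>' t (X t x) + grad (\<psi> t) (X t x) \<bullet> (- vel t x)) (at t within {0..<T})"
        using t R by (intro C1c_C1b_chain[OF \<psi>]) auto
      then have "((\<lambda>s. \<psi> s (X s x)) has_vector_derivative ?k t) (at t within {0..<T})"
        by (simp add: k1_def k2_def)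
      then show "((\<lambda>s. \<psi> s (X s x)) has_vector_derivative ?k t) (at t within {0..R})"
        by (rule has_vector_derivative_within_subset) (use R in auto)
    qed
    then have "integral {0..R} ?k = - \<psi> 0 x"
      using van[of R] R by (simp add: integral_unique X_0)
    moreover have "(LINT t:{0..R}|lborel. ?k t) = integral {0..R} ?k"
      by (rule set_borel_integral_eq_integral(2)) (rule borel_integrable_atLeastAtMost'[OF kc])
    moreover have "(\<integral>t. indicator {0..<T} t *\<^sub>R k1 t x - indicator {0..<T} t *\<^sub>R k2 t x \<partial>lborel) = (LINT t:{0..R}|lborel. ?k t)"
      unfolding set_lebesgue_integral_def
    proof (rule Bochner_Integration.integral_cong[OF refl])
      fix t
      show "indicator {0..<T} t *\<^sub>R k1 t x - indicator {0..<T} t *\<^sub>R k2 t x = indicator {0..R} t *\<^sub>R ?k t"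
        using van[of t] R by (auto simp: indicator_def k1_def k2_def)
    qed
    ultimately show ?thesis by simp
  qed
  have "(LINT t:{0..<T}|lborel. (\<integral>x. \<psi>' t x \<partial>\<rho> t))
      - (LINT t:{0..<T}|lborel. (\<integral>x. grad (\<psi> t) x \<bullet> conv_measure G (\<rho> t) x \<partial>\<rho> t))
    = integral\<^sup>L (lborel \<Otimes>\<^sub>M \<rho>0) (\<lambda>(t, x). indicator {0..<T} t *\<^sub>R k1 t x)
      - integral\<^sup>L (lborel \<Otimes>\<^sub>M \<rho>0) (\<lambda>(t, x). indicator {0..<T} t *\<^sub>R k2 t x)"
    unfolding I1 I2 P.integral_fst[OF int1] P.integral_fst[OF int2] ..
  also have "\<dots> = integral\<^sup>L (lborel \<Otimes>\<^sub>M \<rho>0) (\<lambda>(t, x). indicator {0..<T} t *\<^sub>R k1 t x - indicator {0..<T} t *\<^sub>R k2 t x)"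
    by (subst Bochner_Integration.integral_diff[OF int1 int2, symmetric]) (simp add: case_prod_unfold)
  also have "\<dots> = (\<integral>x. (\<integral>t. indicator {0..<T} t *\<^sub>R k1 t x - indicator {0..<T} t *\<^sub>R k2 t x \<partial>lborel) \<partial>\<rho>0)"
    by (rule P.integral_snd[symmetric])
       (use Bochner_Integration.integrable_diff[OF int1 int2] in \<open>simp add: case_prod_unfold\<close>)
  also have "\<dots> = - (\<integral>x. \<psi> 0 x \<partial>\<rho>0)"
    unfolding inner by simp
  finally show "(LINT t:{0..<T}|lborel. (\<integral>x. \<psi>' t x \<partial>\<rho> t))
        - (LINT t:{0..<T}|lborel. (\<integral>x. grad (\<psi> t) x \<bullet> conv_measure G (\<rho> t) x \<partial>\<rho> t))
        + (\<integral>x. \<psi> 0 x \<partial>\<rho>0) = 0"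
    by simp
qed

end

section \<open>Weak solutions tested with time-independent functions\<close>

text \<open>Convolution with \<open>G\<close> is controlled by the dual Lipschitz distance: in the direction \<open>e\<close> of the difference,
  \<open>y \<mapsto> G (x - y) \<bullet> e\<close> is an admissible test function.\<close>

lemma conv_diff_le_dual:
  assumes "lipschitz_field G M L" and \<mu>: "\<mu> \<in> prob_measures" and \<nu>: "\<nu> \<in> prob_measures"
    and dual: "\<And>\<phi>. bounded (range \<phi>) \<Longrightarrow> (\<And>x y. \<bar>\<phi> x - \<phi> y\<bar> \<le> norm (x - y)) \<Longrightarrow>
      \<bar>(\<integral>x. \<phi> x \<partial>\<mu>) - (\<integral>x. \<phi> x \<partial>\<nu>)\<bar> \<le> d"
  shows "norm (conv_measure G \<mu> x - conv_measure G \<nu> x) \<le> L * d"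
proof -
  interpret lipschitz_field G M L by fact
  define w where "w = conv_measure G \<mu> x - conv_measure G \<nu> x"
  show ?thesis
  proof (cases "w = 0")
    case True
    have "\<bar>(\<integral>x. (0::real) \<partial>\<mu>) - (\<integral>x. 0 \<partial>\<nu>)\<bar> \<le> d"
      by (rule dual) auto
    then show ?thesis using True L_ge_1 by (simp add: w_def)
  next
    case False
    define e where "e = w /\<^sub>R (L * norm w)"
    have e: "norm e = 1 / L"
      using False L_ge_1 by (simp add: e_def field_simps)
    define \<phi> where "\<phi> y = G (x - y) \<bullet> e" for y
    have int: "integrable \<kappa> (\<lambda>y. G (x - y))" if "\<kappa> \<in> prob_measures" for \<kappa>
      using that by (intro prob_integrable_bounded[OF that _ G_bound]) measurable
    have "w \<bullet> e = (\<integral>y. \<phi> y \<partial>\<mu>) - (\<integral>y. \<phi> y \<partial>\<nu>)"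
      unfolding \<phi>_def integral_inner_left[OF int[OF \<mu>]] integral_inner_left[OF int[OF \<nu>]]
      by (simp add: w_def conv_measure_def inner_diff_left)
    also have "\<bar>\<dots>\<bar> \<le> d"
    proof (rule dual)
      have "\<bar>\<phi> y\<bar> \<le> M * norm e" for y
        unfolding \<phi>_def by (intro order_trans[OF Cauchy_Schwarz_ineq2] mult_right_mono G_bound) auto
      then show "bounded (range \<phi>)"
        by (intro boundedI[where B = "M * norm e"]) auto
      fix y z
      have "\<bar>\<phi> y - \<phi> z\<bar> = \<bar>(G (x - y) - G (x - z)) \<bullet> e\<bar>"
        by (simp add: \<phi>_def inner_diff_left)
      also have "\<dots> \<le> norm (G (x - y) - G (x - z)) * norm e"
        by (rule Cauchy_Schwarz_ineq2)
      also have "\<dots> \<le> (L * norm (y - z)) * norm e"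
        using G_lip[of "x - y" "x - z"] by (intro mult_right_mono) (auto simp: norm_minus_commute)
      finally show "\<bar>\<phi> y - \<phi> z\<bar> \<le> norm (y - z)"
        using L_ge_1 by (simp add: e)
    qed
    finally have "w \<bullet> e \<le> d" by simp
    moreover have "w \<bullet> e = norm w / L"
      using False by (simp add: e_def power2_norm_eq_inner[symmetric] power2_eq_square field_simps)
    ultimately have "norm w / L \<le> d" by simp
    then show ?thesis
      using L_ge_1 by (simp add: w_def pos_divide_le_eq mult.commute)
  qed
qed

lemma integral_tail_small:
  fixes \<mu> :: "'a::euclidean_space measure"
  assumes \<mu>: "\<mu> \<in> prob_measures" and "e > 0"
  obtains R :: real where "(\<integral>x. min 1 (max 0 (norm x - R)) \<partial>\<mu>) < e"
proof -
  interpret prob_space \<mu> using \<mu> by (rule prob_measuresD)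
  have "(\<lambda>n. \<integral>x. min 1 (max 0 (norm x - real n)) \<partial>\<mu>) \<longlonglongrightarrow> (\<integral>x. 0 \<partial>\<mu>)"
  proof (rule integral_dominated_convergence[where w = "\<lambda>_. 1"])
    show "AE x in \<mu>. (\<lambda>n. min 1 (max 0 (norm x - real n))) \<longlonglongrightarrow> 0"
    proof (rule AE_I2)
      fix x :: 'a
      obtain N where "norm x < real N" using reals_Archimedean2 by blast
      then show "(\<lambda>n. min 1 (max 0 (norm x - real n))) \<longlonglongrightarrow> 0"
        by (intro tendsto_eventually eventually_sequentiallyI[of N]) auto
    qed
  qed (auto simp: prob_measuresD[OF \<mu>])
  then have "\<forall>\<^sub>F n in sequentially. (\<integral>x. min 1 (max 0 (norm x - real n)) \<partial>\<mu>) < e"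
    using \<open>e > 0\<close> by (intro order_tendstoD(2)[where y = 0]) simp_all
  then show thesis
    using that by (auto simp: eventually_sequentially)
qed

text \<open>Integrals of \<open>d s\<close> against a narrowly convergent family, for functions \<open>d s\<close> that tend to zero only
  pointwise. Equicontinuity makes the convergence uniform on compact sets, and a continuous cut-off
  shows that little mass escapes.\<close>

lemma narrow_integral_tendsto:
  fixes \<mu> :: "'i \<Rightarrow> 'a::euclidean_space measure" and d :: "'i \<Rightarrow> 'a \<Rightarrow> real"
  assumes prob: "\<forall>\<^sub>F s in F. \<mu> s \<in> prob_measures" and \<nu>: "\<nu> \<in> prob_measures"
    and narrow: "\<And>\<phi> :: 'a \<Rightarrow> real. continuous_on UNIV \<phi> \<Longrightarrow> bounded (range \<phi>) \<Longrightarrow>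
      ((\<lambda>s. \<integral>x. \<phi> x \<partial>\<mu> s) \<longlongrightarrow> (\<integral>x. \<phi> x \<partial>\<nu>)) F"
    and d: "\<And>x. ((\<lambda>s. d s x) \<longlongrightarrow> 0) F"
    and lip: "\<forall>\<^sub>F s in F. \<forall>x y. \<bar>d s x - d s y\<bar> \<le> K * norm (x - y)"
    and bd: "\<forall>\<^sub>F s in F. \<forall>x. 0 \<le> d s x \<and> d s x \<le> K" and "K > 0"
  shows "((\<lambda>s. \<integral>x. d s x \<partial>\<mu> s) \<longlongrightarrow> 0) F"
proof (rule tendstoI)
  fix e :: real assume "e > 0"
  \<comment> \<open>The final bound is \<open>(K + 2) h\<close>.\<close>
  define h where "h = e / (K + 3)"
  have "h > 0" using \<open>e > 0\<close> \<open>K > 0\<close> by (simp add: h_def)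
  obtain R where R: "(\<integral>x. min 1 (max 0 (norm x - R)) \<partial>\<nu>) < h"
    using integral_tail_small[OF \<nu> \<open>h > 0\<close>] by metis
  define \<kappa> where "\<kappa> x = min 1 (max 0 (norm x - R))" for x :: 'a
  have \<kappa>: "continuous_on UNIV \<kappa>" "bounded (range \<kappa>)" "\<And>x. 0 \<le> \<kappa> x" "\<And>x. \<kappa> x \<le> 1"
    by (auto simp: \<kappa>_def intro!: continuous_intros boundedI[where B = 1])
  have "\<forall>\<^sub>F s in F. (\<integral>x. \<kappa> x \<partial>\<mu> s) < h"
    using order_tendstoD(2)[OF narrow[OF \<kappa>(1,2)]] R by (simp add: \<kappa>_def)
  moreover obtain C :: "'a set" where C: "finite C" "cball 0 (R + 1) \<subseteq> (\<Union>c\<in>C. ball c (h / K))"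
  proof -
    have "cball 0 (R + 1) \<subseteq> (\<Union>c\<in>cball (0::'a) (R + 1). ball c (h / K))"
      using \<open>h > 0\<close> \<open>K > 0\<close> by auto
    from compactE_image[OF compact_cball _ this] show thesis
      using that by (metis open_ball)
  qed
  have "\<forall>\<^sub>F s in F. \<forall>c\<in>C. d s c < h"
    using \<open>h > 0\<close> by (intro eventually_ball_finite C(1) ballI order_tendstoD(2)[OF d])
  ultimately show "\<forall>\<^sub>F s in F. dist (\<integral>x. d s x \<partial>\<mu> s) 0 < e"
    using prob lip bd
  proof eventually_elim
    case (elim s)
    interpret prob_space "\<mu> s" using elim(3) by (rule prob_measuresD)
    have le: "d s x \<le> 2 * h + K * \<kappa> x" for x
    proof (cases "x \<in> cball 0 (R + 1)")
      case True
      then obtain c where c: "c \<in> C" "dist c x < h / K" using C(2) by auto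
      have "K * norm (x - c) \<le> h"
        using c(2) \<open>K > 0\<close> by (simp add: dist_norm norm_minus_commute field_simps)
      then have "d s x \<le> 2 * h"
        using elim(4)[rule_format, of x c] elim(2) c(1) by fastforce
      then show ?thesis using \<kappa>(3)[of x] \<open>K > 0\<close> by (simp add: add_increasing2)
    next
      case False
      then have "\<kappa> x = 1" by (auto simp: \<kappa>_def)
      then show ?thesis using elim(5) \<open>h > 0\<close> by (simp add: add_increasing)
    qed
    have "d s \<in> borel_measurable borel"
      using elim(4) by (intro borel_measurable_lipschitz(2)[where L = K]) auto
    then have int: "integrable (\<mu> s) (d s)"
      using elim(5) by (intro prob_integrable_bounded[OF elim(3), where B = K]) auto
    have \<kappa>int: "integrable (\<mu> s) \<kappa>"
      using \<kappa> by (intro prob_integrable_bounded[OF elim(3), where B = 1] borel_measurable_continuous_onI) auto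
    have "(\<integral>x. d s x \<partial>\<mu> s) \<le> (\<integral>x. 2 * h + K * \<kappa> x \<partial>\<mu> s)"
      using int \<kappa>int le by (intro integral_mono) auto
    also have "\<dots> = 2 * h + K * (\<integral>x. \<kappa> x \<partial>\<mu> s)"
      using \<kappa>int by (simp add: prob_space)
    also have "\<dots> \<le> 2 * h + K * h"
      using elim(1) \<open>K > 0\<close> by (intro add_left_mono mult_left_mono) auto
    also have "\<dots> < e"
    proof -
      have "(K + 3) * h = e" using \<open>K > 0\<close> by (simp add: h_def)
      then show ?thesis using \<open>h > 0\<close> by (simp add: algebra_simps)
    qed
    finally show ?case
      using elim(5) by (simp add: Bochner_Integration.integral_nonneg)
  qed
qed

lemma primitive_has_derivative:
  fixes p :: "real \<Rightarrow> real"
  assumes "continuous_on {0..<T} p" "t \<in> {0..<T}"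
  shows "((\<lambda>s. integral {0..s} p) has_real_derivative p t) (at t within {0..<T})"
proof -
  define R where "R = (t + T) / 2"
  have R: "t < R" "R < T" using assms(2) by (auto simp: R_def)
  have "((\<lambda>s. integral {0..s} p) has_vector_derivative p t) (at t within {0..R})"
    using assms R by (intro integral_has_vector_derivative) (auto elim: continuous_on_subset)
  moreover have "at t within {0..R} = at t within {0..<T}"
    using R assms(2) by (intro at_within_nhd[of t "{..<R}"]) auto
  ultimately show ?thesis
    by (simp add: has_real_derivative_iff_has_vector_derivative)
qed

lemma set_integral_eq_integral_support:
  fixes f :: "real \<Rightarrow> real"
  assumes "continuous_on {0..S} f" "S < T" "\<And>t. t \<in> {0..<T} \<Longrightarrow> S < t \<Longrightarrow> f t = 0"
  shows "(LINT t:{0..<T}|lborel. f t) = integral {0..S} f"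
proof -
  have "(LINT t:{0..<T}|lborel. f t) = (LINT t:{0..S}|lborel. f t)"
    unfolding set_lebesgue_integral_def
    using assms by (intro Bochner_Integration.integral_cong) (auto simp: indicator_def)
  also have "\<dots> = integral {0..S} f"
    by (rule set_borel_integral_eq_integral(2)) (rule borel_integrable_atLeastAtMost'[OF assms(1)])
  finally show ?thesis .
qed

text \<open>If \<open>h' = - g\<close> holds in the sense of distributions with initial value \<open>h0\<close>, then it holds classically. With
  \<open>u = h + \<integral>g - h0\<close>, the hypothesis says that \<open>\<integral> \<eta>' u = 0\<close>; choosing \<open>\<eta>' = (S - t)\<^sup>+ u\<close> yields
  \<open>\<integral> (S - t)\<^sup>+ u\<^sup>2 = 0\<close>. The factor \<open>(S - t)\<^sup>+\<close> makes \<open>\<eta>\<close> constant, hence zero, after \<open>S\<close>.\<close>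

lemma dubois_reymond:
  fixes h g :: "real \<Rightarrow> real"
  assumes h: "continuous_on {0..<T} h" and g: "continuous_on {0..<T} g"
    and test: "\<And>\<eta> \<eta>' S. 0 < S \<Longrightarrow> S < T \<Longrightarrow>
      (\<And>t. t \<in> {0..<T} \<Longrightarrow> (\<eta> has_real_derivative \<eta>' t) (at t within {0..<T})) \<Longrightarrow>
      continuous_on {0..<T} \<eta>' \<Longrightarrow> (\<And>t. t \<in> {0..<T} \<Longrightarrow> S < t \<Longrightarrow> \<eta> t = 0 \<and> \<eta>' t = 0) \<Longrightarrow>
      integral {0..S} (\<lambda>t. \<eta>' t * h t) - integral {0..S} (\<lambda>t. \<eta> t * g t) + \<eta> 0 * h0 = 0"
    and t0: "t0 \<in> {0..<T}"
  shows "h t0 = h0 - integral {0..t0} g"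
proof -
  define I where "I t = integral {0..t} g" for t
  define u where "u t = h t + I t - h0" for t
  define S where "S = (t0 + T) / 2"
  have S: "0 < S" "S < T" "t0 < S" using t0 by (auto simp: S_def)
  define p where "p t = max 0 (S - t) * u t" for t
  define J where "J t = integral {0..t} p" for t
  define \<eta> where "\<eta> t = J t - J S" for t
  have I_der: "(I has_real_derivative g t) (at t within {0..<T})" if "t \<in> {0..<T}" for t
    unfolding I_def by (rule primitive_has_derivative[OF g that])
  have I_cont: "continuous_on {0..<T} I"
    using I_der by (intro DERIV_continuous_on) auto
  have p_cont: "continuous_on {0..<T} p"
    unfolding p_def u_def by (intro continuous_intros h I_cont)
  have J_der: "(J has_real_derivative p t) (at t within {0..<T})" if "t \<in> {0..<T}" for t
    unfolding J_def by (rule primitive_has_derivative[OF p_cont that])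
  then have \<eta>_der: "(\<eta> has_real_derivative p t) (at t within {0..<T})" if "t \<in> {0..<T}" for t
    unfolding \<eta>_def using that by (auto intro!: derivative_eq_intros)
  have sub: "{0..S} \<subseteq> {0..<T}" using S by auto
  have vanish: "\<eta> t = 0 \<and> p t = 0" if t: "t \<in> {0..<T}" "S < t" for t
  proof -
    have "p integrable_on {0..t}"
      using t by (intro integrable_continuous_interval continuous_on_subset[OF p_cont]) auto
    then have "J S + integral {S..t} p = J t"
      unfolding J_def using S t by (intro Henstock_Kurzweil_Integration.integral_combine) auto
    moreover have "integral {S..t} p = integral {S..t} (\<lambda>_. 0)"
      by (intro integral_cong) (auto simp: p_def)
    ultimately show ?thesis using t by (simp add: \<eta>_def p_def)
  qed
  have \<eta>_cont: "continuous_on {0..S} \<eta>"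
    by (rule DERIV_continuous_on[where D = p], rule DERIV_subset[OF \<eta>_der sub]) (use sub in auto)
  note conts = continuous_on_subset[OF p_cont sub] continuous_on_subset[OF h sub]
    continuous_on_subset[OF g sub] continuous_on_subset[OF I_cont sub] \<eta>_cont
  have 1: "integral {0..S} (\<lambda>t. p t * h t) - integral {0..S} (\<lambda>t. \<eta> t * g t) + \<eta> 0 * h0 = 0"
    using S p_cont by (intro test[OF _ _ \<eta>_der]) (auto simp: vanish)
  have "((\<lambda>t. p t * I t + \<eta> t * g t) has_integral \<eta> S * I S - \<eta> 0 * I 0) {0..S}"
  proof (rule fundamental_theorem_of_calculus)
    fix t assume t: "t \<in> {0..S}"
    then have "t \<in> {0..<T}" using sub by auto
    note DERIV_subset[OF \<eta>_der[OF this] sub] DERIV_subset[OF I_der[OF this] sub]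
    then have "((\<lambda>t. \<eta> t * I t) has_real_derivative p t * I t + \<eta> t * g t) (at t within {0..S})"
      by (auto intro!: derivative_eq_intros)
    then show "((\<lambda>t. \<eta> t * I t) has_vector_derivative p t * I t + \<eta> t * g t) (at t within {0..S})"
      by (simp add: has_real_derivative_iff_has_vector_derivative)
  qed (use S in simp)
  then have "integral {0..S} (\<lambda>t. p t * I t + \<eta> t * g t) = 0"
    by (simp add: integral_unique \<eta>_def I_def)
  then have 2: "integral {0..S} (\<lambda>t. p t * I t) + integral {0..S} (\<lambda>t. \<eta> t * g t) = 0"
    by (subst (asm) Henstock_Kurzweil_Integration.integral_add)
       (auto intro!: integrable_continuous_interval continuous_intros conts)
  have 3: "\<eta> 0 = - integral {0..S} p"
    by (simp add: \<eta>_def J_def)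
  have "integral {0..S} (\<lambda>t. p t * u t) = integral {0..S} (\<lambda>t. (p t * h t + p t * I t) - p t * h0)"
    by (intro integral_cong) (simp add: u_def algebra_simps)
  also have "\<dots> = integral {0..S} (\<lambda>t. p t * h t) + integral {0..S} (\<lambda>t. p t * I t) - integral {0..S} p * h0"
    by (subst Henstock_Kurzweil_Integration.integral_diff Henstock_Kurzweil_Integration.integral_add integral_mult_left;
        (auto intro!: integrable_continuous_interval continuous_intros conts)?)+
  also have "\<dots> = 0"
    using 1 2 3 by simp
  finally have "integral {0..S} (\<lambda>t. p t * u t) = 0" .
  moreover have "continuous_on {0..S} (\<lambda>t. p t * u t)"
    unfolding u_def by (intro continuous_intros conts)
  moreover have "p t * u t \<ge> 0" for t
    by (simp add: p_def mult.assoc)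
  ultimately have "p t0 * u t0 = 0"
    using integral_eq_0_iff[of 0 S "\<lambda>t. p t * u t"] S t0 by auto
  then have "u t0 = 0"
    using S by (simp add: p_def)
  then show ?thesis by (simp add: u_def I_def)
qed

section \<open>Euler steps for weak solutions\<close>

lemma taylor_lipschitz_derivative:
  fixes \<phi> :: "'a::real_normed_vector \<Rightarrow> real"
  assumes D: "\<And>x. (\<phi> has_derivative blinfun_apply (\<phi>' x)) (at x)"
    and lip: "\<And>x y. norm (\<phi>' x - \<phi>' y) \<le> B * norm (x - y)"
  shows "\<bar>\<phi> (x + k) - \<phi> x - blinfun_apply (\<phi>' x) k\<bar> \<le> B * (norm k)\<^sup>2"
proof -
  have "0 \<le> B * norm k"
    using order_trans[OF norm_ge_zero lip[of k 0]] by simp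
  define f where "f s = \<phi> (x + s *\<^sub>R k) - s * blinfun_apply (\<phi>' x) k" for s
  have "norm (f 1 - f 0) \<le> B * (norm k)\<^sup>2 * 1 - B * (norm k)\<^sup>2 * 0"
  proof (rule norm_diff_le_of_derivative_le[where a = 0 and b = 1])
    fix s :: real assume s: "s \<in> {0..1}"
    have "((\<lambda>s. \<phi> (x + s *\<^sub>R k)) has_derivative (\<lambda>h. blinfun_apply (\<phi>' (x + s *\<^sub>R k)) (h *\<^sub>R k))) (at s within {0..1})"
      by (rule has_derivative_compose[OF _ D]) (auto intro!: derivative_eq_intros)
    then have "((\<lambda>s. \<phi> (x + s *\<^sub>R k)) has_vector_derivative blinfun_apply (\<phi>' (x + s *\<^sub>R k)) k) (at s within {0..1})"
      by (simp add: has_vector_derivative_def blinfun.scaleR_right)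
    then show "(f has_vector_derivative blinfun_apply (\<phi>' (x + s *\<^sub>R k)) k - blinfun_apply (\<phi>' x) k) (at s within {0..1})"
      unfolding f_def by (auto intro!: derivative_eq_intros simp: has_real_derivative_iff_has_vector_derivative[symmetric])
    show "((\<lambda>s. B * (norm k)\<^sup>2 * s) has_vector_derivative B * (norm k)\<^sup>2) (at s within {0..1})"
      unfolding has_real_derivative_iff_has_vector_derivative[symmetric] by (auto intro!: derivative_eq_intros)
    have "norm (blinfun_apply (\<phi>' (x + s *\<^sub>R k)) k - blinfun_apply (\<phi>' x) k) \<le> norm (\<phi>' (x + s *\<^sub>R k) - \<phi>' x) * norm k"
      using norm_blinfun[of "\<phi>' (x + s *\<^sub>R k) - \<phi>' x" k] by (simp add: blinfun.diff_left)
    also have "\<dots> \<le> (B * norm (s *\<^sub>R k)) * norm k"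
      using lip[of "x + s *\<^sub>R k" x] by (intro mult_right_mono) auto
    also have "\<dots> = s * (B * norm k * norm k)"
      using s by simp
    also have "\<dots> \<le> 1 * (B * norm k * norm k)"
      using s \<open>0 \<le> B * norm k\<close> by (intro mult_right_mono) auto
    finally show "norm (blinfun_apply (\<phi>' (x + s *\<^sub>R k)) k - blinfun_apply (\<phi>' x) k) \<le> B * (norm k)\<^sup>2"
      by (simp add: power2_eq_square mult.assoc)
  qed auto
  then show ?thesis by (simp add: f_def algebra_simps)
qed

text \<open>The class \<open>C\<^sup>1\<^sup>,\<^sup>1\<close> with quantitative bounds. The derivative is carried along as a bounded linear map because it will be composed with derivatives of
  Euler steps.\<close>

definition C11 :: "real \<Rightarrow> real \<Rightarrow> ('a::euclidean_space \<Rightarrow> real) \<Rightarrow> ('a \<Rightarrow> 'a \<Rightarrow>\<^sub>L real) \<Rightarrow> bool" where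
  "C11 A B \<phi> \<phi>' \<longleftrightarrow> bounded (range \<phi>) \<and> (\<forall>x. (\<phi> has_derivative blinfun_apply (\<phi>' x)) (at x)) \<and>
     (\<forall>x. norm (\<phi>' x) \<le> A) \<and> (\<forall>x y. norm (\<phi>' x - \<phi>' y) \<le> B * norm (x - y))"

lemma C11_D:
  assumes "C11 A B \<phi> \<phi>'"
  shows "bounded (range \<phi>)" "(\<phi> has_derivative blinfun_apply (\<phi>' x)) (at x)"
    "norm (\<phi>' x) \<le> A" "norm (\<phi>' x - \<phi>' y) \<le> B * norm (x - y)" "0 \<le> A"
  using assms order_trans[OF norm_ge_zero, of "\<phi>' x" A] by (auto simp: C11_def)

lemma C11_C1b:
  assumes "C11 A B \<phi> \<phi>'"
  shows "\<phi> \<in> C1b"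
proof -
  obtain b where "\<And>x. norm (\<phi> x) \<le> b"
    using C11_D(1)[OF assms] by (auto simp: bounded_iff)
  then show ?thesis
    using C11_D[OF assms] borel_measurable_lipschitz(1)[OF C11_D(4)[OF assms], of UNIV]
    by (intro C1bI[where B = b and A = A]) auto
qed

lemma C11_grad:
  assumes "C11 A B \<phi> \<phi>'"
  shows "grad \<phi> x \<bullet> v = blinfun_apply (\<phi>' x) v" "norm (grad \<phi> x) \<le> A"
    "norm (grad \<phi> x - grad \<phi> y) \<le> B * norm (x - y)"
proof -
  show *: "grad \<phi> x \<bullet> v = blinfun_apply (\<phi>' x) v" for x v
    by (rule grad_inner[OF C11_D(2)[OF assms]])
  show "norm (grad \<phi> x) \<le> A"
    using norm_grad_le[OF C11_D(2)[OF assms]] C11_D(3)[OF assms] order_trans by blast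
  let ?w = "grad \<phi> x - grad \<phi> y"
  have "norm ?w * norm ?w = ?w \<bullet> ?w"
    by (simp add: power2_norm_eq_inner[symmetric] power2_eq_square)
  also have "\<dots> = blinfun_apply (\<phi>' x - \<phi>' y) ?w"
    unfolding inner_diff_left[of _ _ ?w] * by (simp add: blinfun.diff_left)
  also have "\<dots> \<le> norm (\<phi>' x - \<phi>' y) * norm ?w"
    using norm_blinfun[of "\<phi>' x - \<phi>' y" ?w] by simp
  finally have "norm ?w \<le> norm (\<phi>' x - \<phi>' y)"
    by (cases "?w = 0") auto
  then show "norm ?w \<le> B * norm (x - y)"
    using C11_D(4)[OF assms] order_trans by blast
qed

lemma C11_mono: "C11 A B \<phi> \<phi>' \<Longrightarrow> A \<le> A' \<Longrightarrow> B \<le> B' \<Longrightarrow> C11 A' B' \<phi> \<phi>'"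
  unfolding C11_def by (meson mult_right_mono norm_ge_zero order_trans)

lemma C11_lipschitz:
  assumes "C11 A B \<phi> \<phi>'"
  shows "\<bar>\<phi> x - \<phi> y\<bar> \<le> A * norm (x - y)"
proof -
  have "norm (\<phi> x - \<phi> y) \<le> A * norm (x - y)"
    using C11_D(2,3)[OF assms]
    by (intro differentiable_bound[where S = UNIV and f' = "\<lambda>x. blinfun_apply (\<phi>' x)"])
       (auto simp: norm_blinfun.rep_eq[symmetric])
  then show ?thesis by simp
qed

text \<open>The growth of the constants is what counts: \<open>A\<close> grows by the factor \<open>1 + O(\<delta>)\<close> and \<open>B\<close> likewise, up to
  an additional \<open>O(\<delta>)\<close>, so both stay bounded over a number of steps of order \<open>1 / \<delta>\<close>.\<close>

lemma C11_compose_euler_step: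
  fixes \<phi> :: "'a::euclidean_space \<Rightarrow> real"
  assumes \<phi>: "C11 A B \<phi> \<phi>'" and "\<delta> \<ge> 0" "B \<ge> 0" "L \<ge> 0" "b \<ge> 0"
    and V: "\<And>x. (V has_derivative blinfun_apply (V' x)) (at x)" "\<And>x. norm (V' x) \<le> L"
      "\<And>x y. norm (V' x - V' y) \<le> b * norm (x - y)"
  shows "\<exists>\<phi>2'. C11 (A * (1 + \<delta> * L)) (B * (1 + \<delta> * L)\<^sup>2 + A * \<delta> * b) (\<lambda>x. \<phi> (x + \<delta> *\<^sub>R V x)) \<phi>2'"
proof -
  define S where "S x = x + \<delta> *\<^sub>R V x" for x
  define S' where "S' x = id_blinfun + \<delta> *\<^sub>R V' x" for x
  let ?c = "1 + \<delta> * L"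
  have c: "?c \<ge> 0" using \<open>\<delta> \<ge> 0\<close> \<open>L \<ge> 0\<close> by simp
  have S: "(S has_derivative blinfun_apply (S' x)) (at x)" for x
    unfolding S_def S'_def
    by (rule has_derivative_eq_rhs[OF has_derivative_add[OF has_derivative_ident has_derivative_scaleR_right[OF V(1)]]])
       (auto simp: fun_eq_iff blinfun.add_left blinfun.scaleR_left)
  have S'_le: "norm (S' x) \<le> ?c" for x
    unfolding S'_def using V(2)[of x] \<open>\<delta> \<ge> 0\<close> norm_blinfun_id_le[where 'a = 'a]
    by (intro norm_triangle_le) (auto intro!: add_mono mult_left_mono)
  have S'_lip: "norm (S' x - S' y) \<le> \<delta> * b * norm (x - y)" for x y
  proof -
    have "S' x - S' y = \<delta> *\<^sub>R (V' x - V' y)" by (simp add: S'_def scaleR_diff_right)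
    then show ?thesis using mult_left_mono[OF V(3)[of x y] \<open>\<delta> \<ge> 0\<close>] \<open>\<delta> \<ge> 0\<close> by simp
  qed
  have S_lip: "norm (S x - S y) \<le> ?c * norm (x - y)" for x y
    by (rule differentiable_bound[where S = UNIV and f' = "\<lambda>x. blinfun_apply (S' x)"])
       (auto simp: norm_blinfun.rep_eq[symmetric] S'_le intro: S)
  have A: "A \<ge> 0" using C11_D(5)[OF \<phi>] .
  have "C11 (A * ?c) (B * ?c\<^sup>2 + A * \<delta> * b) (\<lambda>x. \<phi> (S x)) (\<lambda>x. \<phi>' (S x) o\<^sub>L S' x)"
    unfolding C11_def
  proof (intro conjI allI)
    show "bounded (range (\<lambda>x. \<phi> (S x)))"
      using C11_D(1)[OF \<phi>] by (rule bounded_subset) auto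
    show "((\<lambda>x. \<phi> (S x)) has_derivative blinfun_apply (\<phi>' (S x) o\<^sub>L S' x)) (at x)" for x
      by (rule has_derivative_eq_rhs[OF has_derivative_compose[OF S C11_D(2)[OF \<phi>]]]) auto
    show "norm (\<phi>' (S x) o\<^sub>L S' x) \<le> A * ?c" for x
      by (rule order_trans[OF norm_blinfun_compose]) (intro mult_mono C11_D(3)[OF \<phi>] S'_le A norm_ge_zero)
    fix x y
    have "(\<phi>' (S x) o\<^sub>L S' x) - (\<phi>' (S y) o\<^sub>L S' y) = ((\<phi>' (S x) - \<phi>' (S y)) o\<^sub>L S' x) + (\<phi>' (S y) o\<^sub>L (S' x - S' y))"
      by (rule blinfun_eqI) (simp add: blinfun.diff_left blinfun.diff_right blinfun.add_left)
    also have "norm \<dots> \<le> norm (\<phi>' (S x) - \<phi>' (S y)) * norm (S' x) + norm (\<phi>' (S y)) * norm (S' x - S' y)"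
      by (intro norm_triangle_le add_mono norm_blinfun_compose)
    also have "\<dots> \<le> (B * (?c * norm (x - y))) * ?c + A * (\<delta> * b * norm (x - y))"
    proof (intro add_mono mult_mono S'_le C11_D(3)[OF \<phi>] S'_lip)
      show "norm (\<phi>' (S x) - \<phi>' (S y)) \<le> B * (?c * norm (x - y))"
        by (rule order_trans[OF C11_D(4)[OF \<phi>]]) (intro mult_left_mono S_lip \<open>B \<ge> 0\<close>)
    qed (use A c \<open>B \<ge> 0\<close> in auto)
    also have "\<dots> = (B * ?c\<^sup>2 + A * \<delta> * b) * norm (x - y)"
      by (simp add: power2_eq_square algebra_simps)
    finally show "norm ((\<phi>' (S x) o\<^sub>L S' x) - (\<phi>' (S y) o\<^sub>L S' y)) \<le> (B * ?c\<^sup>2 + A * \<delta> * b) * norm (x - y)" .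
  qed
  then show ?thesis by (auto simp: S_def)
qed

lemma C11_approximation:
  fixes r :: real
  assumes "r > 0"
  obtains B where "B \<ge> 0"
    "\<And>(\<phi> :: 'a::euclidean_space \<Rightarrow> real) A. A \<ge> 0 \<Longrightarrow> bounded (range \<phi>) \<Longrightarrow>
      (\<And>x y. \<bar>\<phi> x - \<phi> y\<bar> \<le> A * norm (x - y)) \<Longrightarrow>
      \<exists>\<phi>1 \<phi>1'. C11 A (B * A) \<phi>1 \<phi>1' \<and> (\<forall>x. \<bar>\<phi>1 x - \<phi> x\<bar> \<le> A * r)"
proof -
  obtain B where "B \<ge> 0" and B: "\<And>(u :: 'a \<Rightarrow> real) M L.
      L \<ge> 0 \<Longrightarrow> (\<And>x. norm (u x) \<le> M) \<Longrightarrow> (\<And>x y. norm (u x - u y) \<le> L * norm (x - y)) \<Longrightarrow>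
      \<exists>v v'. (\<forall>x. (v has_derivative blinfun_apply (v' x)) (at x)) \<and> (\<forall>x. norm (v x) \<le> M) \<and>
        (\<forall>x. norm (v x - u x) \<le> L * r) \<and> (\<forall>x. norm (v' x) \<le> L) \<and>
        (\<forall>x y. norm (v' x - v' y) \<le> B * L * norm (x - y))"
    using smooth_approximation[OF assms, where 'a = 'a and 'b = real] by metis
  show thesis
  proof (rule that[OF \<open>B \<ge> 0\<close>])
    fix \<phi> :: "'a \<Rightarrow> real" and A
    assume "A \<ge> 0" "bounded (range \<phi>)" and lip: "\<And>x y. \<bar>\<phi> x - \<phi> y\<bar> \<le> A * norm (x - y)"
    then obtain b where "\<And>x. norm (\<phi> x) \<le> b" by (auto simp: bounded_iff)
    with B[of A \<phi> b] \<open>A \<ge> 0\<close> lip obtain v v' where "\<And>x. (v has_derivative blinfun_apply (v' x)) (at x)"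
      "\<And>x. norm (v x) \<le> b" "\<And>x. norm (v x - \<phi> x) \<le> A * r" "\<And>x. norm (v' x) \<le> A"
      "\<And>x y. norm (v' x - v' y) \<le> B * A * norm (x - y)"
      by auto
    then show "\<exists>\<phi>1 \<phi>1'. C11 A (B * A) \<phi>1 \<phi>1' \<and> (\<forall>x. \<bar>\<phi>1 x - \<phi> x\<bar> \<le> A * r)"
      by (intro exI[of _ v] exI[of _ v']) (auto simp: C11_def intro: boundedI[where B = b])
  qed
qed

text \<open>An arbitrary weak solution; unlike the flow above, it does not come with trajectories.\<close>

locale weak_curve = lipschitz_field G M L for G :: "'a::euclidean_space \<Rightarrow> 'a" and M L +
  fixes T :: real and \<rho>0 :: "'a measure" and \<sigma> :: "real \<Rightarrow> 'a measure"
  assumes T_pos: "T > 0" and \<rho>0: "\<rho>0 \<in> prob_measures" and weak: "weak_solution T G \<rho>0 \<sigma>"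
begin

lemma \<sigma>_prob: "t \<in> {0..<T} \<Longrightarrow> \<sigma> t \<in> prob_measures"
  using weak by (simp add: weak_solution_def C_P_narrow_def)

lemma \<sigma>_narrow:
  assumes "continuous_on UNIV \<phi>" "bounded (range \<phi>)"
  shows "continuous_on {0..<T} (\<lambda>t. \<integral>x. \<phi> x \<partial>\<sigma> t :: real)"
  using weak assms by (simp add: weak_solution_def C_P_narrow_def)

lemma \<sigma>_narrow_tendsto:
  assumes "t \<in> {0..<T}" "continuous_on UNIV \<phi>" "bounded (range \<phi>)"
  shows "((\<lambda>s. \<integral>x. \<phi> x \<partial>\<sigma> s :: real) \<longlongrightarrow> (\<integral>x. \<phi> x \<partial>\<sigma> t)) (at t within {0..<T})"
  using \<sigma>_narrow[OF assms(2,3)] assms(1) by (simp add: continuous_on_def)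

text \<open>The transporting velocity is \<open>- drift\<close>.\<close>

definition drift :: "real \<Rightarrow> 'a \<Rightarrow> 'a" where "drift t x = conv_measure G (\<sigma> t) x"

lemma drift_bound: "t \<in> {0..<T} \<Longrightarrow> norm (drift t x) \<le> M"
  unfolding drift_def by (intro conv_bound prob_measuresD(1) \<sigma>_prob)

lemma drift_lipschitz: "t \<in> {0..<T} \<Longrightarrow> norm (drift t x - drift t y) \<le> L * norm (x - y)"
  unfolding drift_def by (intro conv_lipschitz \<sigma>_prob)

lemma drift_continuous: "t \<in> {0..<T} \<Longrightarrow> continuous_on A (drift t)"
  by (rule borel_measurable_lipschitz(1)[OF drift_lipschitz])

lemma drift_tendsto:
  assumes t: "t \<in> {0..<T}"
  shows "((\<lambda>s. drift s x) \<longlongrightarrow> drift t x) (at t within {0..<T})"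
proof -
  have eq: "drift s x \<bullet> i = (\<integral>y. G (x - y) \<bullet> i \<partial>\<sigma> s)" if "s \<in> {0..<T}" for s i
  proof -
    have "integrable (\<sigma> s) (\<lambda>y. G (x - y))"
      by (rule prob_integrable_bounded[OF \<sigma>_prob[OF that] _ G_bound]) measurable
    then show ?thesis by (simp add: drift_def conv_measure_def)
  qed
  have "((\<lambda>s. drift s x \<bullet> i) \<longlongrightarrow> drift t x \<bullet> i) (at t within {0..<T})" if "i \<in> Basis" for i
  proof -
    have "\<bar>G (x - y) \<bullet> i\<bar> \<le> M" for y
      using Basis_le_norm[OF that, of "G (x - y)"] G_bound[of "x - y"] by linarith
    then have "((\<lambda>s. \<integral>y. G (x - y) \<bullet> i \<partial>\<sigma> s) \<longlongrightarrow> (\<integral>y. G (x - y) \<bullet> i \<partial>\<sigma> t)) (at t within {0..<T})"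
      by (intro \<sigma>_narrow_tendsto t) (auto intro!: continuous_intros boundedI[where B = M])
    then show ?thesis
      unfolding eq[OF t]
      by (rule Lim_transform_eventually) (auto simp: eventually_at_filter eq intro!: always_eventually)
  qed
  then show ?thesis
    by (subst tendsto_componentwise_iff) auto
qed

definition mean :: "('a \<Rightarrow> real) \<Rightarrow> real \<Rightarrow> real" where "mean \<phi> t = (\<integral>x. \<phi> x \<partial>\<sigma> t)"
definition flux :: "('a \<Rightarrow> real) \<Rightarrow> real \<Rightarrow> real" where "flux \<phi> t = (\<integral>x. grad \<phi> x \<bullet> drift t x \<partial>\<sigma> t)"

lemma flux_density_bound:
  assumes "\<phi> \<in> C1b" "s \<in> {0..<T}"
  shows "\<bar>grad \<phi> x \<bullet> drift s x\<bar> \<le> C1b_norm \<phi> * M"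
  by (rule order_trans[OF Cauchy_Schwarz_ineq2]) (intro mult_mono C1b_norm_bounds assms drift_bound norm_ge_zero)

lemma flux_density_continuous: "\<phi> \<in> C1b \<Longrightarrow> s \<in> {0..<T} \<Longrightarrow> continuous_on A (\<lambda>x. grad \<phi> x \<bullet> drift s x)"
  by (intro continuous_on_inner C1b_continuous drift_continuous)

lemma flux_density_integrable:
  assumes "\<phi> \<in> C1b" "s \<in> {0..<T}" "t \<in> {0..<T}"
  shows "integrable (\<sigma> t) (\<lambda>x. grad \<phi> x \<bullet> drift s x)"
  using flux_density_bound[OF assms(1,2)]
  by (intro prob_integrable_bounded[OF \<sigma>_prob[OF assms(3)]] borel_measurable_continuous_onI flux_density_continuous assms) auto

text \<open>Both the measure and the integrand depend on time. The change of the integrand is handled by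
  \<open>narrow_integral_tendsto\<close>, the change of the measure by narrow continuity.\<close>

lemma flux_continuous:
  assumes \<phi>: "\<phi> \<in> C1b"
  shows "continuous_on {0..<T} (flux \<phi>)"
  unfolding continuous_on_def
proof
  fix t assume t: "t \<in> {0..<T}"
  let ?F = "at t within {0..<T}"
  have ev: "\<forall>\<^sub>F s in ?F. s \<in> {0..<T}"
    by (auto simp: eventually_at_filter intro!: always_eventually)
  have d: "((\<lambda>s. \<integral>x. norm (drift s x - drift t x) \<partial>\<sigma> s) \<longlongrightarrow> 0) ?F"
  proof (rule narrow_integral_tendsto[where \<nu> = "\<sigma> t" and K = "2 * L + 2 * M"])
    show "\<forall>\<^sub>F s in ?F. \<sigma> s \<in> prob_measures"
      using ev by eventually_elim (rule \<sigma>_prob)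
    show "((\<lambda>s. norm (drift s x - drift t x)) \<longlongrightarrow> 0) ?F" for x
      using drift_tendsto[OF t] by (intro tendsto_norm_zero LIM_zero)
    show "\<forall>\<^sub>F s in ?F. \<forall>x y. \<bar>norm (drift s x - drift t x) - norm (drift s y - drift t y)\<bar> \<le> (2 * L + 2 * M) * norm (x - y)"
      using ev
    proof (eventually_elim, intro allI)
      fix s x y assume s: "s \<in> {0..<T}"
      have "\<bar>norm (drift s x - drift t x) - norm (drift s y - drift t y)\<bar> \<le> norm ((drift s x - drift s y) - (drift t x - drift t y))"
        using norm_triangle_ineq3[of "drift s x - drift t x" "drift s y - drift t y"] by (simp add: algebra_simps)
      also have "\<dots> \<le> L * norm (x - y) + L * norm (x - y)"
        by (rule order_trans[OF norm_triangle_ineq4]) (intro add_mono drift_lipschitz s t)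
      also have "\<dots> = (2 * L) * norm (x - y)" by simp
      also have "\<dots> \<le> (2 * L + 2 * M) * norm (x - y)"
        using M_ge_1 by (intro mult_right_mono) auto
      finally show "\<bar>norm (drift s x - drift t x) - norm (drift s y - drift t y)\<bar> \<le> (2 * L + 2 * M) * norm (x - y)" .
    qed
    show "\<forall>\<^sub>F s in ?F. \<forall>x. 0 \<le> norm (drift s x - drift t x) \<and> norm (drift s x - drift t x) \<le> 2 * L + 2 * M"
      using ev
    proof (eventually_elim, intro allI conjI)
      fix s x assume s: "s \<in> {0..<T}"
      show "norm (drift s x - drift t x) \<le> 2 * L + 2 * M"
        using norm_triangle_ineq4[of "drift s x" "drift t x"] drift_bound[OF s, of x] drift_bound[OF t, of x] L_ge_1 by linarith
    qed simp
    show "2 * L + 2 * M > 0" using M_ge_1 L_ge_1 by linarith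
  qed (intro \<sigma>_prob \<sigma>_narrow_tendsto t; assumption)+
  have "((\<lambda>s. flux \<phi> s - (\<integral>x. grad \<phi> x \<bullet> drift t x \<partial>\<sigma> s)) \<longlongrightarrow> 0) ?F"
  proof (rule Lim_null_comparison)
    show "((\<lambda>s. C1b_norm \<phi> * (\<integral>x. norm (drift s x - drift t x) \<partial>\<sigma> s)) \<longlongrightarrow> 0) ?F"
      using tendsto_mult_right_zero[OF d] .
    show "\<forall>\<^sub>F s in ?F. norm (flux \<phi> s - (\<integral>x. grad \<phi> x \<bullet> drift t x \<partial>\<sigma> s)) \<le> C1b_norm \<phi> * (\<integral>x. norm (drift s x - drift t x) \<partial>\<sigma> s)"
      using ev
    proof eventually_elim
      fix s assume s: "s \<in> {0..<T}"
      have "norm (flux \<phi> s - (\<integral>x. grad \<phi> x \<bullet> drift t x \<partial>\<sigma> s)) \<le> (\<integral>x. C1b_norm \<phi> * norm (drift s x - drift t x) \<partial>\<sigma> s)"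
        unfolding flux_def
      proof (rule norm_integral_diff_le)
        have "norm (norm (drift s x - drift t x)) \<le> M + M" for x
          using norm_triangle_ineq4[of "drift s x" "drift t x"] drift_bound[OF s, of x] drift_bound[OF t, of x] by simp
        then show "integrable (\<sigma> s) (\<lambda>x. C1b_norm \<phi> * norm (drift s x - drift t x))"
          by (intro integrable_mult_right prob_integrable_bounded[OF \<sigma>_prob[OF s]] borel_measurable_continuous_onI
              continuous_intros drift_continuous s t)
        show "norm (grad \<phi> x \<bullet> drift s x - grad \<phi> x \<bullet> drift t x) \<le> C1b_norm \<phi> * norm (drift s x - drift t x)" for x
          unfolding inner_diff_right[symmetric] real_norm_def
          by (rule order_trans[OF Cauchy_Schwarz_ineq2]) (intro mult_right_mono C1b_norm_bounds \<phi> norm_ge_zero)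
      qed (intro flux_density_integrable \<phi> s t)+
      then show "norm (flux \<phi> s - (\<integral>x. grad \<phi> x \<bullet> drift t x \<partial>\<sigma> s)) \<le> C1b_norm \<phi> * (\<integral>x. norm (drift s x - drift t x) \<partial>\<sigma> s)"
        by simp
    qed
  qed
  moreover have "((\<lambda>s. \<integral>x. grad \<phi> x \<bullet> drift t x \<partial>\<sigma> s) \<longlongrightarrow> flux \<phi> t) ?F"
    unfolding flux_def using flux_density_bound[OF \<phi> t]
    by (intro \<sigma>_narrow_tendsto t flux_density_continuous \<phi>) (auto intro!: boundedI)
  ultimately have "((\<lambda>s. (flux \<phi> s - (\<integral>x. grad \<phi> x \<bullet> drift t x \<partial>\<sigma> s)) + (\<integral>x. grad \<phi> x \<bullet> drift t x \<partial>\<sigma> s)) \<longlongrightarrow> 0 + flux \<phi> t) ?F"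
    by (rule tendsto_add)
  then show "(flux \<phi> \<longlongrightarrow> flux \<phi> t) ?F" by simp
qed

lemma mean_continuous: "\<phi> \<in> C1b \<Longrightarrow> continuous_on {0..<T} (mean \<phi>)"
  unfolding mean_def using \<sigma>_narrow[of \<phi>] C1b_continuous(1)[of \<phi> UNIV] by (simp add: C1b_def)

text \<open>Test functions of the form \<open>\<eta>(t) \<phi>(x)\<close> reduce the equation to one in time alone.\<close>

lemma mean_eq:
  assumes \<phi>: "\<phi> \<in> C1b" and t: "t \<in> {0..<T}"
  shows "mean \<phi> t = (\<integral>x. \<phi> x \<partial>\<rho>0) - integral {0..t} (flux \<phi>)"
proof (rule dubois_reymond[OF mean_continuous[OF \<phi>] flux_continuous[OF \<phi>] _ t])
  fix \<eta> \<eta>' :: "real \<Rightarrow> real" and S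
  assume S: "0 < S" "S < T" and \<eta>: "\<And>t. t \<in> {0..<T} \<Longrightarrow> (\<eta> has_real_derivative \<eta>' t) (at t within {0..<T})"
    and \<eta>': "continuous_on {0..<T} \<eta>'" and van: "\<And>t. t \<in> {0..<T} \<Longrightarrow> S < t \<Longrightarrow> \<eta> t = 0 \<and> \<eta>' t = 0"
  have \<eta>c: "continuous_on {0..<T} \<eta>"
    using \<eta> by (intro DERIV_continuous_on) auto
  have sub: "{0..S} \<subseteq> {0..<T}" using S by auto
  have "C1c_C1b T (\<lambda>t x. \<eta> t * \<phi> x) (\<lambda>t x. \<eta>' t * \<phi> x)"
    using van by (intro C1c_C1b_separated[OF \<phi> \<eta> \<eta>' S(2)]) auto
  then have W: "(LINT t:{0..<T}|lborel. (\<integral>x. \<eta>' t * \<phi> x \<partial>\<sigma> t))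
      - (LINT t:{0..<T}|lborel. (\<integral>x. grad (\<lambda>x. \<eta> t * \<phi> x) x \<bullet> conv_measure G (\<sigma> t) x \<partial>\<sigma> t))
      + (\<integral>x. \<eta> 0 * \<phi> x \<partial>\<rho>0) = 0"
    using weak unfolding weak_solution_def by blast
  have e1: "(\<integral>x. \<eta>' t * \<phi> x \<partial>\<sigma> t) = \<eta>' t * mean \<phi> t" for t
    by (simp add: mean_def)
  have e2: "(\<integral>x. grad (\<lambda>x. \<eta> t * \<phi> x) x \<bullet> conv_measure G (\<sigma> t) x \<partial>\<sigma> t) = \<eta> t * flux \<phi> t" for t
    by (simp add: flux_def drift_def C1b_scale(2)[OF \<phi>])
  have "(LINT t:{0..<T}|lborel. \<eta>' t * mean \<phi> t) - (LINT t:{0..<T}|lborel. \<eta> t * flux \<phi> t) + \<eta> 0 * (\<integral>x. \<phi> x \<partial>\<rho>0) = 0"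
    using W unfolding e1 e2 by simp
  moreover have "(LINT t:{0..<T}|lborel. \<eta>' t * mean \<phi> t) = integral {0..S} (\<lambda>t. \<eta>' t * mean \<phi> t)"
    using S van by (intro set_integral_eq_integral_support continuous_on_mult continuous_on_subset[OF \<eta>' sub]
        continuous_on_subset[OF mean_continuous[OF \<phi>] sub]) auto
  moreover have "(LINT t:{0..<T}|lborel. \<eta> t * flux \<phi> t) = integral {0..S} (\<lambda>t. \<eta> t * flux \<phi> t)"
    using S van by (intro set_integral_eq_integral_support continuous_on_mult continuous_on_subset[OF \<eta>c sub]
        continuous_on_subset[OF flux_continuous[OF \<phi>] sub]) auto
  ultimately show "integral {0..S} (\<lambda>t. \<eta>' t * mean \<phi> t) - integral {0..S} (\<lambda>t. \<eta> t * flux \<phi> t) + \<eta> 0 * (\<integral>x. \<phi> x \<partial>\<rho>0) = 0"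
    by simp
qed

lemma mean_derivative:
  assumes \<phi>: "\<phi> \<in> C1b" and t: "t \<in> {0..<T}"
  shows "(mean \<phi> has_vector_derivative - flux \<phi> t) (at t within {0..<T})"
proof -
  have "((\<lambda>s. (\<integral>x. \<phi> x \<partial>\<rho>0) - integral {0..s} (flux \<phi>)) has_vector_derivative - flux \<phi> t) (at t within {0..<T})"
    unfolding has_real_derivative_iff_has_vector_derivative[symmetric]
    using primitive_has_derivative[OF flux_continuous[OF \<phi>] t] by (auto intro!: derivative_eq_intros)
  then show ?thesis
    by (intro has_vector_derivative_transform[OF t mean_eq[OF \<phi>]])
qed

lemma bounded_lipschitz_integrable:
  fixes \<phi> :: "'a \<Rightarrow> real"
  assumes "bounded (range \<phi>)" "\<And>x y. \<bar>\<phi> x - \<phi> y\<bar> \<le> A * norm (x - y)" "\<mu> \<in> prob_measures"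
  shows "integrable \<mu> \<phi>"
proof -
  obtain b where "\<And>x. norm (\<phi> x) \<le> b" using assms(1) by (auto simp: bounded_iff)
  then show ?thesis
    using assms by (intro prob_integrable_bounded[where B = b] borel_measurable_lipschitz(2)[where L = A]) auto
qed

lemma integral_close:
  fixes \<phi> \<phi>1 :: "'a \<Rightarrow> real"
  assumes "bounded (range \<phi>)" "\<And>x y. \<bar>\<phi> x - \<phi> y\<bar> \<le> A * norm (x - y)"
    and "C11 A B \<phi>1 \<phi>1'" "\<And>x. \<bar>\<phi>1 x - \<phi> x\<bar> \<le> r" and \<mu>: "\<mu> \<in> prob_measures"
  shows "\<bar>(\<integral>x. \<phi>1 x \<partial>\<mu>) - (\<integral>x. \<phi> x \<partial>\<mu>)\<bar> \<le> r"
proof -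
  interpret prob_space \<mu> using \<mu> by (rule prob_measuresD)
  have "norm ((\<integral>x. \<phi>1 x \<partial>\<mu>) - (\<integral>x. \<phi> x \<partial>\<mu>)) \<le> (\<integral>x. r \<partial>\<mu>)"
    using assms(4)
    by (intro norm_integral_diff_le bounded_lipschitz_integrable[OF assms(1,2) \<mu>]
        bounded_lipschitz_integrable[OF C11_D(1)[OF assms(3)] C11_lipschitz[OF assms(3)] \<mu>]) auto
  then show ?thesis by (simp add: prob_space)
qed

text \<open>The test function need not be smooth, because mollification does not increase its Lipschitz constant.
  This is applied to kernels \<open>G (x - y)\<close>, whose regularity is no better.\<close>

lemma lipschitz_in_time:
  fixes \<phi> :: "'a \<Rightarrow> real"
  assumes "A \<ge> 0" and \<phi>: "bounded (range \<phi>)" "\<And>x y. \<bar>\<phi> x - \<phi> y\<bar> \<le> A * norm (x - y)"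
    and s: "s \<in> {0..<T}" and t: "t \<in> {0..<T}"
  shows "\<bar>(\<integral>x. \<phi> x \<partial>\<sigma> t) - (\<integral>x. \<phi> x \<partial>\<sigma> s)\<bar> \<le> A * (M * \<bar>t - s\<bar>)"
proof -
  have smooth: "\<bar>mean \<phi>1 b - mean \<phi>1 a\<bar> \<le> A * M * b - A * M * a"
    if \<phi>1: "C11 A B \<phi>1 \<phi>1'" and ab: "a \<in> {0..<T}" "b \<in> {0..<T}" "a \<le> b" for B \<phi>1 \<phi>1' a b
  proof -
    have "norm (mean \<phi>1 b - mean \<phi>1 a) \<le> A * M * b - A * M * a"
    proof (rule norm_diff_le_of_derivative_le[where a = 0 and b = b])
      fix r assume "r \<in> {0..b}"
      then have r: "r \<in> {0..<T}" using ab by auto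
      show "(mean \<phi>1 has_vector_derivative - flux \<phi>1 r) (at r within {0..b})"
        using ab by (intro has_vector_derivative_within_subset[OF mean_derivative[OF C11_C1b[OF \<phi>1] r]]) auto
      show "((\<lambda>x. A * M * x) has_vector_derivative A * M) (at r within {0..b})"
        unfolding has_real_derivative_iff_has_vector_derivative[symmetric] by (auto intro!: derivative_eq_intros)
      have "\<bar>grad \<phi>1 x \<bullet> drift r x\<bar> \<le> A * M" for x
        by (rule order_trans[OF Cauchy_Schwarz_ineq2])
           (intro mult_mono C11_grad(2)[OF \<phi>1] drift_bound r \<open>A \<ge> 0\<close> norm_ge_zero)
      then show "norm (- flux \<phi>1 r) \<le> A * M"
        using norm_prob_integral_le[OF prob_measuresD(1)[OF \<sigma>_prob[OF r]], of "\<lambda>x. grad \<phi>1 x \<bullet> drift r x" "A * M"]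
        by (simp add: flux_def)
    qed (use ab in auto)
    then show ?thesis by simp
  qed
  have "\<bar>(\<integral>x. \<phi> x \<partial>\<sigma> t) - (\<integral>x. \<phi> x \<partial>\<sigma> s)\<bar> \<le> A * (M * \<bar>t - s\<bar>) + e" if "e > 0" for e
  proof -
    define r where "r = e / (2 * (A + 1))"
    have "r > 0" using \<open>e > 0\<close> \<open>A \<ge> 0\<close> by (simp add: r_def)
    obtain B \<phi>1 \<phi>1' where \<phi>1: "C11 A B \<phi>1 \<phi>1'" and close: "\<And>x. \<bar>\<phi>1 x - \<phi> x\<bar> \<le> A * r"
      using C11_approximation[OF \<open>r > 0\<close>] \<open>A \<ge> 0\<close> \<phi> by metis
    have "\<bar>mean \<phi>1 t - mean \<phi>1 s\<bar> \<le> A * (M * \<bar>t - s\<bar>)"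
      using smooth[OF \<phi>1 s t] smooth[OF \<phi>1 t s] by (cases "s \<le> t") (auto simp: algebra_simps abs_minus_commute)
    moreover have hc: "\<bar>mean \<phi>1 a - (\<integral>x. \<phi> x \<partial>\<sigma> a)\<bar> \<le> A * r" if "a \<in> {0..<T}" for a
      unfolding mean_def by (rule integral_close[OF \<phi> \<phi>1 close \<sigma>_prob[OF that]])
    moreover have "2 * (A * r) \<le> e"
      using \<open>A \<ge> 0\<close> \<open>e > 0\<close> by (simp add: r_def field_simps)
    ultimately show ?thesis
      using hc[OF s] hc[OF t] by linarith
  qed
  then show ?thesis by (rule field_le_epsilon)
qed

lemma initial_mean:
  fixes \<phi> :: "'a \<Rightarrow> real"
  assumes \<phi>: "bounded (range \<phi>)" "\<And>x y. \<bar>\<phi> x - \<phi> y\<bar> \<le> norm (x - y)"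
  shows "(\<integral>x. \<phi> x \<partial>\<sigma> 0) = (\<integral>x. \<phi> x \<partial>\<rho>0)"
proof -
  have 0: "0 \<in> {0..<T}" using T_pos by simp
  have "\<bar>(\<integral>x. \<phi> x \<partial>\<sigma> 0) - (\<integral>x. \<phi> x \<partial>\<rho>0)\<bar> \<le> 0 + e" if "e > 0" for e
  proof -
    have "e / 2 > 0" using that by simp
    have \<phi>': "\<And>x y. \<bar>\<phi> x - \<phi> y\<bar> \<le> 1 * norm (x - y)" using \<phi>(2) by simp
    obtain B \<phi>1 \<phi>1' where \<phi>1: "C11 1 B \<phi>1 \<phi>1'" and close: "\<And>x. \<bar>\<phi>1 x - \<phi> x\<bar> \<le> 1 * (e / 2)"
      using C11_approximation[OF \<open>e / 2 > 0\<close>] zero_le_one \<phi>(1) \<phi>' by metis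
    have "(\<integral>x. \<phi>1 x \<partial>\<sigma> 0) = (\<integral>x. \<phi>1 x \<partial>\<rho>0)"
      using mean_eq[OF C11_C1b[OF \<phi>1] 0] by (simp add: mean_def)
    then show ?thesis
      using integral_close[OF \<phi>(1) \<phi>' \<phi>1 close \<sigma>_prob[OF 0]] integral_close[OF \<phi>(1) \<phi>' \<phi>1 close \<rho>0]
      by linarith
  qed
  then have "\<bar>(\<integral>x. \<phi> x \<partial>\<sigma> 0) - (\<integral>x. \<phi> x \<partial>\<rho>0)\<bar> \<le> 0"
    by (rule field_le_epsilon)
  then show ?thesis by simp
qed

lemma drift_lipschitz_in_time:
  assumes "s \<in> {0..<T}" "t \<in> {0..<T}"
  shows "norm (drift s x - drift t x) \<le> L * (M * \<bar>s - t\<bar>)"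
  unfolding drift_def
  by (rule conv_diff_le_dual[OF lipschitz_field_axioms \<sigma>_prob[OF assms(1)] \<sigma>_prob[OF assms(2)]])
     (use lipschitz_in_time[OF zero_le_one _ _ assms(2,1)] in simp)

text \<open>The integrand of the flux is Lipschitz in space, and moves with bounded speed in time; hence
  \<open>lipschitz_in_time\<close> applies to it.\<close>

lemma flux_lipschitz:
  assumes \<phi>: "C11 A B \<phi> \<phi>'" and "B \<ge> 0" and s: "s \<in> {0..<T}" and t: "t \<in> {0..<T}"
  shows "\<bar>flux \<phi> s - flux \<phi> t\<bar> \<le> (A * L * M + (B * M + A * L) * M) * \<bar>s - t\<bar>"
proof -
  have A: "A \<ge> 0" using C11_D(5)[OF \<phi>] .
  note C = C11_C1b[OF \<phi>]
  define w where "w x = grad \<phi> x \<bullet> drift t x" for x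
  interpret s: prob_space "\<sigma> s" by (rule prob_measuresD(1)[OF \<sigma>_prob[OF s]])
  have "norm (flux \<phi> s - (\<integral>x. w x \<partial>\<sigma> s)) \<le> (\<integral>x. A * (L * (M * \<bar>s - t\<bar>)) \<partial>\<sigma> s)"
    unfolding flux_def w_def
  proof (rule norm_integral_diff_le)
    show "norm (grad \<phi> x \<bullet> drift s x - grad \<phi> x \<bullet> drift t x) \<le> A * (L * (M * \<bar>s - t\<bar>))" for x
      unfolding inner_diff_right[symmetric] real_norm_def
      by (rule order_trans[OF Cauchy_Schwarz_ineq2])
         (intro mult_mono C11_grad(2)[OF \<phi>] drift_lipschitz_in_time s t A norm_ge_zero)
  qed (auto intro: flux_density_integrable[OF C] s t)
  moreover have "\<bar>(\<integral>x. w x \<partial>\<sigma> s) - (\<integral>x. w x \<partial>\<sigma> t)\<bar> \<le> (B * M + A * L) * (M * \<bar>s - t\<bar>)"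
  proof (rule lipschitz_in_time[OF _ _ _ t s])
    show "B * M + A * L \<ge> 0" using A \<open>B \<ge> 0\<close> M_ge_1 L_ge_1 by simp
    show "bounded (range w)"
      using flux_density_bound[OF C t] by (auto simp: w_def intro!: boundedI)
    fix x y
    have "w x - w y = (grad \<phi> x - grad \<phi> y) \<bullet> drift t x + grad \<phi> y \<bullet> (drift t x - drift t y)"
      by (simp add: w_def inner_diff_left inner_diff_right)
    also have "\<bar>\<dots>\<bar> \<le> norm (grad \<phi> x - grad \<phi> y) * norm (drift t x) + norm (grad \<phi> y) * norm (drift t x - drift t y)"
      by (intro order_trans[OF abs_triangle_ineq] add_mono Cauchy_Schwarz_ineq2)
    also have "\<dots> \<le> (B * norm (x - y)) * M + A * (L * norm (x - y))"
      using \<open>B \<ge> 0\<close> A by (intro add_mono mult_mono C11_grad(2,3)[OF \<phi>] drift_bound drift_lipschitz t) auto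
    finally show "\<bar>w x - w y\<bar> \<le> (B * M + A * L) * norm (x - y)"
      by (simp add: algebra_simps)
  qed
  ultimately show ?thesis
    by (simp add: s.prob_space flux_def[of _ t] w_def[symmetric] algebra_simps)
qed

text \<open>The solution at time \<open>t + \<delta>\<close> against the push-forward of the solution at time \<open>t\<close> by \<open>x + \<delta> V(x)\<close>. Both sides
  are expanded to first order in \<open>\<delta>\<close>. The first-order terms differ by the velocity error \<open>\<eta>\<close>; the
  remainders are controlled by the Lipschitz constants of the flux and of the gradient of \<open>\<phi>\<close>.\<close>

lemma euler_step:
  assumes \<phi>: "C11 A B \<phi> \<phi>'" and "B \<ge> 0" and "\<delta> \<ge> 0" and t: "t \<in> {0..<T}" and t\<delta>: "t + \<delta> \<in> {0..<T}"
    and V: "continuous_on UNIV V" "\<And>x. norm (V x) \<le> M" "\<And>x. norm (V x + drift t x) \<le> \<eta>"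
  shows "\<bar>(\<integral>x. \<phi> x \<partial>\<sigma> (t + \<delta>)) - (\<integral>x. \<phi> (x + \<delta> *\<^sub>R V x) \<partial>\<sigma> t)\<bar>
      \<le> \<delta> * (A * \<eta>) + (A * L * M + (B * M + A * L) * M + B * M\<^sup>2) * \<delta>\<^sup>2"
proof -
  have A: "A \<ge> 0" using C11_D(5)[OF \<phi>] .
  note C = C11_C1b[OF \<phi>]
  interpret t: prob_space "\<sigma> t" by (rule prob_measuresD(1)[OF \<sigma>_prob[OF t]])
  let ?K = "A * L * M + (B * M + A * L) * M"
  have K: "?K \<ge> 0" using A \<open>B \<ge> 0\<close> M_ge_1 L_ge_1 by simp
  have 1: "\<bar>mean \<phi> (t + \<delta>) - mean \<phi> t + \<delta> * flux \<phi> t\<bar> \<le> ?K * \<delta>\<^sup>2"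
  proof -
    \<comment> \<open>the mean minus its linearisation at \<open>t\<close>, up to a constant\<close>
    define f where "f s = mean \<phi> s + s * flux \<phi> t" for s
    have "norm (f (t + \<delta>) - f t) \<le> ?K * \<delta> * (t + \<delta>) - ?K * \<delta> * t"
    proof (rule norm_diff_le_of_derivative_le[where a = t and b = "t + \<delta>"])
      fix r assume r: "r \<in> {t..t + \<delta>}"
      then have rT: "r \<in> {0..<T}" using t t\<delta> by auto
      have "(mean \<phi> has_vector_derivative - flux \<phi> r) (at r within {t..t + \<delta>})"
        using t t\<delta> by (intro has_vector_derivative_within_subset[OF mean_derivative[OF C rT]]) auto
      then show "(f has_vector_derivative - flux \<phi> r + flux \<phi> t) (at r within {t..t + \<delta>})"
        unfolding f_def has_real_derivative_iff_has_vector_derivative[symmetric]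
        by (auto intro!: derivative_eq_intros)
      show "((\<lambda>x. ?K * \<delta> * x) has_vector_derivative ?K * \<delta>) (at r within {t..t + \<delta>})"
        unfolding has_real_derivative_iff_has_vector_derivative[symmetric] by (auto intro!: derivative_eq_intros)
      have "\<bar>flux \<phi> r - flux \<phi> t\<bar> \<le> ?K * \<bar>r - t\<bar>"
        by (rule flux_lipschitz[OF \<phi> \<open>B \<ge> 0\<close> rT t])
      also have "\<dots> \<le> ?K * \<delta>"
        using r K by (intro mult_left_mono) auto
      finally show "norm (- flux \<phi> r + flux \<phi> t) \<le> ?K * \<delta>"
        by simp
    qed (use \<open>\<delta> \<ge> 0\<close> in auto)
    then show ?thesis by (simp add: f_def algebra_simps power2_eq_square)
  qed
  have \<phi>c: "continuous_on UNIV \<phi>" by (rule C1b_continuous[OF C])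
  obtain b where b: "\<And>x. norm (\<phi> x) \<le> b" using C11_D(1)[OF \<phi>] by (auto simp: bounded_iff)
  have int\<phi>: "integrable (\<sigma> t) \<phi>"
    by (intro prob_integrable_bounded[OF \<sigma>_prob[OF t] _ b] borel_measurable_continuous_onI \<phi>c)
  have intS: "integrable (\<sigma> t) (\<lambda>x. \<phi> (x + \<delta> *\<^sub>R V x))"
    by (intro prob_integrable_bounded[OF \<sigma>_prob[OF t] _ b] borel_measurable_continuous_onI
        continuous_on_compose2[OF \<phi>c] continuous_intros V(1)) auto
  have gradV: "\<bar>grad \<phi> x \<bullet> V x\<bar> \<le> A * M" for x
    by (rule order_trans[OF Cauchy_Schwarz_ineq2]) (intro mult_mono C11_grad(2)[OF \<phi>] V A norm_ge_zero)
  have intV: "integrable (\<sigma> t) (\<lambda>x. grad \<phi> x \<bullet> V x)"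
    using gradV by (intro prob_integrable_bounded[OF \<sigma>_prob[OF t], where B = "A * M"] borel_measurable_continuous_onI
        continuous_on_inner C1b_continuous C V(1)) auto
  have 2: "\<bar>(\<integral>x. \<phi> (x + \<delta> *\<^sub>R V x) \<partial>\<sigma> t) - (\<integral>x. \<phi> x + \<delta> * (grad \<phi> x \<bullet> V x) \<partial>\<sigma> t)\<bar> \<le> B * M\<^sup>2 * \<delta>\<^sup>2"
  proof -
    have "norm ((\<integral>x. \<phi> (x + \<delta> *\<^sub>R V x) \<partial>\<sigma> t) - (\<integral>x. \<phi> x + \<delta> * (grad \<phi> x \<bullet> V x) \<partial>\<sigma> t)) \<le> (\<integral>x. B * M\<^sup>2 * \<delta>\<^sup>2 \<partial>\<sigma> t)"
    proof (rule norm_integral_diff_le)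
      fix x
      have "\<bar>\<phi> (x + \<delta> *\<^sub>R V x) - \<phi> x - blinfun_apply (\<phi>' x) (\<delta> *\<^sub>R V x)\<bar> \<le> B * (norm (\<delta> *\<^sub>R V x))\<^sup>2"
        by (rule taylor_lipschitz_derivative[OF C11_D(2)[OF \<phi>] C11_D(4)[OF \<phi>]])
      also have "\<dots> \<le> B * (\<delta> * M)\<^sup>2"
        using \<open>\<delta> \<ge> 0\<close> \<open>B \<ge> 0\<close> V(2) by (intro mult_left_mono power_mono) (auto intro: mult_left_mono)
      finally show "norm (\<phi> (x + \<delta> *\<^sub>R V x) - (\<phi> x + \<delta> * (grad \<phi> x \<bullet> V x))) \<le> B * M\<^sup>2 * \<delta>\<^sup>2"
        by (simp add: C11_grad(1)[OF \<phi>] blinfun.scaleR_right algebra_simps power_mult_distrib)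
    qed (use intS int\<phi> intV in auto)
    then show ?thesis by (simp add: t.prob_space)
  qed
  have 3: "\<bar>(\<integral>x. grad \<phi> x \<bullet> V x \<partial>\<sigma> t) + flux \<phi> t\<bar> \<le> A * \<eta>"
  proof -
    have "(\<integral>x. grad \<phi> x \<bullet> V x \<partial>\<sigma> t) + flux \<phi> t = (\<integral>x. grad \<phi> x \<bullet> (V x + drift t x) \<partial>\<sigma> t)"
      using intV flux_density_integrable[OF C t t] by (simp add: flux_def inner_add_right)
    also have "norm \<dots> \<le> A * \<eta>"
    proof (rule norm_prob_integral_le[OF t.prob_space_axioms])
      show "norm (grad \<phi> x \<bullet> (V x + drift t x)) \<le> A * \<eta>" for x
        unfolding real_norm_def
        by (rule order_trans[OF Cauchy_Schwarz_ineq2]) (intro mult_mono C11_grad(2)[OF \<phi>] V A norm_ge_zero)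
    qed
    finally show ?thesis by simp
  qed
  have eq: "(\<integral>x. \<phi> x + \<delta> * (grad \<phi> x \<bullet> V x) \<partial>\<sigma> t) = mean \<phi> t + \<delta> * (\<integral>x. grad \<phi> x \<bullet> V x \<partial>\<sigma> t)"
    using int\<phi> intV by (simp add: mean_def)
  have "\<bar>\<delta> * ((\<integral>x. grad \<phi> x \<bullet> V x \<partial>\<sigma> t) + flux \<phi> t)\<bar> \<le> \<delta> * (A * \<eta>)"
    using 3 \<open>\<delta> \<ge> 0\<close> by (simp add: abs_mult mult_left_mono)
  then show ?thesis
    using 1 2 unfolding eq by (simp add: mean_def algebra_simps abs_le_iff)
qed

end

section \<open>Uniqueness of weak solutions\<close>

locale two_weak_curves = s1: weak_curve G M L T \<rho>0 \<sigma>1 + s2: weak_curve G M L T \<rho>0 \<sigma>2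
  for G :: "'a::euclidean_space \<Rightarrow> 'a" and M L T \<rho>0 \<sigma>1 \<sigma>2
begin

definition Q :: "('a \<Rightarrow> real) \<Rightarrow> real \<Rightarrow> real" where
  "Q \<phi> t = \<bar>(\<integral>x. \<phi> x \<partial>\<sigma>1 t) - (\<integral>x. \<phi> x \<partial>\<sigma>2 t)\<bar>"

text \<open>The constant of the quadratic error in \<open>euler_step\<close>.\<close>

definition K :: "real \<Rightarrow> real \<Rightarrow> real" where
  "K A B = A * L * M + (B * M + A * L) * M + B * M\<^sup>2"

lemma K_mono: "A \<le> A' \<Longrightarrow> B \<le> B' \<Longrightarrow> K A B \<le> K A' B'"
  unfolding K_def using s1.M_ge_1 s1.L_ge_1 by (intro add_mono mult_right_mono) auto

text \<open>Both solutions are compared with the same Euler step, whose velocity approximates that of the first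
  solution; for the second one the distance \<open>d\<close> of the two solutions enters.\<close>

lemma one_step:
  assumes \<phi>: "C11 A B \<phi> \<phi>'" and "B \<ge> 0" "\<delta> \<ge> 0" "b \<ge> 0" and t: "t \<in> {0..<T}" and t\<delta>: "t + \<delta> \<in> {0..<T}"
    and V: "\<And>x. (V has_derivative blinfun_apply (V' x)) (at x)" "\<And>x. norm (V x) \<le> M"
      "\<And>x. norm (V x + s1.drift t x) \<le> L * r" "\<And>x. norm (V' x) \<le> L" "\<And>x y. norm (V' x - V' y) \<le> b * norm (x - y)"
    and d: "\<And>\<phi>. bounded (range \<phi>) \<Longrightarrow> (\<And>x y. \<bar>\<phi> x - \<phi> y\<bar> \<le> norm (x - y)) \<Longrightarrow> Q \<phi> t \<le> d"
  obtains \<phi>2 \<phi>2' where "C11 (A * (1 + \<delta> * L)) (B * (1 + \<delta> * L)\<^sup>2 + A * \<delta> * b) \<phi>2 \<phi>2'"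
    "Q \<phi> (t + \<delta>) \<le> Q \<phi>2 t + \<delta> * (A * (2 * L * r + L * d)) + 2 * K A B * \<delta>\<^sup>2"
proof -
  have "L \<ge> 0" using s1.L_ge_1 by simp
  have Vc: "continuous_on UNIV V"
    by (rule has_derivative_continuous_on) (rule V(1))
  have c12: "norm (s1.drift t x - s2.drift t x) \<le> L * d" for x
    unfolding s1.drift_def s2.drift_def
    by (rule conv_diff_le_dual[OF s1.lipschitz_field_axioms s1.\<sigma>_prob[OF t] s2.\<sigma>_prob[OF t]])
       (use d in \<open>simp add: Q_def\<close>)
  have V2: "norm (V x + s2.drift t x) \<le> L * r + L * d" for x
    using norm_triangle_ineq4[of "V x + s1.drift t x" "s1.drift t x - s2.drift t x"] V(3)[of x] c12[of x] by simp
  obtain \<phi>2' where \<phi>2: "C11 (A * (1 + \<delta> * L)) (B * (1 + \<delta> * L)\<^sup>2 + A * \<delta> * b) (\<lambda>x. \<phi> (x + \<delta> *\<^sub>R V x)) \<phi>2'"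
    using C11_compose_euler_step[OF \<phi> \<open>\<delta> \<ge> 0\<close> \<open>B \<ge> 0\<close> \<open>L \<ge> 0\<close> \<open>b \<ge> 0\<close> V(1,4,5)] by blast
  show thesis
  proof (rule that[OF \<phi>2])
    show "Q \<phi> (t + \<delta>) \<le> Q (\<lambda>x. \<phi> (x + \<delta> *\<^sub>R V x)) t + \<delta> * (A * (2 * L * r + L * d)) + 2 * K A B * \<delta>\<^sup>2"
    proof -
      have "\<delta> * (A * (2 * L * r + L * d)) = \<delta> * (A * (L * r)) + \<delta> * (A * (L * r + L * d))"
        by (simp add: algebra_simps)
      then show ?thesis
        using s1.euler_step[OF \<phi> \<open>B \<ge> 0\<close> \<open>\<delta> \<ge> 0\<close> t t\<delta> Vc V(2) V(3)]
          s2.euler_step[OF \<phi> \<open>B \<ge> 0\<close> \<open>\<delta> \<ge> 0\<close> t t\<delta> Vc V(2) V2]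
        unfolding Q_def K_def[symmetric] by linarith
    qed
  qed
qed

lemma Q_0:
  assumes "C11 A B \<phi> \<phi>'"
  shows "Q \<phi> 0 = 0"
  using s1.mean_eq[OF C11_C1b[OF assms], of 0] s2.mean_eq[OF C11_C1b[OF assms], of 0] s1.T_pos
  by (simp add: Q_def s1.mean_def s2.mean_def)

text \<open>A bound, up to time \<open>T\<close>, on the Lipschitz constants of all transported test functions that start with constant \<open>1\<close>.\<close>

definition A0 :: real where "A0 = exp (L * T)"

text \<open>Steps of length \<open>\<delta> = \<tau> / N\<close> are followed from \<open>\<tau>\<close> back to \<open>0\<close>, where the two solutions agree. The
  admissible constants \<open>\<alpha>\<close> and \<open>\<beta>\<close> at time \<open>t\<close> are chosen so that one step back from \<open>t + \<delta>\<close> leads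
  from the class at \<open>t + \<delta>\<close> into the class at \<open>t\<close>, and at \<open>\<tau>\<close> they are those of \<open>\<phi>\<close>.
  The rate \<open>2 A0 L\<close> turns the accumulated term into half of the assumed bound.\<close>

lemma euler_chain:
  assumes "\<theta> \<ge> 0" and bd: "\<And>t \<phi>. t \<in> {0..<T} \<Longrightarrow> bounded (range \<phi>) \<Longrightarrow> (\<And>x y. \<bar>\<phi> x - \<phi> y\<bar> \<le> norm (x - y)) \<Longrightarrow>
      Q \<phi> t \<le> \<theta> * exp (2 * A0 * L * t)"
    and \<tau>: "0 < \<tau>" "\<tau> < T" and "r > 0" and \<phi>: "C11 1 B0 \<phi> \<phi>'" and "B0 \<ge> 0"
  shows "Q \<phi> \<tau> \<le> 2 * \<tau> * A0 * L * r + \<theta> / 2 * exp (2 * A0 * L * \<tau>)"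
proof (rule field_le_epsilon)
  fix e :: real assume "e > 0"
  have L: "L \<ge> 1" by (rule s1.L_ge_1)
  have A0: "A0 \<ge> 1" using L s1.T_pos by (simp add: A0_def)
  obtain b1 where "b1 \<ge> 0" and approx: "\<And>(u :: 'a \<Rightarrow> 'a) M L.
      L \<ge> 0 \<Longrightarrow> (\<And>x. norm (u x) \<le> M) \<Longrightarrow> (\<And>x y. norm (u x - u y) \<le> L * norm (x - y)) \<Longrightarrow>
      \<exists>v v'. (\<forall>x. (v has_derivative blinfun_apply (v' x)) (at x)) \<and> (\<forall>x. norm (v x) \<le> M) \<and>
        (\<forall>x. norm (v x - u x) \<le> L * r) \<and> (\<forall>x. norm (v' x) \<le> L) \<and>
        (\<forall>x y. norm (v' x - v' y) \<le> b1 * L * norm (x - y))"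
    using smooth_approximation[OF \<open>r > 0\<close>, where 'a = 'a and 'b = 'a] by metis
  define b where "b = b1 * L"
  have b: "b \<ge> 0" using \<open>b1 \<ge> 0\<close> L by (simp add: b_def)
  define \<alpha> where "\<alpha> t = exp (L * (\<tau> - t))" for t
  define \<beta> where "\<beta> t = exp (2 * L * (\<tau> - t)) * (B0 + b * A0 * (\<tau> - t))" for t
  define C where "C = K A0 (\<beta> 0)"
  define \<Lambda> where "\<Lambda> = 2 * A0 * L"
  have \<Lambda>: "\<Lambda> > 0" using A0 L by (simp add: \<Lambda>_def)
  \<comment> \<open>The accumulated quadratic errors sum to \<open>2 C \<tau>\<^sup>2 / N\<close>.\<close>
  obtain N where N: "real N > 2 * C * \<tau>\<^sup>2 / e" "N > 0"
    using reals_Archimedean2[of "max 1 (2 * C * \<tau>\<^sup>2 / e)"] by (metis max_less_iff_conj less_trans of_nat_0_less_iff zero_less_one)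
  define \<delta> where "\<delta> = \<tau> / real N"
  have \<delta>: "\<delta> > 0" "real N * \<delta> = \<tau>" using \<tau> N by (auto simp: \<delta>_def)
  have claim: "C11 (\<alpha> (real k * \<delta>)) (\<beta> (real k * \<delta>)) \<phi> \<phi>' \<Longrightarrow>
      Q \<phi> (real k * \<delta>) \<le> real k * \<delta> * (2 * A0 * L * r + 2 * C * \<delta>) + A0 * L * \<theta> * (exp (\<Lambda> * (real k * \<delta>)) - 1) / \<Lambda>"
    if "k \<le> N" for k \<phi> \<phi>'
    using that
  proof (induction k arbitrary: \<phi> \<phi>')
    case 0
    then show ?case using Q_0 by simp
  next
    case (Suc k)
    define t where "t = real k * \<delta>"
    have t\<delta>_eq: "real (Suc k) * \<delta> = t + \<delta>" by (simp add: t_def algebra_simps)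
    have "real (Suc k) * \<delta> \<le> real N * \<delta>"
      using Suc.prems(2) \<delta>(1) by (intro mult_right_mono) auto
    then have t: "0 \<le> t" "t + \<delta> \<le> \<tau>"
      unfolding t\<delta>_eq \<delta>(2) using \<delta>(1) by (simp_all add: t_def)
    have tT: "t \<in> {0..<T}" "t + \<delta> \<in> {0..<T}" using t \<tau> \<delta> by auto
    have \<phi>: "C11 (\<alpha> (t + \<delta>)) (\<beta> (t + \<delta>)) \<phi> \<phi>'"
      using Suc.prems(1) unfolding t\<delta>_eq .
    have "\<alpha> (t + \<delta>) \<le> A0"
      unfolding \<alpha>_def A0_def using t \<delta> \<tau> L by simp
    have "\<alpha> (t + \<delta>) > 0" by (simp add: \<alpha>_def)
    have \<beta>0: "\<beta> (t + \<delta>) \<ge> 0"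
      unfolding \<beta>_def using t b A0 \<open>B0 \<ge> 0\<close> by simp
    have "\<beta> (t + \<delta>) \<le> \<beta> 0"
      unfolding \<beta>_def using t \<delta> b A0 \<open>B0 \<ge> 0\<close> L \<tau> by (intro mult_mono add_mono mult_left_mono) auto
    have \<alpha>_step: "\<alpha> (t + \<delta>) * (1 + \<delta> * L) \<le> \<alpha> t"
    proof -
      have "\<alpha> (t + \<delta>) * (1 + \<delta> * L) \<le> \<alpha> (t + \<delta>) * exp (\<delta> * L)"
        using \<open>\<alpha> (t + \<delta>) > 0\<close> by (intro mult_left_mono exp_ge_add_one_self) auto
      also have "\<dots> = \<alpha> t"
        by (simp add: \<alpha>_def exp_add[symmetric] algebra_simps)
      finally show ?thesis .
    qed
    have \<beta>_step: "\<beta> (t + \<delta>) * (1 + \<delta> * L)\<^sup>2 + \<alpha> (t + \<delta>) * \<delta> * b \<le> \<beta> t"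
    proof -
      have "(1 + \<delta> * L)\<^sup>2 \<le> (exp (\<delta> * L))\<^sup>2"
        using \<delta> L by (intro power_mono exp_ge_add_one_self) auto
      also have "\<dots> = exp (2 * L * \<delta>)"
        by (simp add: exp_double[symmetric] mult_ac)
      finally have "\<beta> (t + \<delta>) * (1 + \<delta> * L)\<^sup>2 \<le> \<beta> (t + \<delta>) * exp (2 * L * \<delta>)"
        using \<beta>0 by (rule mult_left_mono)
      also have "\<dots> = exp (2 * L * (\<tau> - t)) * (B0 + b * A0 * (\<tau> - (t + \<delta>)))"
        by (simp add: \<beta>_def mult.commute mult.left_commute exp_add[symmetric] algebra_simps)
      finally have 1: "\<beta> (t + \<delta>) * (1 + \<delta> * L)\<^sup>2 \<le> exp (2 * L * (\<tau> - t)) * (B0 + b * A0 * (\<tau> - (t + \<delta>)))" .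
      have "\<alpha> (t + \<delta>) * \<delta> * b \<le> 1 * (A0 * \<delta> * b)"
        using \<open>\<alpha> (t + \<delta>) \<le> A0\<close> \<delta> b by (simp add: mult_right_mono)
      also have "\<dots> \<le> exp (2 * L * (\<tau> - t)) * (A0 * \<delta> * b)"
        using t \<delta> L A0 b by (intro mult_right_mono) auto
      finally show ?thesis
        using 1 by (simp add: \<beta>_def algebra_simps)
    qed
    have "norm (- s1.drift t x) \<le> M" "norm (- s1.drift t x - - s1.drift t y) \<le> L * norm (x - y)" for x y
      using s1.drift_bound[OF tT(1)] s1.drift_lipschitz[OF tT(1), of y x] by (auto simp: norm_minus_commute)
    with approx[of L "\<lambda>x. - s1.drift t x" M] L obtain V V' where V: "\<And>x. (V has_derivative blinfun_apply (V' x)) (at x)"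
      "\<And>x. norm (V x) \<le> M" "\<And>x. norm (V x + s1.drift t x) \<le> L * r" "\<And>x. norm (V' x) \<le> L"
      "\<And>x y. norm (V' x - V' y) \<le> b * norm (x - y)"
      unfolding b_def by auto
    obtain \<phi>2 \<phi>2' where \<phi>2: "C11 (\<alpha> (t + \<delta>) * (1 + \<delta> * L)) (\<beta> (t + \<delta>) * (1 + \<delta> * L)\<^sup>2 + \<alpha> (t + \<delta>) * \<delta> * b) \<phi>2 \<phi>2'"
      and step: "Q \<phi> (t + \<delta>) \<le> Q \<phi>2 t + \<delta> * (\<alpha> (t + \<delta>) * (2 * L * r + L * (\<theta> * exp (\<Lambda> * t)))) + 2 * K (\<alpha> (t + \<delta>)) (\<beta> (t + \<delta>)) * \<delta>\<^sup>2"
      using one_step[OF \<phi> \<beta>0 less_imp_le[OF \<delta>(1)] b tT V bd[OF tT(1)]] unfolding \<Lambda>_def by metis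
    have "Q \<phi>2 t \<le> t * (2 * A0 * L * r + 2 * C * \<delta>) + A0 * L * \<theta> * (exp (\<Lambda> * t) - 1) / \<Lambda>"
      using Suc.IH[of \<phi>2 \<phi>2'] C11_mono[OF \<phi>2 \<alpha>_step \<beta>_step] Suc.prems(2) by (simp add: t_def)
    moreover have "\<delta> * (\<alpha> (t + \<delta>) * (2 * L * r + L * (\<theta> * exp (\<Lambda> * t)))) \<le> \<delta> * (A0 * (2 * L * r + L * (\<theta> * exp (\<Lambda> * t))))"
      using \<delta> L \<open>r > 0\<close> \<open>\<theta> \<ge> 0\<close> \<open>\<alpha> (t + \<delta>) \<le> A0\<close> by (intro mult_left_mono mult_right_mono) auto
    moreover have "2 * K (\<alpha> (t + \<delta>)) (\<beta> (t + \<delta>)) * \<delta>\<^sup>2 \<le> 2 * C * \<delta>\<^sup>2"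
      unfolding C_def using \<open>\<alpha> (t + \<delta>) \<le> A0\<close> \<open>\<beta> (t + \<delta>) \<le> \<beta> 0\<close>
      by (intro mult_right_mono mult_left_mono K_mono) auto
    \<comment> \<open>a Riemann sum of the exponential is below its integral\<close>
    moreover have "A0 * L * \<theta> * (\<delta> * exp (\<Lambda> * t)) \<le> A0 * L * \<theta> * ((exp (\<Lambda> * (t + \<delta>)) - exp (\<Lambda> * t)) / \<Lambda>)"
    proof (rule mult_left_mono)
      have "exp (\<Lambda> * t) * (1 + \<Lambda> * \<delta>) \<le> exp (\<Lambda> * t) * exp (\<Lambda> * \<delta>)"
        by (intro mult_left_mono exp_ge_add_one_self) auto
      then have "\<Lambda> * (\<delta> * exp (\<Lambda> * t)) \<le> exp (\<Lambda> * (t + \<delta>)) - exp (\<Lambda> * t)"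
        by (simp add: exp_add distrib_left mult_ac)
      then show "\<delta> * exp (\<Lambda> * t) \<le> (exp (\<Lambda> * (t + \<delta>)) - exp (\<Lambda> * t)) / \<Lambda>"
        using \<Lambda> by (simp add: pos_le_divide_eq mult_ac)
    qed (use A0 L \<open>\<theta> \<ge> 0\<close> in auto)
    ultimately have "Q \<phi> (t + \<delta>) \<le> t * (2 * A0 * L * r + 2 * C * \<delta>) + A0 * L * \<theta> * (exp (\<Lambda> * t) - 1) / \<Lambda>
        + \<delta> * (2 * A0 * L * r) + A0 * L * \<theta> * ((exp (\<Lambda> * (t + \<delta>)) - exp (\<Lambda> * t)) / \<Lambda>) + 2 * C * \<delta>\<^sup>2"
      using step by (simp add: algebra_simps)
    also have "\<dots> = (t + \<delta>) * (2 * A0 * L * r + 2 * C * \<delta>) + A0 * L * \<theta> * (exp (\<Lambda> * (t + \<delta>)) - 1) / \<Lambda>"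
      by (simp add: algebra_simps power2_eq_square diff_divide_distrib add_divide_distrib)
    finally show ?case by (simp only: t\<delta>_eq)
  qed
  have "\<alpha> \<tau> = 1" "\<beta> \<tau> = B0" by (simp_all add: \<alpha>_def \<beta>_def)
  then have "Q \<phi> \<tau> \<le> \<tau> * (2 * A0 * L * r + 2 * C * \<delta>) + A0 * L * \<theta> * (exp (\<Lambda> * \<tau>) - 1) / \<Lambda>"
    using claim[of N \<phi> \<phi>'] \<phi> by (simp add: \<delta>(2))
  also have "A0 * L * \<theta> * (exp (\<Lambda> * \<tau>) - 1) / \<Lambda> = \<theta> / 2 * (exp (\<Lambda> * \<tau>) - 1)"
    using A0 L by (simp add: \<Lambda>_def field_simps)
  also have "\<dots> \<le> \<theta> / 2 * exp (\<Lambda> * \<tau>)"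
    using \<open>\<theta> \<ge> 0\<close> by (intro mult_left_mono) auto
  also have "\<tau> * (2 * A0 * L * r + 2 * C * \<delta>) \<le> 2 * \<tau> * A0 * L * r + e"
  proof -
    have "2 * C * \<tau>\<^sup>2 \<le> e * real N"
      using N(1) \<open>e > 0\<close> by (simp add: field_simps)
    then have "2 * C * \<tau> * \<delta> \<le> e"
      using N(2) by (simp add: \<delta>_def field_simps power2_eq_square)
    then show ?thesis by (simp add: algebra_simps)
  qed
  finally show "Q \<phi> \<tau> \<le> 2 * \<tau> * A0 * L * r + \<theta> / 2 * exp (2 * A0 * L * \<tau>) + e"
    by (simp add: \<Lambda>_def)
qed

text \<open>The Gronwall argument runs over all times and all test functions simultaneously.\<close>

lemma Q_eq_0:
  assumes t: "t \<in> {0..<T}" and \<phi>: "bounded (range \<phi>)" "\<And>x y. \<bar>\<phi> x - \<phi> y\<bar> \<le> norm (x - y)"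
  shows "Q \<phi> t = 0"
proof -
  define I where "I = {(t, \<phi> :: 'a \<Rightarrow> real). t \<in> {0..<T} \<and> bounded (range \<phi>) \<and> (\<forall>x y. \<bar>\<phi> x - \<phi> y\<bar> \<le> norm (x - y))}"
  define e where "e = (\<lambda>(t, \<phi>). Q \<phi> t * exp (- (2 * A0 * L * t)))"
  have Q_init: "Q \<phi> 0 = 0" if "(t, \<phi>) \<in> I" for t \<phi>
    using that s1.initial_mean[of \<phi>] s2.initial_mean[of \<phi>] by (simp add: I_def Q_def)
  have "e (t, \<phi>) \<le> 2 * 0"
  proof (rule halving_bound[where A = I and e = e])
    fix i assume i: "i \<in> I"
    obtain t \<phi> where ti: "i = (t, \<phi>)" by (cases i)
    with i have t: "t \<in> {0..<T}" and \<phi>: "bounded (range \<phi>)" "\<And>x y. \<bar>\<phi> x - \<phi> y\<bar> \<le> norm (x - y)"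
      by (auto simp: I_def)
    have 0: "0 \<in> {0..<T}" using s1.T_pos by simp
    have "Q \<phi> t \<le> 2 * M * \<bar>t\<bar>"
      using s1.lipschitz_in_time[OF zero_le_one \<phi>(1) _ 0 t] s2.lipschitz_in_time[OF zero_le_one \<phi>(1) _ 0 t] \<phi>(2)
        Q_init[OF i[unfolded ti]] by (simp add: Q_def)
    also have "\<dots> \<le> 2 * M * T"
      using t s1.M_ge_1 by (intro mult_left_mono) auto
    finally have "Q \<phi> t * exp (- (2 * A0 * L * t)) \<le> (2 * M * T) * 1"
      using t s1.L_ge_1 s1.M_ge_1 s1.T_pos by (intro mult_mono) (auto simp: A0_def)
    then show "e i \<le> 2 * M * T" by (simp add: e_def ti)
  next
    fix \<theta> i assume "0 \<le> \<theta>" and \<theta>: "\<And>j. j \<in> I \<Longrightarrow> e j \<le> \<theta>" and i: "i \<in> I"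
    obtain \<tau> \<phi> where ti: "i = (\<tau>, \<phi>)" by (cases i)
    with i have \<tau>: "\<tau> \<in> {0..<T}" and \<phi>: "bounded (range \<phi>)" "\<And>x y. \<bar>\<phi> x - \<phi> y\<bar> \<le> 1 * norm (x - y)"
      by (auto simp: I_def)
    have bd: "Q \<phi> t \<le> \<theta> * exp (2 * A0 * L * t)"
      if "t \<in> {0..<T}" "bounded (range \<phi>)" "\<And>x y. \<bar>\<phi> x - \<phi> y\<bar> \<le> norm (x - y)" for t \<phi>
      using \<theta>[of "(t, \<phi>)"] that by (simp add: I_def e_def exp_minus field_simps)
    have "Q \<phi> \<tau> \<le> \<theta> / 2 * exp (2 * A0 * L * \<tau>)"
    proof (cases "\<tau> = 0")
      case True
      then show ?thesis using Q_init[OF i[unfolded ti]] \<open>0 \<le> \<theta>\<close> by simp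
    next
      case False
      then have \<tau>': "0 < \<tau>" "\<tau> < T" using \<tau> by auto
      show ?thesis
      proof (rule field_le_epsilon)
        fix \<epsilon> :: real assume "\<epsilon> > 0"
        \<comment> \<open>The errors of \<open>euler_chain\<close> and of mollifying \<open>\<phi>\<close> add up to \<open>c r\<close>.\<close>
        define c where "c = 2 * \<tau> * A0 * L + 2"
        have "c > 0" using \<tau>' s1.L_ge_1 by (simp add: c_def A0_def add_pos_pos)
        define r where "r = \<epsilon> / c"
        have "r > 0" using \<open>c > 0\<close> \<open>\<epsilon> > 0\<close> by (simp add: r_def)
        obtain B where "B \<ge> 0" and B: "\<And>(\<phi> :: 'a \<Rightarrow> real) A. A \<ge> 0 \<Longrightarrow> bounded (range \<phi>) \<Longrightarrow>
            (\<And>x y. \<bar>\<phi> x - \<phi> y\<bar> \<le> A * norm (x - y)) \<Longrightarrow>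
            \<exists>\<phi>1 \<phi>1'. C11 A (B * A) \<phi>1 \<phi>1' \<and> (\<forall>x. \<bar>\<phi>1 x - \<phi> x\<bar> \<le> A * r)"
          using C11_approximation[OF \<open>r > 0\<close>] by metis
        obtain \<phi>1 \<phi>1' where \<phi>1: "C11 1 (B * 1) \<phi>1 \<phi>1'" and close: "\<And>x. \<bar>\<phi>1 x - \<phi> x\<bar> \<le> r"
          using B[of 1 \<phi>] \<phi> by auto
        have "Q \<phi>1 \<tau> \<le> 2 * \<tau> * A0 * L * r + \<theta> / 2 * exp (2 * A0 * L * \<tau>)"
          by (rule euler_chain[OF \<open>0 \<le> \<theta>\<close> bd \<tau>' \<open>r > 0\<close> \<phi>1]) (use \<open>B \<ge> 0\<close> in auto)
        moreover have "\<bar>(\<integral>x. \<phi>1 x \<partial>\<sigma>1 \<tau>) - (\<integral>x. \<phi> x \<partial>\<sigma>1 \<tau>)\<bar> \<le> r" "\<bar>(\<integral>x. \<phi>1 x \<partial>\<sigma>2 \<tau>) - (\<integral>x. \<phi> x \<partial>\<sigma>2 \<tau>)\<bar> \<le> r"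
          using s1.integral_close[OF \<phi> \<phi>1 close] s1.\<sigma>_prob[OF \<tau>] s2.\<sigma>_prob[OF \<tau>] by auto
        then have "Q \<phi> \<tau> \<le> Q \<phi>1 \<tau> + 2 * r"
          unfolding Q_def by linarith
        moreover have "2 * \<tau> * A0 * L * r + 2 * r = \<epsilon>"
        proof -
          have "r * c = \<epsilon>" using \<open>c > 0\<close> by (simp add: r_def)
          then show ?thesis by (simp add: c_def algebra_simps)
        qed
        ultimately show "Q \<phi> \<tau> \<le> \<theta> / 2 * exp (2 * A0 * L * \<tau>) + \<epsilon>"
          by linarith
      qed
    qed
    then show "e i \<le> 0 + \<theta> / 2"
      by (simp add: ti e_def exp_minus field_simps)
  qed (use assms in \<open>auto simp: I_def\<close>)
  then have "Q \<phi> t \<le> 0"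
    by (simp add: e_def mult_le_0_iff)
  then show ?thesis by (simp add: Q_def)
qed

end

theorem weak_solution_unique:
  assumes "lipschitz_field G M L" "T > 0" "\<rho>0 \<in> prob_measures"
    and "weak_solution T G \<rho>0 \<sigma>1" "weak_solution T G \<rho>0 \<sigma>2" and t: "t \<in> {0..<T}"
  shows "\<sigma>1 t = \<sigma>2 t"
proof -
  interpret lipschitz_field G M L by fact
  interpret two_weak_curves G M L T \<rho>0 \<sigma>1 \<sigma>2
    using assms by unfold_locales auto
  show ?thesis
    using Q_eq_0[OF t] by (intro prob_measures_eqI s1.\<sigma>_prob s2.\<sigma>_prob t) (simp add: Q_def)
qed

section \<open>Characteristics of the kinetic equation\<close>

lemma fst_borel_measurable: "fst \<in> borel_measurable (borel :: ('a::euclidean_space \<times> 'a) measure)"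
  unfolding borel_prod[symmetric] by measurable

lemma first_marginal_prob: "\<mu> \<in> prob_measures \<Longrightarrow> first_marginal \<mu> \<in> prob_measures"
  unfolding first_marginal_def
  by (intro distr_in_prob_measures) (simp_all add: prob_measuresD fst_borel_measurable)

lemma norm_fst_snd_le:
  fixes z :: "'a::real_normed_vector \<times> 'b::real_normed_vector"
  shows "norm (fst z) \<le> norm z" "norm (snd z) \<le> norm z"
  by (metis norm_fst_le norm_snd_le prod.collapse)+

context lipschitz_field
begin

text \<open>Continuity in time is uniform in space because all functions \<open>z \<mapsto> G (x - fst z)\<close> share the Lipschitz
  constant \<open>L\<close>, so that their integrals are controlled by \<open>W1\<close>.\<close>

lemma force_field_continuous:
  fixes f :: "real \<Rightarrow> ('a \<times> 'a) measure"
  assumes f: "f \<in> C_P1 {0..<T}" and "S < T"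
  shows "continuous_on ({0..S} \<times> UNIV) (\<lambda>(t, x). force_field G f t x)"
proof (rule continuous_on_uniform_family[where n = "\<lambda>t s. SUP x. norm (force_field G f s x - force_field G f t x)"])
  have fp: "f t \<in> prob_measures" if "t \<in> {0..S}" for t
    using f that \<open>S < T\<close> by (auto simp: C_P1_def prob_measures_1_def)
  have Eb: "norm (force_field G f t x) \<le> M" if "t \<in> {0..S}" for t x
    using conv_bound[OF prob_measuresD(1)[OF first_marginal_prob[OF fp[OF that]]]] by (simp add: force_field_def)
  show "continuous_on UNIV (force_field G f t)" if "t \<in> {0..S}" for t
    unfolding force_field_def
    by (intro continuous_on_minus borel_measurable_lipschitz(1)[OF conv_lipschitz] first_marginal_prob fp that)
  fix t assume t: "t \<in> {0..S}"
  have bdd: "bdd_above (range (\<lambda>x. norm (force_field G f s x - force_field G f t x)))" if "s \<in> {0..S}" for s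
  proof (rule bdd_aboveI2)
    show "norm (force_field G f s x - force_field G f t x) \<le> M + M" for x
      by (rule order_trans[OF norm_triangle_ineq4]) (intro add_mono Eb that t)
  qed
  then show "norm (force_field G f s x - force_field G f t x) \<le> (SUP x. norm (force_field G f s x - force_field G f t x))"
    if "s \<in> {0..S}" for s x
    using that by (intro cSUP_upper) auto
  have eq: "conv_measure G (first_marginal (f s)) x = (\<integral>z. G (x - fst z) \<partial>f s)" if "s \<in> {0..S}" for s x
    unfolding first_marginal_def
    by (rule conv_distr) (simp add: prob_measuresD[OF fp[OF that]] fst_borel_measurable)
  show "((\<lambda>s. SUP x. norm (force_field G f s x - force_field G f t x)) \<longlongrightarrow> 0) (at t within {0..S})"
  proof (rule tendstoI)
    fix e :: real assume "e > 0"
    define c where "c = e / (2 * L)"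
    have c: "c > 0" "L * c < e" using \<open>e > 0\<close> L_ge_1 by (simp_all add: c_def)
    have "((\<lambda>s. W1 (f s) (f t)) \<longlongrightarrow> 0) (at t within {0..<T})"
      using f t \<open>S < T\<close> by (auto simp: C_P1_def)
    then have "((\<lambda>s. W1 (f s) (f t)) \<longlongrightarrow> 0) (at t within {0..S})"
      by (rule tendsto_within_subset) (use \<open>S < T\<close> in auto)
    then have "\<forall>\<^sub>F s in at t within {0..S}. W1 (f s) (f t) < ennreal c"
      using c(1) by (intro order_tendstoD(2)) auto
    moreover have "\<forall>\<^sub>F s in at t within {0..S}. s \<in> {0..S}"
      by (auto simp: eventually_at_filter intro!: always_eventually)
    ultimately show "\<forall>\<^sub>F s in at t within {0..S}. dist (SUP x. norm (force_field G f s x - force_field G f t x)) 0 < e"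
    proof eventually_elim
      case (elim s)
      have le: "norm (force_field G f s x - force_field G f t x) \<le> L * c" for x
      proof -
        have "norm ((\<integral>z. G (x - fst z) \<partial>f s) - (\<integral>z. G (x - fst z) \<partial>f t)) \<le> L * c"
        proof (rule integral_diff_le_W1[OF G_bound _ _ elim(1)])
          fix y z :: "'a \<times> 'a"
          have "norm (G (x - fst y) - G (x - fst z)) \<le> L * norm (fst (y - z))"
            using G_lip[of "x - fst y" "x - fst z"] by (simp add: norm_minus_commute)
          also have "\<dots> \<le> L * norm (y - z)"
            using L_ge_1 by (intro mult_left_mono norm_fst_snd_le) auto
          finally show "norm (G (x - fst y) - G (x - fst z)) \<le> L * norm (y - z)" .
        qed (use L_ge_1 in simp)
        then show ?thesis
          by (simp add: force_field_def eq[OF elim(2)] eq[OF t] norm_minus_commute)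
      qed
      have "(SUP x. norm (force_field G f s x - force_field G f t x)) \<le> L * c"
        using le by (intro cSUP_least) auto
      moreover have "0 \<le> (SUP x. norm (force_field G f s x - force_field G f t x))"
        by (rule order_trans[OF norm_ge_zero cSUP_upper[OF UNIV_I bdd[OF elim(2)]]])
      ultimately show ?case using c(2) by simp
    qed
  qed
qed

text \<open>The force field is Lipschitz, so the characteristic system has unique solutions and \<open>flow_map\<close>
  selects their values. They depend continuously on the initial point, which makes \<open>flow_map\<close>
  measurable; this is why the spatial marginal is the law of \<open>x t\<close> under \<open>f0\<close>.\<close>

lemma kinetic_characteristics:
  fixes f :: "real \<Rightarrow> ('a \<times> 'a) measure"
  assumes "\<epsilon> > 0" and f: "f \<in> C_P1 {0..<T}" and S: "0 < S" "S < T"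
    and sol: "kinetic_solution S \<epsilon> G f0 f" and f0: "f0 \<in> prob_measures"
  obtains x v :: "real \<Rightarrow> 'a \<times> 'a \<Rightarrow> 'a" where
    "\<And>z. x 0 z = fst z" "\<And>z. v 0 z = snd z"
    "\<And>t. t \<in> {0..S} \<Longrightarrow> x t \<in> borel_measurable f0"
    "\<And>t. t \<in> {0..S} \<Longrightarrow> first_marginal (f t) = distr f0 borel (x t)"
    "\<And>t z. t \<in> {0..S} \<Longrightarrow> ((\<lambda>s. x s z) has_vector_derivative v t z) (at t within {0..S})"
    "\<And>t z. t \<in> {0..S} \<Longrightarrow> ((\<lambda>s. v s z) has_vector_derivative
        (1 / \<epsilon>) *\<^sub>R (- v t z - conv_measure G (distr f0 borel (x t)) (x t z))) (at t within {0..S})"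
proof -
  define E where "E = force_field G f"
  define F where "F s z = (snd z, - (1 / \<epsilon>) *\<^sub>R snd z + (1 / \<epsilon>) *\<^sub>R E s (fst z))" for s and z :: "'a \<times> 'a"
  define \<Lambda> where "\<Lambda> = 1 + (1 / \<epsilon>) * (1 + L)"
  have \<Lambda>: "\<Lambda> > 0" using \<open>\<epsilon> > 0\<close> L_ge_1 by (simp add: \<Lambda>_def add_pos_pos)
  have fp: "f t \<in> prob_measures" if "t \<in> {0..S}" for t
    using f that S by (auto simp: C_P1_def prob_measures_1_def)
  have E_lip: "norm (E s x - E s y) \<le> L * norm (x - y)" if "s \<in> {0..S}" for s x y
    using conv_lipschitz[OF first_marginal_prob[OF fp[OF that]], of y x]
    by (simp add: E_def force_field_def norm_minus_commute)
  have F_lip: "norm (F s a - F s b) \<le> \<Lambda> * norm (a - b)" if s: "s \<in> {0..S}" for s a b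
  proof -
    have n: "norm (fst a - fst b) \<le> norm (a - b)" "norm (snd a - snd b) \<le> norm (a - b)"
      using norm_fst_snd_le[of "a - b"] by simp_all
    have "F s a - F s b = (snd a - snd b, (1 / \<epsilon>) *\<^sub>R ((E s (fst a) - E s (fst b)) - (snd a - snd b)))"
      by (simp add: F_def algebra_simps)
    also have "norm \<dots> \<le> norm (snd a - snd b) + norm ((1 / \<epsilon>) *\<^sub>R ((E s (fst a) - E s (fst b)) - (snd a - snd b)))"
      by (rule norm_Pair_le)
    also have "\<dots> \<le> norm (a - b) + (1 / \<epsilon>) * (L * norm (a - b) + norm (a - b))"
    proof (rule add_mono[OF n(2)])
      have "norm (E s (fst a) - E s (fst b)) \<le> L * norm (a - b)"
        using L_ge_1 by (intro order_trans[OF E_lip[OF s]] mult_left_mono n(1)) auto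
      then have "norm ((E s (fst a) - E s (fst b)) - (snd a - snd b)) \<le> L * norm (a - b) + norm (a - b)"
        by (rule order_trans[OF norm_triangle_ineq4 add_mono[OF _ n(2)]])
      then show "norm ((1 / \<epsilon>) *\<^sub>R ((E s (fst a) - E s (fst b)) - (snd a - snd b))) \<le> (1 / \<epsilon>) * (L * norm (a - b) + norm (a - b))"
        unfolding norm_scaleR using \<open>\<epsilon> > 0\<close> by (auto intro!: mult_left_mono divide_right_mono)
    qed
    also have "\<dots> = \<Lambda> * norm (a - b)"
      by (simp add: \<Lambda>_def algebra_simps add_divide_distrib)
    finally show ?thesis .
  qed
  have "(\<lambda>p :: real \<times> 'a \<times> 'a. (fst p, fst (snd p))) ` ({0..S} \<times> UNIV) \<subseteq> {0..S} \<times> UNIV"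
    by auto
  from continuous_on_compose2[OF force_field_continuous[OF f S(2)] _ this]
  have "continuous_on ({0..S} \<times> UNIV) (\<lambda>p :: real \<times> 'a \<times> 'a. E (fst p) (fst (snd p)))"
    by (simp add: E_def split_beta continuous_intros)
  then have F_cont: "continuous_on ({0..S} \<times> UNIV) (\<lambda>(t, z). F t z)"
    unfolding F_def split_beta by (intro continuous_intros)
  have "\<exists>Z. Z 0 = z \<and> (\<forall>s\<in>{0..S}. (Z has_vector_derivative F s (Z s)) (at s within {0..S}))" for z
    using ode_existence[OF F_cont F_lip \<Lambda>, of z] S by (metis less_imp_le)
  then obtain Z where Z0: "\<And>z. Z z 0 = z"
    and Z: "\<And>z s. s \<in> {0..S} \<Longrightarrow> (Z z has_vector_derivative F s (Z z s)) (at s within {0..S})"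
    by metis
  define x where "x t z = fst (Z z t)" for t z
  define v where "v t z = snd (Z z t)" for t z
  have x_der: "((\<lambda>s. x s z) has_vector_derivative v t z) (at t within {0..S})" if "t \<in> {0..S}" for t z
    using bounded_linear.has_vector_derivative[OF bounded_linear_fst Z[OF that]]
    by (simp add: x_def v_def F_def)
  have v_der: "((\<lambda>s. v s z) has_vector_derivative - (1 / \<epsilon>) *\<^sub>R v t z + (1 / \<epsilon>) *\<^sub>R E t (x t z)) (at t within {0..S})"
    if "t \<in> {0..S}" for t z
    using bounded_linear.has_vector_derivative[OF bounded_linear_snd Z[OF that]]
    by (simp add: x_def v_def F_def)
  have flow: "flow_map \<epsilon> E t z = Z z t" if t: "t \<in> {0..S}" for t z
    unfolding flow_map_def
  proof (rule the_equality)
    have sub: "{0..t} \<subseteq> {0..S}" using t by auto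
    show "\<exists>x v. (x 0, v 0) = z \<and> (\<forall>s\<in>{0..t}. (x has_vector_derivative v s) (at s within {0..t}) \<and>
        (v has_vector_derivative - (1 / \<epsilon>) *\<^sub>R v s + (1 / \<epsilon>) *\<^sub>R E s (x s)) (at s within {0..t})) \<and> Z z t = (x t, v t)"
    proof (rule exI[of _ "\<lambda>s. x s z"], rule exI[of _ "\<lambda>s. v s z"], intro conjI ballI)
      fix s assume "s \<in> {0..t}"
      then have s: "s \<in> {0..S}" using sub by auto
      show "((\<lambda>s. x s z) has_vector_derivative v s z) (at s within {0..t})"
        by (rule has_vector_derivative_within_subset[OF x_der[OF s] sub])
      show "((\<lambda>s. v s z) has_vector_derivative - (1 / \<epsilon>) *\<^sub>R v s z + (1 / \<epsilon>) *\<^sub>R E s (x s z)) (at s within {0..t})"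
        by (rule has_vector_derivative_within_subset[OF v_der[OF s] sub])
    qed (simp_all add: x_def v_def Z0)
    fix z1
    assume "\<exists>x v. (x 0, v 0) = z \<and> (\<forall>s\<in>{0..t}. (x has_vector_derivative v s) (at s within {0..t}) \<and>
        (v has_vector_derivative - (1 / \<epsilon>) *\<^sub>R v s + (1 / \<epsilon>) *\<^sub>R E s (x s)) (at s within {0..t})) \<and> z1 = (x t, v t)"
    then obtain x1 v1 where 1: "(x1 0, v1 0) = z" "z1 = (x1 t, v1 t)"
      and d: "\<And>s. s \<in> {0..t} \<Longrightarrow> (x1 has_vector_derivative v1 s) (at s within {0..t})"
        "\<And>s. s \<in> {0..t} \<Longrightarrow> (v1 has_vector_derivative - (1 / \<epsilon>) *\<^sub>R v1 s + (1 / \<epsilon>) *\<^sub>R E s (x1 s)) (at s within {0..t})"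
      by blast
    have "norm ((x1 t, v1 t) - Z z t) \<le> 2 * norm ((x1 0, v1 0) - Z z 0) * exp (2 * \<Lambda> * t)"
    proof (rule ode_dependence[where F = F and T = t])
      show "((\<lambda>s. (x1 s, v1 s)) has_vector_derivative F s (x1 s, v1 s)) (at s within {0..t})" if "s \<in> {0..t}" for s
        using has_vector_derivative_Pair[OF d(1)[OF that] d(2)[OF that]] by (simp add: F_def)
      show "(Z z has_vector_derivative F s (Z z s)) (at s within {0..t})" if "s \<in> {0..t}" for s
        by (rule has_vector_derivative_within_subset[OF Z sub]) (use that sub in auto)
    qed (use F_lip sub \<Lambda> t in auto)
    then show "z1 = Z z t"
      by (simp add: 1 Z0)
  qed
  have Z_lip: "norm (Z y t - Z z t) \<le> (2 * exp (2 * \<Lambda> * t)) * norm (y - z)" if "t \<in> {0..S}" for t y z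
    using ode_dependence[OF Z Z F_lip \<Lambda> that, of y z] by (simp add: Z0 mult_ac)
  have Z_meas: "(\<lambda>z. Z z t) \<in> borel_measurable f0" if "t \<in> {0..S}" for t
    unfolding prob_measuresD(4)[OF f0] by (rule borel_measurable_lipschitz(2)[OF Z_lip[OF that]])
  have x_meas: "x t \<in> borel_measurable f0" if "t \<in> {0..S}" for t
    unfolding x_def using measurable_compose[OF Z_meas[OF that] fst_borel_measurable] by simp
  have marg: "first_marginal (f t) = distr f0 borel (x t)" if "t \<in> {0..S}" for t
  proof -
    have "f t = distr f0 borel (flow_map \<epsilon> E t)"
      using sol that unfolding kinetic_solution_def E_def by blast
    also have "flow_map \<epsilon> E t = (\<lambda>z. Z z t)"
      using flow[OF that] by blast
    finally show ?thesis
      unfolding first_marginal_def using distr_distr[OF fst_borel_measurable Z_meas[OF that]]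
      by (simp add: comp_def x_def[abs_def])
  qed
  show thesis
  proof (rule that[of x v])
    show "((\<lambda>s. v s z) has_vector_derivative
        (1 / \<epsilon>) *\<^sub>R (- v t z - conv_measure G (distr f0 borel (x t)) (x t z))) (at t within {0..S})" if "t \<in> {0..S}" for t z
      using v_der[OF that, of z] by (simp add: E_def force_field_def marg[OF that] algebra_simps)
  qed (use x_meas marg x_der in \<open>auto simp: x_def v_def Z0\<close>)
qed

text \<open>The integrating factor \<open>exp (s / \<epsilon>)\<close> removes the friction; the bound does not depend on \<open>\<epsilon>\<close>.\<close>

lemma velocity_bound:
  fixes v E :: "real \<Rightarrow> 'a"
  assumes "\<epsilon> > 0" and der: "\<And>s. s \<in> {0..S} \<Longrightarrow> (v has_vector_derivative (1 / \<epsilon>) *\<^sub>R (- v s - E s)) (at s within {0..S})"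
    and E: "\<And>s. s \<in> {0..S} \<Longrightarrow> norm (E s) \<le> M" and t: "t \<in> {0..S}"
  shows "norm (v t) \<le> norm (v 0) + M"
proof -
  define u where "u s = exp (s / \<epsilon>) *\<^sub>R v s" for s
  have "norm (u t - u 0) \<le> M * exp (t / \<epsilon>) - M * exp (0 / \<epsilon>)"
  proof (rule norm_diff_le_of_derivative_le[where a = 0 and b = S])
    fix s assume s: "s \<in> {0..S}"
    have e: "((\<lambda>s. exp (s / \<epsilon>)) has_real_derivative exp (s / \<epsilon>) / \<epsilon>) (at s within {0..S})"
      using \<open>\<epsilon> > 0\<close> by (auto intro!: derivative_eq_intros)
    show "(u has_vector_derivative exp (s / \<epsilon>) *\<^sub>R ((1 / \<epsilon>) *\<^sub>R (- v s - E s)) + (exp (s / \<epsilon>) / \<epsilon>) *\<^sub>R v s) (at s within {0..S})"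
      unfolding u_def by (rule has_vector_derivative_scaleR[OF e der[OF s]])
    show "((\<lambda>s. M * exp (s / \<epsilon>)) has_vector_derivative M * (exp (s / \<epsilon>) / \<epsilon>)) (at s within {0..S})"
      unfolding has_real_derivative_iff_has_vector_derivative[symmetric] by (rule DERIV_cmult[OF e])
    have "exp (s / \<epsilon>) *\<^sub>R ((1 / \<epsilon>) *\<^sub>R (- v s - E s)) + (exp (s / \<epsilon>) / \<epsilon>) *\<^sub>R v s = - ((exp (s / \<epsilon>) / \<epsilon>) *\<^sub>R E s)"
      by (simp add: algebra_simps)
    then show "norm (exp (s / \<epsilon>) *\<^sub>R ((1 / \<epsilon>) *\<^sub>R (- v s - E s)) + (exp (s / \<epsilon>) / \<epsilon>) *\<^sub>R v s) \<le> M * (exp (s / \<epsilon>) / \<epsilon>)"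
      using mult_right_mono[OF E[OF s], of "exp (s / \<epsilon>) / \<epsilon>"] \<open>\<epsilon> > 0\<close> by (simp add: mult_ac)
  qed (use t in auto)
  then have "norm (u t) \<le> norm (v 0) + M * exp (t / \<epsilon>)"
    using norm_triangle_sub[of "u t" "u 0"] M_ge_1 by (simp add: u_def)
  also have "\<dots> \<le> (norm (v 0) + M) * exp (t / \<epsilon>)"
    using t \<open>\<epsilon> > 0\<close> by (simp add: distrib_right mult_le_cancel_left1)
  finally have "exp (t / \<epsilon>) * norm (v t) \<le> exp (t / \<epsilon>) * (norm (v 0) + M)"
    by (simp add: u_def mult.commute)
  then show ?thesis by simp
qed

end

section \<open>The small-inertia limit\<close>

context aggregation_flow
begin

text \<open>The deviation of a particle grows with its initial speed and is measured relative to it.\<close>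

definition weight :: "'a \<times> 'a \<Rightarrow> real" where "weight z = 1 + norm (snd z)"

text \<open>The variable \<open>y = x + \<epsilon> v - X\<close> has no stiff term in its equation. The interaction averages the errors of
  all particles, and this is where the mean \<open>m\<close> of the weight enters the exponential rate.\<close>

theorem kinetic_limit_rate:
  fixes f0 :: "('a \<times> 'a) measure"
  assumes f0: "f0 \<in> prob_measures_1" and \<rho>0_eq: "\<rho>0 = first_marginal f0"
    and "\<epsilon> > 0" and f: "f \<in> C_P1 {0..<T}" and S: "0 < S" "S < T"
    and sol: "kinetic_solution S \<epsilon> G f0 f" and t: "t \<in> {0..S}"
  defines "m \<equiv> \<integral>z. weight z \<partial>f0"
  shows "W1 (first_marginal (f t)) (\<rho> t) \<le> ennreal (\<epsilon> * (2 * (2 + M) * exp (2 * L * (1 + m) * t) * m))"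
proof -
  have f0p: "f0 \<in> prob_measures" using f0 by (simp add: prob_measures_1_def)
  interpret f0: prob_space f0 using f0p by (rule prob_measuresD)
  have fst_m: "fst \<in> borel_measurable f0"
    by (simp add: prob_measuresD[OF f0p] fst_borel_measurable)
  have X_meas: "(\<lambda>z. X t (fst z)) \<in> borel_measurable f0" for t
    using measurable_compose[OF fst_m borel_measurable_continuous_onI[OF X_cont]] .
  have \<rho>_eq: "\<rho> t = distr f0 borel (\<lambda>z. X t (fst z))" for t
    unfolding \<rho>_def unfolding \<rho>0_eq first_marginal_def
    by (subst distr_distr[OF borel_measurable_continuous_onI[OF X_cont] fst_m]) (simp add: comp_def)
  have int: "integrable f0 weight"
  proof -
    have "integrable f0 norm" using f0 by (simp add: prob_measures_1_def)
    moreover have "(\<lambda>z. norm (snd z)) \<in> borel_measurable f0"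
      unfolding prob_measuresD(4)[OF f0p] by (intro borel_measurable_continuous_onI continuous_intros)
    ultimately have "integrable f0 (\<lambda>z. norm (snd z))"
      by (rule Bochner_Integration.integrable_bound) (auto simp: norm_fst_snd_le)
    then show ?thesis unfolding weight_def by simp
  qed
  have w1: "weight z \<ge> 1" for z by (simp add: weight_def)
  have m1: "m \<ge> 1"
    using integral_mono[OF f0.integrable_const[of 1] int] w1 by (simp add: m_def f0.prob_space)
  obtain x v where x0: "\<And>z. x 0 z = fst z" and v0: "\<And>z. v 0 z = snd z"
    and x_meas: "\<And>t. t \<in> {0..S} \<Longrightarrow> x t \<in> borel_measurable f0"
    and marg: "\<And>t. t \<in> {0..S} \<Longrightarrow> first_marginal (f t) = distr f0 borel (x t)"
    and x_der: "\<And>t z. t \<in> {0..S} \<Longrightarrow> ((\<lambda>s. x s z) has_vector_derivative v t z) (at t within {0..S})"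
    and v_der: "\<And>t z. t \<in> {0..S} \<Longrightarrow> ((\<lambda>s. v s z) has_vector_derivative
        (1 / \<epsilon>) *\<^sub>R (- v t z - conv_measure G (distr f0 borel (x t)) (x t z))) (at t within {0..S})"
    using kinetic_characteristics[OF \<open>\<epsilon> > 0\<close> f S sol f0p] by metis
  have v_le: "norm (v s z) \<le> norm (snd z) + M" if "s \<in> {0..S}" for s z
    using velocity_bound[OF \<open>\<epsilon> > 0\<close> v_der _ that, of z]
      conv_bound[OF prob_measuresD(1)[OF distr_in_prob_measures[OF f0.prob_space_axioms x_meas]]] by (simp add: v0)
  define \<Lambda> where "\<Lambda> = 2 * L * (1 + m)"
  have \<Lambda>: "\<Lambda> > 0" using L_ge_1 m1 by (simp add: \<Lambda>_def)
  define e where "e = (\<lambda>(s, z). norm (x s z - X s (fst z)) / (exp (\<Lambda> * s) * weight z))"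
  have e_le: "e (s, z) \<le> c \<longleftrightarrow> norm (x s z - X s (fst z)) \<le> c * exp (\<Lambda> * s) * weight z" for s z c
    using w1[of z] by (simp add: e_def pos_divide_le_eq mult_ac)
  have main: "e (t, z) \<le> 2 * (\<epsilon> * (2 + M))" for z
  proof (rule halving_bound[where A = "{0..S} \<times> UNIV" and e = e])
    fix i assume "i \<in> {0..S} \<times> (UNIV :: ('a \<times> 'a) set)"
    then obtain s z where i: "i = (s, z)" and s: "s \<in> {0..S}" by auto
    have "norm (x s z - x 0 z) \<le> (norm (snd z) + M) * s - (norm (snd z) + M) * 0"
    proof (rule norm_diff_le_of_derivative_le[where a = 0 and b = S and f' = "\<lambda>r. v r z"])
      show "norm (v r z) \<le> norm (snd z) + M" if "r \<in> {0..S}" for r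
        by (rule v_le[OF that])
      show "((\<lambda>s. x s z) has_vector_derivative v r z) (at r within {0..S})" if "r \<in> {0..S}" for r
        by (rule x_der[OF that])
      show "((*) (norm (snd z) + M) has_vector_derivative norm (snd z) + M) (at r within {0..S})" for r
        unfolding has_real_derivative_iff_has_vector_derivative[symmetric] by (auto intro!: derivative_eq_intros)
    qed (use s in auto)
    moreover have "norm (X s (fst z) - X 0 (fst z)) \<le> M * s"
      using X_speed[of s 0 "fst z"] s S by simp
    ultimately have "norm (x s z - X s (fst z)) \<le> (norm (snd z) + M) * s + M * s"
      using norm_triangle_ineq4[of "x s z - x 0 z" "X s (fst z) - X 0 (fst z)"] by (simp add: x0 X_0)
    also have "\<dots> = s * (norm (snd z) + 2 * M)" by (simp add: algebra_simps)
    also have "\<dots> \<le> S * ((1 + 2 * M) * weight z)"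
      using s M_ge_1 by (intro mult_mono) (auto simp: weight_def algebra_simps)
    also have "\<dots> \<le> (S * (1 + 2 * M)) * exp (\<Lambda> * s) * weight z"
      using S M_ge_1 s \<Lambda> w1[of z] by (simp add: mult_le_cancel_left1 mult_le_cancel_right1)
    finally show "e i \<le> S * (1 + 2 * M)"
      unfolding i e_le .
  next
    fix \<theta> i assume "0 \<le> \<theta>" and \<theta>: "\<And>j. j \<in> {0..S} \<times> (UNIV :: ('a \<times> 'a) set) \<Longrightarrow> e j \<le> \<theta>"
      and "i \<in> {0..S} \<times> (UNIV :: ('a \<times> 'a) set)"
    then obtain s z where i: "i = (s, z)" and s: "s \<in> {0..S}" by auto
    have diff: "norm (x r z - X r (fst z)) \<le> \<theta> * exp (\<Lambda> * r) * weight z" if "r \<in> {0..S}" for r z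
      using \<theta>[of "(r, z)"] that by (simp add: e_le)
    define y where "y r = x r z + \<epsilon> *\<^sub>R v r z - X r (fst z)" for r
    let ?c = "\<theta> * weight z * (L * (1 + m))"
    have "norm (y s - y 0) \<le> ?c * exp (\<Lambda> * s) / \<Lambda> - ?c * exp (\<Lambda> * 0) / \<Lambda>"
    proof (rule norm_diff_le_of_derivative_le[where a = 0 and b = S])
      fix r assume r: "r \<in> {0..S}"
      have "((\<lambda>s. X s (fst z)) has_vector_derivative - conv_measure G (\<rho> r) (X r (fst z))) (at r within {0..S})"
        using r S X_deriv[of r "fst z"] unfolding \<rho>_def by (auto elim!: has_vector_derivative_within_subset)
      then have "(y has_vector_derivative v r z + \<epsilon> *\<^sub>R ((1 / \<epsilon>) *\<^sub>R (- v r z - conv_measure G (distr f0 borel (x r)) (x r z)))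
          - - conv_measure G (\<rho> r) (X r (fst z))) (at r within {0..S})"
        unfolding y_def
        by (intro has_vector_derivative_diff has_vector_derivative_add x_der[OF r]
            bounded_linear.has_vector_derivative[OF bounded_linear_scaleR_right v_der[OF r]])
      then show "(y has_vector_derivative conv_measure G (\<rho> r) (X r (fst z)) - conv_measure G (distr f0 borel (x r)) (x r z)) (at r within {0..S})"
        using \<open>\<epsilon> > 0\<close> by (simp add: algebra_simps)
      show "((\<lambda>s. ?c * exp (\<Lambda> * s) / \<Lambda>) has_vector_derivative ?c * exp (\<Lambda> * r)) (at r within {0..S})"
        using \<Lambda> by (intro has_vector_derivative_exp_weight) simp
      have "norm (conv_measure G (\<rho> r) (X r (fst z)) - conv_measure G (distr f0 borel (x r)) (x r z))
          \<le> L * (\<integral>z'. \<theta> * exp (\<Lambda> * r) * (weight z + weight z') \<partial>f0)"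
        unfolding \<rho>_eq conv_distr[OF X_meas] conv_distr[OF x_meas[OF r]]
      proof (rule G_integral_diff_le[OF f0.prob_space_axioms X_meas x_meas[OF r]])
        show "integrable f0 (\<lambda>z'. \<theta> * exp (\<Lambda> * r) * (weight z + weight z'))"
          using int by simp
        fix z'
        have "(X r (fst z) - X r (fst z')) - (x r z - x r z') = (x r z' - X r (fst z')) - (x r z - X r (fst z))"
          by simp
        also have "norm \<dots> \<le> \<theta> * exp (\<Lambda> * r) * weight z' + \<theta> * exp (\<Lambda> * r) * weight z"
          by (rule order_trans[OF norm_triangle_ineq4]) (intro add_mono diff r)
        finally show "norm ((X r (fst z) - X r (fst z')) - (x r z - x r z')) \<le> \<theta> * exp (\<Lambda> * r) * (weight z + weight z')"
          by (simp add: algebra_simps)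
      qed
      also have "\<dots> = L * (\<theta> * exp (\<Lambda> * r) * (weight z + m))"
        using int by (simp add: m_def f0.prob_space)
      also have "\<dots> \<le> L * (\<theta> * exp (\<Lambda> * r) * ((1 + m) * weight z))"
        using L_ge_1 \<open>0 \<le> \<theta>\<close> mult_left_mono[OF w1[of z], of m] m1 by (intro mult_left_mono) (auto simp: distrib_right)
      finally show "norm (conv_measure G (\<rho> r) (X r (fst z)) - conv_measure G (distr f0 borel (x r)) (x r z)) \<le> ?c * exp (\<Lambda> * r)"
        by (simp add: mult_ac)
    qed (use s in auto)
    also have "\<dots> \<le> ?c * exp (\<Lambda> * s) / \<Lambda>"
      using \<Lambda> \<open>0 \<le> \<theta>\<close> w1[of z] L_ge_1 m1 by simp
    also have "\<dots> = \<theta> / 2 * exp (\<Lambda> * s) * weight z"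
    proof -
      have "?c = \<Lambda> * (\<theta> * weight z / 2)" by (simp add: \<Lambda>_def)
      then show ?thesis unfolding \<open>?c = _\<close> using \<Lambda> by simp
    qed
    finally have 1: "norm (y s - y 0) \<le> \<theta> / 2 * exp (\<Lambda> * s) * weight z" .
    have "x s z - X s (fst z) = (y s - y 0) + (\<epsilon> *\<^sub>R snd z - \<epsilon> *\<^sub>R v s z)"
      by (simp add: y_def x0 v0 X_0)
    also have "norm \<dots> \<le> norm (y s - y 0) + (norm (\<epsilon> *\<^sub>R snd z) + norm (\<epsilon> *\<^sub>R v s z))"
      by (intro order_trans[OF norm_triangle_ineq] add_left_mono norm_triangle_ineq4)
    also have "norm (\<epsilon> *\<^sub>R snd z) + norm (\<epsilon> *\<^sub>R v s z) \<le> \<epsilon> * ((2 + M) * weight z)"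
    proof -
      have "(2 + M) * weight z = 2 + M + 2 * norm (snd z) + M * norm (snd z)"
        by (simp add: weight_def algebra_simps)
      moreover have "0 \<le> M * norm (snd z)" using M_ge_1 by simp
      ultimately have "norm (snd z) + norm (v s z) \<le> (2 + M) * weight z"
        using v_le[OF s, of z] by linarith
      then show ?thesis
        using \<open>\<epsilon> > 0\<close> by (simp flip: distrib_left)
    qed
    also have "\<epsilon> * ((2 + M) * weight z) \<le> (\<epsilon> * (2 + M)) * exp (\<Lambda> * s) * weight z"
      using \<open>\<epsilon> > 0\<close> M_ge_1 \<Lambda> s w1[of z] by (simp add: mult_le_cancel_left1)
    finally have "norm (x s z - X s (fst z)) \<le> (\<epsilon> * (2 + M) + \<theta> / 2) * exp (\<Lambda> * s) * weight z"
      using 1 by (simp add: algebra_simps)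
    then show "e i \<le> \<epsilon> * (2 + M) + \<theta> / 2"
      unfolding i e_le .
  qed (use t \<open>\<epsilon> > 0\<close> M_ge_1 in auto)
  let ?w = "\<lambda>z. 2 * (\<epsilon> * (2 + M)) * exp (\<Lambda> * t) * weight z"
  have "W1 (first_marginal (f t)) (\<rho> t) \<le> ennreal (\<integral>z. ?w z \<partial>f0)"
    unfolding marg[OF t] \<rho>_eq
    using main by (intro W1_distr_le[OF f0.prob_space_axioms x_meas[OF t] X_meas]) (auto simp: int e_le dist_norm)
  also have "(\<integral>z. ?w z \<partial>f0) = \<epsilon> * (2 * (2 + M) * exp (2 * L * (1 + m) * t) * m)"
    by (simp add: m_def \<Lambda>_def mult_ac)
  finally show ?thesis .
qed

end

section \<open>The limit theorem\<close>

theorem theorem5p1: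
  fixes T :: real
    and K :: "'a::euclidean_space \<Rightarrow> real"
    and gradK :: "'a \<Rightarrow> 'a"
    and f0 :: "('a \<times> 'a) measure"
    and f :: "real \<Rightarrow> real \<Rightarrow> ('a \<times> 'a) measure"
  assumes "T > 0"
    and "radial K"
    and "weak_gradient K gradK"
    and "continuous_on UNIV gradK"
    and "\<forall>i\<in>Basis. (\<lambda>x. gradK x \<bullet> i) \<in> W_1_infinity"
    and "f0 \<in> prob_measures_1"
    and "compact (msupport f0)"
    and "\<And>\<epsilon>. \<epsilon> > 0 \<Longrightarrow> f \<epsilon> \<in> C_P1 {0..<T}"
    and "\<And>\<epsilon> S. \<epsilon> > 0 \<Longrightarrow> 0 < S \<Longrightarrow> S < T \<Longrightarrow> kinetic_solution S \<epsilon> gradK f0 (f \<epsilon>)"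
  shows "\<exists>\<rho>. \<rho> \<in> C_P1 {0..<T} \<and>
    (\<forall>t\<in>{0..<T}. ((\<lambda>\<epsilon>. W1 (first_marginal (f \<epsilon> t)) (\<rho> t)) \<longlongrightarrow> 0) (at_right 0)) \<and>
    weak_solution T gradK (first_marginal f0) \<rho> \<and>
    (\<forall>\<rho>'. weak_solution T gradK (first_marginal f0) \<rho>' \<longrightarrow> (\<forall>t\<in>{0..<T}. \<rho>' t = \<rho> t))"
proof -
  obtain M L where "M \<ge> 1" "L \<ge> 1" "\<And>x. norm (gradK x) \<le> M" "\<And>x y. norm (gradK x - gradK y) \<le> L * norm (x - y)"
    using W_1_infinity_field_bounded_lipschitz[OF assms(4,5)] by metis
  then interpret lipschitz_field gradK M L
    by unfold_locales
  have f0: "f0 \<in> prob_measures" "integrable f0 norm"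
    using assms(6) by (auto simp: prob_measures_1_def)
  have \<rho>0: "first_marginal f0 \<in> prob_measures"
    by (rule first_marginal_prob[OF f0(1)])
  have fst_m: "fst \<in> borel_measurable f0"
    by (simp add: prob_measuresD[OF f0(1)] fst_borel_measurable)
  have \<rho>0_int: "integrable (first_marginal f0) norm"
  proof -
    have "integrable f0 (\<lambda>z. norm (fst z))"
      using f0(2) measurable_compose[OF fst_m borel_measurable_norm]
      by (rule Bochner_Integration.integrable_bound) (auto simp: norm_fst_snd_le)
    then show ?thesis
      unfolding first_marginal_def by (simp add: integrable_distr_eq[OF fst_m])
  qed
  obtain X where X: "\<And>x. X 0 x = x" "\<And>t. continuous_on UNIV (X t)"
    "\<And>t x. t \<in> {0..T} \<Longrightarrow> ((\<lambda>s. X s x) has_vector_derivative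
        - conv_measure gradK (distr (first_marginal f0) borel (X t)) (X t x)) (at t within {0..T})"
    using aggregation_flow_exists[OF \<rho>0, of T] \<open>T > 0\<close> by (metis less_imp_le)
  interpret flow: aggregation_flow gradK M L T "first_marginal f0" X
    by unfold_locales (use \<open>T > 0\<close> \<rho>0 X in auto)
  have limit: "((\<lambda>\<epsilon>. W1 (first_marginal (f \<epsilon> t)) (flow.\<rho> t)) \<longlongrightarrow> 0) (at_right 0)" if t: "t \<in> {0..<T}" for t
  proof -
    \<comment> \<open>Solutions are given on compact subintervals of \<open>[0,T)\<close>; this one contains \<open>t\<close>.\<close>
    define S where "S = (t + T) / 2"
    have S: "0 < S" "S < T" "t \<in> {0..S}" using t by (auto simp: S_def)
    define C where "C = 2 * (2 + M) * exp (2 * L * (1 + (\<integral>z. flow.weight z \<partial>f0)) * t) * (\<integral>z. flow.weight z \<partial>f0)"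
    have C: "W1 (first_marginal (f \<epsilon> t)) (flow.\<rho> t) \<le> ennreal (\<epsilon> * C)" if "\<epsilon> > 0" for \<epsilon>
      unfolding C_def
      by (rule flow.kinetic_limit_rate[OF assms(6) refl that assms(8)[OF that] S(1,2) assms(9)[OF that S(1,2)] S(3)])
    have lim: "((\<lambda>\<epsilon>. ennreal (\<epsilon> * C)) \<longlongrightarrow> ennreal 0) (at_right 0)"
      by (intro tendsto_ennrealI tendsto_mult_left_zero tendsto_ident_at)
    have upper: "\<forall>\<^sub>F \<epsilon> in at_right 0. W1 (first_marginal (f \<epsilon> t)) (flow.\<rho> t) \<le> ennreal (\<epsilon> * C)"
      using C by (auto simp: eventually_at_filter intro!: always_eventually)
    show ?thesis
      by (rule tendsto_sandwich[OF _ upper tendsto_const]) (use lim in simp_all)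
  qed
  have unique: "\<rho>' t = flow.\<rho> t" if "weak_solution T gradK (first_marginal f0) \<rho>'" "t \<in> {0..<T}" for \<rho>' t
    by (rule weak_solution_unique[OF lipschitz_field_axioms \<open>T > 0\<close> \<rho>0 that(1) flow.\<rho>_weak_solution that(2)])
  show ?thesis
    using flow.\<rho>_C_P1[OF \<rho>0_int] flow.\<rho>_weak_solution limit unique by blast
qed

end
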